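(* Let $\kappa_0\ge1$ be fixed and assume $\kappa\le\kappa_0$. Let $c_2,c_3,c_\lambda>0$ be constants. There is a constant $c_0>0$ such that if $p\ge\frac{c_0\log n}{n}$, $L\le c_2 n^{c_3}$ and $\lambda=c_\lambda\sqrt{\frac{np\log n}{L}}$, then with probability at least $1-O(n^{-5})$ the regularized MLE $\theta$ satisfies $$\frac{\big\|e^{\theta}-e^{\theta^*-\bar\theta^*\mathbf 1}\big\|_\infty}{\big\|e^{\theta^*-\bar\theta^*\mathbf 1}\big\|_\infty}\le C\sqrt{\frac{\log n}{npL}},$$ where $\bar\theta^*=\frac1n\mathbf 1^\top\theta^*$, $e^{v}$ denotes the entrywise exponential of a vector $v$, and $C$ depends only on $\kappa_0,c_2,c_3,c_\lambda$.
   Context: Bradley–Terry–Luce (BTL) setup. There are $n$ items with unknown preference scores $w_1^*\ge w_2^*\ge\cdots\ge w_n^*>0$, all lying in $[w_{\min},w_{\max}]$ with $w_{\min}>0$; set $\theta_i^*=\log w_i^*$ and $\kappa=w_{\max}/w_{\min}$. A comparison graph $\mathcal G=(\{1,\dots,n\},\mathcal E)$ is drawn from the Erdős–Rényi model $\mathcal G_{n,p}$ (each unordered pair is an edge independently with probability $p$). For each edge $(i,j)\in\mathcal E$ one observes $L$ comparisons $y_{i,j}^{(l)}$, $l=1,\dots,L$, where $y_{i,j}^{(l)}=1$ with probability $y^*_{i,j}:=\frac{w_j^*}{w_i^*+w_j^*}$ and $0$ otherwise, with the convention $y_{j,i}^{(l)}=1-y_{i,j}^{(l)}$; all comparisons are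 mutually independent and independent of $\mathcal G$. Let $y_{i,j}=\frac1L\sum_{l=1}^L y_{i,j}^{(l)}$. Regularized MLE: with $\mathcal L(\theta;y)=\sum_{(i,j)\in\mathcal E,\,i>j}\{-y_{j,i}(\theta_i-\theta_j)+\log(1+e^{\theta_i-\theta_j})\}$ and $\mathcal L_\lambda(\theta;y)=\mathcal L(\theta;y)+\frac\lambda2\|\theta\|_2^2$, the regularized MLE $\theta$ is the minimizer of $\mathcal L_\lambda(\cdot;y)$ over $\mathbb R^n$. *)

theory Defs
  imports "HOL-Probability.Probability"
begin

text \<open>Items are indexed 0,...,n-1. Unordered pairs are stored as (i,j) with i < j.\<close>

definition btl_edges_pmf :: "nat \<Rightarrow> real \<Rightarrow> (nat \<times> nat \<Rightarrow> bool) pmf" where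
  "btl_edges_pmf n p = Pi_pmf {(i,j). i < j \<and> j < n} False (\<lambda>_. bernoulli_pmf p)"

text \<open>Comparison outcomes y_{i,j}^{(l)} for i < j, l < L; True (=1) with probability
  w_j/(w_i+w_j). Outcomes are generated for all pairs independently of the graph; only those
  on edges of G enter the loss (same joint law as observing them only on edges).\<close>
definition btl_comp_pmf :: "nat \<Rightarrow> nat \<Rightarrow> (nat \<Rightarrow> real) \<Rightarrow> (nat \<times> nat \<times> nat \<Rightarrow> bool) pmf" where
  "btl_comp_pmf n L w = Pi_pmf {(i,j,l). i < j \<and> j < n \<and> l < L} False
      (\<lambda>(i,j,l). bernoulli_pmf (w j / (w i + w j)))"

definition btl_avg :: "nat \<Rightarrow> (nat \<times> nat \<times> nat \<Rightarrow> bool) \<Rightarrow> nat \<Rightarrow> nat \<Rightarrow> real" where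
  "btl_avg L Y i j = (\<Sum>l<L. if Y (i,j,l) then 1 else 0) / real L"

text \<open>Negative log-likelihood: sum over edges (i,j) with i > j (stored as (j,i)).\<close>
definition btl_loss :: "nat \<Rightarrow> nat \<Rightarrow> (nat \<times> nat \<Rightarrow> bool) \<Rightarrow> (nat \<times> nat \<times> nat \<Rightarrow> bool)
    \<Rightarrow> (nat \<Rightarrow> real) \<Rightarrow> real" where
  "btl_loss n L G Y \<theta> = (\<Sum>(j,i)\<in>{(j,i). j < i \<and> i < n \<and> G (j,i)}.
       - btl_avg L Y j i * (\<theta> i - \<theta> j) + ln (1 + exp (\<theta> i - \<theta> j)))"

definition btl_reg_loss :: "nat \<Rightarrow> nat \<Rightarrow> real \<Rightarrow> (nat \<times> nat \<Rightarrow> bool) \<Rightarrow> (nat \<times> nat \<times> nat \<Rightarrow> bool)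
    \<Rightarrow> (nat \<Rightarrow> real) \<Rightarrow> real" where
  "btl_reg_loss n L lam G Y \<theta> = btl_loss n L G Y \<theta> + lam / 2 * (\<Sum>i<n. (\<theta> i)\<^sup>2)"

text \<open>theta (restricted to {0..<n}) minimizes the regularized loss over R^n.\<close>
definition btl_is_reg_mle :: "nat \<Rightarrow> nat \<Rightarrow> real \<Rightarrow> (nat \<times> nat \<Rightarrow> bool) \<Rightarrow> (nat \<times> nat \<times> nat \<Rightarrow> bool)
    \<Rightarrow> (nat \<Rightarrow> real) \<Rightarrow> bool" where
  "btl_is_reg_mle n L lam G Y \<theta> \<longleftrightarrow> (\<forall>\<theta>'. btl_reg_loss n L lam G Y \<theta> \<le> btl_reg_loss n L lam G Y \<theta>')"

definition vnorm_inf :: "nat \<Rightarrow> (nat \<Rightarrow> real) \<Rightarrow> real" where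
  "vnorm_inf n v = Max ((\<lambda>i. \<bar>v i\<bar>) ` {..<n})"

text \<open>Entries of e^{theta* - mean(theta*) 1}, with theta*_i = ln w_i.\<close>
definition btl_centered :: "nat \<Rightarrow> (nat \<Rightarrow> real) \<Rightarrow> nat \<Rightarrow> real" where
  "btl_centered n w i = exp (ln (w i) - (\<Sum>k<n. ln (w k)) / real n)"

end

theory Submission
  imports Defs
begin

text \<open>
  Leave-one-out argument with box-constrained minimisers. The regularised MLE has coordinate sum
  zero, so adding the penalty \<open>p/2 (\<Sum> x)\<^sup>2\<close> to the loss does not move it. The penalised loss is
  strongly convex with modulus of order \<open>n p\<close> on the unit sup-norm box around the centred truth
  \<open>ts\<close>: by Chernoff and a union bound every cut of the graph (also with one vertex deleted) has the
  expected order of edges, and Cheeger's inequality turns this into a spectral gap.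

  Let \<open>x\<close> minimise over the box, \<open>d = x - ts\<close>, \<open>M\<close> the sup norm of \<open>d\<close> and
  \<open>eps = sqrt (ln n / (n p L))\<close>. Strong convexity gives an \<open>l2\<close> bound of order \<open>sqrt n eps\<close> on \<open>d\<close>. At a
  coordinate \<open>m\<close> where \<open>\<bar>d m\<bar> = M\<close>, the first-order condition bounds \<open>n p M\<close> by
  \<open>n p eps\<close> plus the sum of \<open>d\<close> over the neighbours of \<open>m\<close> (a maximum principle, valid also on the
  boundary of the box). In that sum \<open>x\<close> is replaced by the minimiser with all edges at \<open>m\<close> deleted,
  which is \<open>l2\<close>-close to \<open>x\<close> and independent of the edges at \<open>m\<close>, so that Bernstein's inequality
  applies. This gives \<open>M = O(eps)\<close>, hence \<open>x\<close> is an interior minimiser and equals the MLE.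
\<close>

subsection \<open>The logistic function\<close>

text \<open>The derivative of the logistic function decays exponentially, so the loss has curvature
  of order \<open>n p\<close> only where score differences are bounded. Working in a box secures
  this curvature before anything is known about the location of the MLE. The edge terms do not see a
  constant added to all scores, and the ridge weight \<open>lam = clam * (n p eps)\<close> controls
  that direction only with a modulus smaller than \<open>n p\<close> by a factor of order
  \<open>eps\<close>. The penalty supplies the missing modulus. A deleted vertex has no edges left,
  so its coordinate is frozen at the truth in the leave-one-out problem, and the two minimisers are
  compared on the other coordinates. The argument is circular in \<open>M\<close>: the distance to
  the leave-one-out minimiser and the Bernstein bound both contain \<open>M\<close>. In the
  neighbour sum these terms carry a factor \<open>1 / c0\<close>, because
  \<open>c0 * ln n <= n p\<close>. A large \<open>c0\<close>, depending only on
  \<open>B = ln kappa0\<close>, makes them at most half of what the maximum principle provides. A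
  second largeness condition on \<open>c0\<close> keeps the minimiser off the boundary of the
  box.\<close>

definition sigmoid :: "real \<Rightarrow> real" where
  "sigmoid t = exp t / (1 + exp t)"

lemma sigmoid_minus: "sigmoid (- t) = 1 - sigmoid t"
proof -
  have "1 + exp t > 0" by (simp add: add_pos_pos)
  then show ?thesis
    by (simp add: sigmoid_def exp_minus divide_simps)
qed

lemma sigmoid_ln_diff:
  assumes "a > 0" "b > 0"
  shows "sigmoid (ln a - ln b) = a / (b + a)"
proof -
  have "exp (ln a - ln b) = a / b"
    using assms by (simp add: exp_diff)
  moreover have "(a / b) / (1 + a / b) = a / (b + a)"
    using assms by (simp add: divide_simps add_pos_pos)
  ultimately show ?thesis
    by (simp add: sigmoid_def)
qed

lemma DERIV_ln_one_plus_exp: "((\<lambda>t. ln (1 + exp t)) has_real_derivative sigmoid t) (at t)"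
proof -
  have "1 + exp t > 0" by (simp add: add_pos_pos)
  then show ?thesis
    by (auto intro!: derivative_eq_intros simp: sigmoid_def)
qed

lemma DERIV_sigmoid: "(sigmoid has_real_derivative 1 / (2 + exp t + exp (- t))) (at t)"
proof -
  have "1 + exp t > 0" by (simp add: add_pos_pos)
  then have "((\<lambda>t. exp t / (1 + exp t)) has_real_derivative
      (exp t * (1 + exp t) - exp t * exp t) / ((1 + exp t) * (1 + exp t))) (at t)"
    by (auto intro!: derivative_eq_intros)
  moreover have "(exp t * (1 + exp t) - exp t * exp t) / ((1 + exp t) * (1 + exp t))
      = 1 / (2 + exp t + exp (- t))"
  proof -
    have "2 + exp t + exp (- t) = (1 + exp t) * (1 + exp t) / exp t"
      by (simp add: exp_minus field_simps)
    then show ?thesis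
      by (simp add: algebra_simps)
  qed
  ultimately show ?thesis
    unfolding sigmoid_def by simp
qed

text \<open>On \<open>[-R, R]\<close> the derivative \<open>1 / (2 + exp z + exp (- z))\<close> is
  at least \<open>exp (- R) / 4\<close>, since both exponentials are at most \<open>exp R\<close>.
  This factor becomes the curvature constant \<open>c\<close>.\<close>

lemma sigmoid_diff_bounds:
  assumes "t \<le> s" "\<bar>s\<bar> \<le> R" "\<bar>t\<bar> \<le> R"
  shows "exp (- R) / 4 * (s - t) \<le> sigmoid s - sigmoid t"
proof (cases "s = t")
  case False
  with assms have "t < s" by simp
  then obtain z where z: "t < z" "z < s"
    and eq: "sigmoid s - sigmoid t = (s - t) * (1 / (2 + exp z + exp (- z)))"
    using MVT2[of t s sigmoid "\<lambda>z. 1 / (2 + exp z + exp (- z))"] DERIV_sigmoid by blast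
  have "exp z \<le> exp R" "exp (- z) \<le> exp R" "1 \<le> exp R"
    using z assms by auto
  then have "2 + exp z + exp (- z) \<le> 4 * exp R"
    by linarith
  then have "1 / (4 * exp R) \<le> 1 / (2 + exp z + exp (- z))"
    by (intro divide_left_mono) (auto intro!: mult_pos_pos add_pos_pos)
  then have "exp (- R) / 4 \<le> 1 / (2 + exp z + exp (- z))"
    by (simp add: exp_minus field_simps)
  then have "(s - t) * (exp (- R) / 4) \<le> (s - t) * (1 / (2 + exp z + exp (- z)))"
    using \<open>t < s\<close> by (intro mult_left_mono) auto
  then show ?thesis
    using eq by (simp add: mult.commute)
qed simp

lemma sigmoid_mono: "t \<le> s \<Longrightarrow> sigmoid t \<le> sigmoid s"
proof -
  assume "t \<le> s"
  then have "exp (- max \<bar>s\<bar> \<bar>t\<bar>) / 4 * (s - t) \<le> sigmoid s - sigmoid t"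
    by (intro sigmoid_diff_bounds) auto
  moreover have "0 \<le> exp (- max \<bar>s\<bar> \<bar>t\<bar>) / 4 * (s - t)"
    using \<open>t \<le> s\<close> by simp
  ultimately show ?thesis by linarith
qed

lemma sigmoid_lipschitz: "\<bar>sigmoid s - sigmoid t\<bar> \<le> \<bar>s - t\<bar>"
proof -
  have *: "sigmoid s - sigmoid t \<le> s - t" if "t \<le> s" for s t
  proof (cases "s = t")
    case False
    with that have "t < s" by simp
    then obtain z where
      eq: "sigmoid s - sigmoid t = (s - t) * (1 / (2 + exp z + exp (- z)))"
      using MVT2[of t s sigmoid "\<lambda>z. 1 / (2 + exp z + exp (- z))"] DERIV_sigmoid by blast
    have "2 + exp z + exp (- z) \<ge> 1"
      using exp_gt_zero[of z] exp_gt_zero[of "- z"] by linarith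
    then have "1 / (2 + exp z + exp (- z)) \<le> 1"
      by (subst divide_le_eq_1) linarith
    then have "(s - t) * (1 / (2 + exp z + exp (- z))) \<le> (s - t) * 1"
      using \<open>t < s\<close> by (intro mult_left_mono) auto
    then show ?thesis
      using eq by simp
  qed simp
  show ?thesis
    using *[of s t] *[of t s] sigmoid_mono[of s t] sigmoid_mono[of t s] by linarith
qed

lemma sigmoid_strongly_monotone:
  assumes "\<bar>s\<bar> \<le> R" "\<bar>t\<bar> \<le> R"
  shows "exp (- R) / 4 * (s - t)\<^sup>2 \<le> (sigmoid s - sigmoid t) * (s - t)"
proof -
  have *: "exp (- R) / 4 * (s - t)\<^sup>2 \<le> (sigmoid s - sigmoid t) * (s - t)"
    if "t \<le> s" "\<bar>s\<bar> \<le> R" "\<bar>t\<bar> \<le> R" for s t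
    using mult_right_mono[OF sigmoid_diff_bounds[OF that], of "s - t"] that
    by (simp add: power2_eq_square mult.assoc)
  show ?thesis
  proof (cases "t \<le> s")
    case False
    then have "exp (- R) / 4 * (t - s)\<^sup>2 \<le> (sigmoid t - sigmoid s) * (t - s)"
      using assms by (intro *) auto
    then show ?thesis
      by (simp add: power2_commute algebra_simps)
  next
    case True
    then show ?thesis
      using assms by (rule *)
  qed
qed

lemma sigmoid_monotone: "0 \<le> (sigmoid s - sigmoid t) * (s - t)"
proof (cases "s \<le> t")
  case True
  then show ?thesis
    using sigmoid_mono[of s t] by (intro mult_nonpos_nonpos) auto
next
  case False
  then show ?thesis
    using sigmoid_mono[of t s] by (intro mult_nonneg_nonneg) auto
qed

subsection \<open>The penalised loss and its box-constrained minimisers\<close>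

text \<open>The sum runs over ordered pairs, so each edge of the symmetric weight \<open>A\<close> is counted twice; both
  terms agree because \<open>y j i = 1 - y i j\<close>.\<close>

definition pobj :: "nat \<Rightarrow> (nat \<Rightarrow> nat \<Rightarrow> real) \<Rightarrow> (nat \<Rightarrow> nat \<Rightarrow> real) \<Rightarrow> real \<Rightarrow> real \<Rightarrow> (nat \<Rightarrow> real) \<Rightarrow> real" where
  "pobj n A y lam p x =
     (\<Sum>i<n. \<Sum>j<n. A i j * (ln (1 + exp (x i - x j)) - y i j * (x i - x j))) / 2
     + lam / 2 * (\<Sum>i<n. (x i)\<^sup>2) + p / 2 * (\<Sum>i<n. x i)\<^sup>2"

definition pgrad :: "nat \<Rightarrow> (nat \<Rightarrow> nat \<Rightarrow> real) \<Rightarrow> (nat \<Rightarrow> nat \<Rightarrow> real) \<Rightarrow> real \<Rightarrow> real \<Rightarrow> (nat \<Rightarrow> real) \<Rightarrow> nat \<Rightarrow> real" where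
  "pgrad n A y lam p x i =
     (\<Sum>j<n. A i j * (sigmoid (x i - x j) - y i j)) + lam * x i + p * (\<Sum>k<n. x k)"

text \<open>The residual of an edge changes sign with its orientation. Exchanging the summation
  indices merges the two orientations, and the resulting factor 2 cancels the division by 2 in
  \<open>pobj\<close>.\<close>

lemma sum_antisym:
  fixes r :: "nat \<Rightarrow> nat \<Rightarrow> real" and d :: "nat \<Rightarrow> real"
  assumes "\<And>i j. i < n \<Longrightarrow> j < n \<Longrightarrow> r j i = - r i j"
  shows "(\<Sum>i<n. \<Sum>j<n. r i j * (d i - d j)) = 2 * (\<Sum>i<n. \<Sum>j<n. r i j * d i)"
proof -
  have "(\<Sum>i<n. \<Sum>j<n. r i j * d j) = (\<Sum>i<n. \<Sum>j<n. r j i * d i)"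
    by (rule sum.swap)
  also have "\<dots> = (\<Sum>i<n. \<Sum>j<n. - (r i j * d i))"
    by (intro sum.cong refl, subst assms) auto
  finally have "(\<Sum>i<n. \<Sum>j<n. r i j * d j) = - (\<Sum>i<n. \<Sum>j<n. r i j * d i)"
    by (simp add: sum_negf)
  then show ?thesis
    by (simp add: right_diff_distrib sum_subtractf)
qed

text \<open>This identifies \<open>pgrad\<close> as the gradient of \<open>pobj\<close>. The flip
  rule for \<open>y\<close> is required only on edges: on the diagonal it would force
  \<open>y i i = 1/2\<close>.\<close>

lemma pobj_directional_derivative:
  assumes A: "\<And>i j. i < n \<Longrightarrow> j < n \<Longrightarrow> A j i = A i j"
    and y: "\<And>i j. i < n \<Longrightarrow> j < n \<Longrightarrow> A i j \<noteq> 0 \<Longrightarrow> y j i = 1 - y i j"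
  shows "((\<lambda>t. pobj n A y lam p (\<lambda>i. x i + t * d i)) has_real_derivative
           (\<Sum>i<n. pgrad n A y lam p x i * d i)) (at 0)"
proof -
  define r where "r i j = A i j * (sigmoid (x i - x j) - y i j)" for i j
  have anti: "r j i = - r i j" if "i < n" "j < n" for i j
  proof (cases "A i j = 0")
    case True
    then show ?thesis using A[OF that] by (simp add: r_def)
  next
    case False
    have "sigmoid (x j - x i) = 1 - sigmoid (x i - x j)"
      using sigmoid_minus[of "x i - x j"] by simp
    then show ?thesis
      unfolding r_def A[OF that] y[OF that False] by (simp only: right_diff_distrib)
  qed
  have edge: "((\<lambda>t. A i j * (ln (1 + exp ((x i + t * d i) - (x j + t * d j)))
        - y i j * ((x i + t * d i) - (x j + t * d j)))) has_real_derivative r i j * (d i - d j)) (at 0)"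
    for i j
  proof -
    have lin: "((\<lambda>t. (x i + t * d i) - (x j + t * d j)) has_real_derivative (d i - d j)) (at 0)"
      by (auto intro!: derivative_eq_intros)
    have "((\<lambda>t. ln (1 + exp ((x i + t * d i) - (x j + t * d j)))) has_real_derivative
        sigmoid ((x i + 0 * d i) - (x j + 0 * d j)) * (d i - d j)) (at 0)"
      by (rule DERIV_chain2[OF DERIV_ln_one_plus_exp lin])
    from DERIV_cmult[OF DERIV_diff[OF this DERIV_cmult[OF lin, of "y i j"]], of "A i j"]
    show ?thesis
      by (simp add: r_def algebra_simps)
  qed
  have "((\<lambda>t. pobj n A y lam p (\<lambda>i. x i + t * d i)) has_real_derivative
      (\<Sum>i<n. \<Sum>j<n. r i j * (d i - d j)) / 2 + lam / 2 * (\<Sum>i<n. 2 * x i * d i)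
      + p / 2 * (2 * (\<Sum>i<n. x i) * (\<Sum>i<n. d i))) (at 0)"
    unfolding pobj_def
    by (intro DERIV_add DERIV_cdivide DERIV_cmult DERIV_sum edge)
       (auto intro!: derivative_eq_intros)
  also have "(\<Sum>i<n. \<Sum>j<n. r i j * (d i - d j)) = 2 * (\<Sum>i<n. \<Sum>j<n. r i j * d i)"
    by (rule sum_antisym) (rule anti)
  also have "2 * (\<Sum>i<n. \<Sum>j<n. r i j * d i) / 2 + lam / 2 * (\<Sum>i<n. 2 * x i * d i)
      + p / 2 * (2 * (\<Sum>i<n. x i) * (\<Sum>i<n. d i)) = (\<Sum>i<n. pgrad n A y lam p x i * d i)"
  proof -
    have "(\<Sum>i<n. pgrad n A y lam p x i * d i) = (\<Sum>i<n. (\<Sum>j<n. r i j) * d i)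
        + (\<Sum>i<n. lam * x i * d i) + (\<Sum>i<n. p * (\<Sum>k<n. x k) * d i)"
      unfolding sum.distrib[symmetric] pgrad_def r_def by (intro sum.cong refl) (simp add: distrib_right)
    also have "(\<Sum>i<n. p * (\<Sum>k<n. x k) * d i) = p * (\<Sum>k<n. x k) * (\<Sum>i<n. d i)"
      by (simp add: sum_distrib_left)
    also have "(\<Sum>i<n. (\<Sum>j<n. r i j) * d i) = (\<Sum>i<n. \<Sum>j<n. r i j * d i)"
      by (simp add: sum_distrib_right)
    also have "(\<Sum>i<n. lam * x i * d i) = lam / 2 * (\<Sum>i<n. 2 * x i * d i)"
      by (simp add: sum_distrib_left mult.assoc)
    finally show ?thesis
      by simp
  qed
  finally show ?thesis .
qed

section \<open>First-order conditions for minimisation over a box\<close>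

lemma directional_derivative_nonneg:
  fixes g :: "real \<Rightarrow> real"
  assumes "(g has_real_derivative D) (at 0)" "e > 0"
    and "\<And>t. 0 < t \<Longrightarrow> t < e \<Longrightarrow> g 0 \<le> g t"
  shows "0 \<le> D"
proof (rule ccontr)
  assume "\<not> 0 \<le> D"
  then obtain d where d: "d > 0" "\<And>h. h > 0 \<Longrightarrow> h < d \<Longrightarrow> g (0 + h) < g 0"
    using DERIV_neg_dec_right[OF assms(1)] by force
  define t where "t = min d e / 2"
  have "0 < t" "t < d" "t < e"
    using d(1) assms(2) by (auto simp: t_def min_def)
  then show False
    using d(2)[of t] assms(3)[of t] by simp
qed

text \<open>A radius 0 freezes a coordinate at its centre. This is how the indices beyond
  \<open>n\<close> and the deleted vertex are treated.\<close>

definition rect :: "(nat \<Rightarrow> real) \<Rightarrow> (nat \<Rightarrow> real) \<Rightarrow> (nat \<Rightarrow> real) set" where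
  "rect c r = {x. \<forall>i. \<bar>x i - c i\<bar> \<le> r i}"

definition rect_minimizer where
  "rect_minimizer n A y lam p c r x \<longleftrightarrow> x \<in> rect c r \<and>
     (\<forall>z\<in>rect c r. pobj n A y lam p x \<le> pobj n A y lam p z)"

text \<open>A product of compact intervals over all of \<open>nat\<close> is compact by Tychonoff,
  and the objective is continuous in the product topology because it reads finitely many
  coordinates.\<close>

lemma rect_minimizer_exists:
  assumes r: "\<And>i. 0 \<le> r i"
  shows "\<exists>x. rect_minimizer n A y lam p c r x"
proof -
  have eq: "rect c r = PiE UNIV (\<lambda>i. {c i - r i .. c i + r i})"
    by (auto simp: rect_def PiE_def Pi_def abs_le_iff algebra_simps)
  have "compactin (product_topology (\<lambda>i. euclidean) UNIV) (rect c r)"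
    unfolding eq by (auto simp: compactin_PiE)
  then have "compact (rect c r)"
    by (simp add: euclidean_product_topology)
  moreover have "rect c r \<noteq> {}"
    using r by (auto simp: rect_def intro!: exI[of _ c])
  moreover have "continuous_on (rect c r) (pobj n A y lam p)"
  proof -
    have coord: "continuous_on (rect c r) (\<lambda>x. x i)" for i
      by (rule continuous_on_subset[OF continuous_on_product_coordinates]) simp
    have pos: "1 + exp t \<noteq> 0" for t :: real
      using exp_gt_zero[of t] by linarith
    show ?thesis
      unfolding pobj_def by (intro continuous_intros coord) (use pos in auto)
  qed
  ultimately obtain x where "x \<in> rect c r" "\<And>z. z \<in> rect c r \<Longrightarrow> pobj n A y lam p x \<le> pobj n A y lam p z"
    using continuous_attains_inf by metis
  then show ?thesis
    by (auto simp: rect_minimizer_def)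
qed

lemma rect_segment:
  assumes "x \<in> rect c r" "z \<in> rect c r" "0 \<le> t" "t \<le> 1"
  shows "(\<lambda>i. x i + t * (z i - x i)) \<in> rect c r"
  unfolding rect_def
proof (safe)
  fix i
  have "\<bar>x i + t * (z i - x i) - c i\<bar> = \<bar>(1 - t) * (x i - c i) + t * (z i - c i)\<bar>"
    by (simp add: algebra_simps)
  also have "\<dots> \<le> (1 - t) * \<bar>x i - c i\<bar> + t * \<bar>z i - c i\<bar>"
    using assms by (intro abs_triangle_ineq[THEN order_trans]) (simp add: abs_mult)
  also have "\<dots> \<le> (1 - t) * r i + t * r i"
    using assms by (intro add_mono mult_left_mono) (auto simp: rect_def)
  finally show "\<bar>x i + t * (z i - x i) - c i\<bar> \<le> r i"
    by (simp add: algebra_simps)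
qed

text \<open>By convexity the segment from \<open>x\<close> to \<open>z\<close> stays in the box, so
  the one-sided derivative along it is nonnegative. This inequality replaces the vanishing of the
  gradient, which may fail on the boundary.\<close>

lemma rect_minimizer_variational:
  assumes A: "\<And>i j. i < n \<Longrightarrow> j < n \<Longrightarrow> A j i = A i j"
    and y: "\<And>i j. i < n \<Longrightarrow> j < n \<Longrightarrow> A i j \<noteq> 0 \<Longrightarrow> y j i = 1 - y i j"
    and x: "rect_minimizer n A y lam p c r x" and z: "z \<in> rect c r"
  shows "0 \<le> (\<Sum>i<n. pgrad n A y lam p x i * (z i - x i))"
proof (rule directional_derivative_nonneg[OF pobj_directional_derivative, where e = 1])
  fix t :: real assume "0 < t" "t < 1"
  then have "(\<lambda>i. x i + t * (z i - x i)) \<in> rect c r"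
    using x z by (intro rect_segment) (auto simp: rect_minimizer_def)
  then show "pobj n A y lam p (\<lambda>i. x i + 0 * (z i - x i)) \<le> pobj n A y lam p (\<lambda>i. x i + t * (z i - x i))"
    using x by (simp add: rect_minimizer_def)
qed (rule A y | simp)+

section \<open>Monotonicity of the gradient\<close>

lemma pgrad_difference:
  assumes A: "\<And>i j. i < n \<Longrightarrow> j < n \<Longrightarrow> A j i = A i j"
  shows "(\<Sum>i<n. (pgrad n A y lam p x i - pgrad n A y lam p z i) * (x i - z i)) =
     (\<Sum>i<n. \<Sum>j<n. A i j * ((sigmoid (x i - x j) - sigmoid (z i - z j)) * ((x i - x j) - (z i - z j)))) / 2
     + lam * (\<Sum>i<n. (x i - z i)\<^sup>2) + p * (\<Sum>i<n. x i - z i)\<^sup>2"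
proof -
  define v where "v i = x i - z i" for i
  define r where "r i j = A i j * (sigmoid (x i - x j) - sigmoid (z i - z j))" for i j
  have "r j i = - r i j" if "i < n" "j < n" for i j
  proof -
    have "sigmoid (x j - x i) = 1 - sigmoid (x i - x j)" "sigmoid (z j - z i) = 1 - sigmoid (z i - z j)"
      using sigmoid_minus[of "x i - x j"] sigmoid_minus[of "z i - z j"] by simp_all
    then show ?thesis
      unfolding r_def A[OF that] by (simp only: right_diff_distrib)
  qed
  from sum_antisym[of n r v, OF this]
  have "(\<Sum>i<n. \<Sum>j<n. r i j * v i) = (\<Sum>i<n. \<Sum>j<n. r i j * (v i - v j)) / 2"
    by simp
  also have "\<dots> = (\<Sum>i<n. \<Sum>j<n. A i j * ((sigmoid (x i - x j) - sigmoid (z i - z j)) * ((x i - x j) - (z i - z j)))) / 2"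
    by (simp add: r_def v_def algebra_simps)
  finally have 1: "(\<Sum>i<n. \<Sum>j<n. r i j * v i) = \<dots>" .
  have "pgrad n A y lam p x i - pgrad n A y lam p z i = (\<Sum>j<n. r i j) + lam * v i + p * (\<Sum>k<n. v k)" for i
    by (simp add: pgrad_def r_def v_def sum_subtractf sum.distrib algebra_simps)
  then have "(\<Sum>i<n. (pgrad n A y lam p x i - pgrad n A y lam p z i) * v i) =
      (\<Sum>i<n. \<Sum>j<n. r i j * v i) + lam * (\<Sum>i<n. (v i)\<^sup>2) + p * (\<Sum>i<n. v i)\<^sup>2"
    by (simp add: sum.distrib sum_distrib_left sum_distrib_right power2_eq_square algebra_simps)
  then show ?thesis
    unfolding 1 by (simp add: v_def)
qed

text \<open>Edges contribute with the logistic curvature \<open>exp (- R) / 4\<close>, and the ridge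
  term is nonnegative. The gap is assumed for the single vector \<open>x - z\<close>, so that the
  lemma also serves a graph with a deleted vertex, where a gap holds only for vectors vanishing
  there.\<close>

lemma pgrad_strongly_monotone:
  assumes A: "\<And>i j. i < n \<Longrightarrow> j < n \<Longrightarrow> A j i = A i j" "\<And>i j. 0 \<le> A i j"
    and R: "\<And>i j. i < n \<Longrightarrow> j < n \<Longrightarrow> \<bar>x i - x j\<bar> \<le> R" "\<And>i j. i < n \<Longrightarrow> j < n \<Longrightarrow> \<bar>z i - z j\<bar> \<le> R"
    and pos: "0 \<le> R" "0 \<le> lam" "0 \<le> p"
    and gap: "mu * (\<Sum>i<n. (x i - z i)\<^sup>2) \<le>
        (\<Sum>i<n. \<Sum>j<n. A i j * ((x i - z i) - (x j - z j))\<^sup>2) / 2 + p * (\<Sum>i<n. x i - z i)\<^sup>2"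
  shows "exp (- R) / 4 * mu * (\<Sum>i<n. (x i - z i)\<^sup>2) \<le>
     (\<Sum>i<n. (pgrad n A y lam p x i - pgrad n A y lam p z i) * (x i - z i))"
proof -
  let ?c = "exp (- R) / 4"
  let ?Q = "(\<Sum>i<n. \<Sum>j<n. A i j * ((x i - z i) - (x j - z j))\<^sup>2) / 2"
  have c: "0 < ?c" "?c \<le> 1"
    using pos(1) exp_le_one_iff[of "- R"] by (auto simp del: exp_le_one_iff)
  have "?c * mu * (\<Sum>i<n. (x i - z i)\<^sup>2) \<le> ?c * (?Q + p * (\<Sum>i<n. x i - z i)\<^sup>2)"
    using mult_left_mono[OF gap, of ?c] c by (simp add: mult.assoc)
  also have "\<dots> \<le> ?c * ?Q + p * (\<Sum>i<n. x i - z i)\<^sup>2"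
    using mult_right_mono[OF c(2), of "p * (\<Sum>i<n. x i - z i)\<^sup>2"] pos(3)
    by (simp add: distrib_left)
  also have "?c * ?Q \<le> (\<Sum>i<n. \<Sum>j<n. A i j * ((sigmoid (x i - x j) - sigmoid (z i - z j)) * ((x i - x j) - (z i - z j)))) / 2"
  proof -
    have "?c * ?Q = (\<Sum>i<n. \<Sum>j<n. A i j * (?c * ((x i - x j) - (z i - z j))\<^sup>2)) / 2"
      by (simp add: sum_distrib_left algebra_simps)
    also have "\<dots> \<le> (\<Sum>i<n. \<Sum>j<n. A i j * ((sigmoid (x i - x j) - sigmoid (z i - z j)) * ((x i - x j) - (z i - z j)))) / 2"
      by (intro divide_right_mono sum_mono mult_left_mono sigmoid_strongly_monotone) (use R A in auto)
    finally show ?thesis .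
  qed
  finally have "?c * mu * (\<Sum>i<n. (x i - z i)\<^sup>2) \<le>
      (\<Sum>i<n. \<Sum>j<n. A i j * ((sigmoid (x i - x j) - sigmoid (z i - z j)) * ((x i - x j) - (z i - z j)))) / 2
      + p * (\<Sum>i<n. x i - z i)\<^sup>2"
    by simp
  moreover have "0 \<le> lam * (\<Sum>i<n. (x i - z i)\<^sup>2)"
    using pos(2) by (intro mult_nonneg_nonneg sum_nonneg) auto
  moreover note pgrad_difference[of n A y lam p x z, OF A(1)]
  ultimately show ?thesis
    by linarith
qed

text \<open>Monotonicity of the logistic function holds on the whole line, so no bound on
  \<open>x\<close> and \<open>z\<close> enters. The small modulus \<open>lam\<close> is enough to
  identify the MLE, whose position is unknown when this is applied.\<close>

lemma pgrad_monotone: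
  assumes A: "\<And>i j. i < n \<Longrightarrow> j < n \<Longrightarrow> A j i = A i j" "\<And>i j. 0 \<le> A i j" and "0 \<le> p"
  shows "lam * (\<Sum>i<n. (x i - z i)\<^sup>2) \<le>
     (\<Sum>i<n. (pgrad n A y lam p x i - pgrad n A y lam p z i) * (x i - z i))"
proof -
  have "0 \<le> (\<Sum>i<n. \<Sum>j<n. A i j * ((sigmoid (x i - x j) - sigmoid (z i - z j)) * ((x i - x j) - (z i - z j))))"
    by (intro sum_nonneg mult_nonneg_nonneg A sigmoid_monotone)
  moreover have "0 \<le> p * (\<Sum>i<n. x i - z i)\<^sup>2"
    using assms by simp
  moreover note pgrad_difference[of n A y lam p x z, OF A(1)]
  ultimately show ?thesis
    by linarith
qed

subsection \<open>Cheeger's inequality\<close>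

text \<open>Induction on the support: peel off the indicator of the support, scaled by the smallest
  nonzero value of \<open>f\<close>.\<close>

lemma coarea_lower_bound:
  fixes f :: "'a \<Rightarrow> real"
  assumes V: "finite V" and f: "\<And>i. i \<in> V \<Longrightarrow> 0 \<le> f i"
    and A: "\<And>i j. i \<in> V \<Longrightarrow> j \<in> V \<Longrightarrow> A j i = A i j" "\<And>i j. 0 \<le> A i j"
    and cut: "\<And>S. S \<subseteq> {i\<in>V. f i \<noteq> 0} \<Longrightarrow> S \<noteq> {} \<Longrightarrow> h * real (card S) \<le> (\<Sum>i\<in>S. \<Sum>j\<in>V - S. A i j)"
  shows "2 * h * (\<Sum>i\<in>V. f i) \<le> (\<Sum>i\<in>V. \<Sum>j\<in>V. A i j * \<bar>f i - f j\<bar>)"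
  using f cut
proof (induction "card {i\<in>V. f i \<noteq> 0}" arbitrary: f rule: less_induct)
  case less
  define S where "S = {i\<in>V. f i \<noteq> 0}"
  show ?case
  proof (cases "S = {}")
    case True
    then have "\<And>i. i \<in> V \<Longrightarrow> f i = 0"
      by (auto simp: S_def)
    then show ?thesis
      using A(2) by (auto intro!: sum_nonneg)
  next
    case False
    have SV: "S \<subseteq> V" and fS: "finite S"
      using V by (auto simp: S_def)
    define a where "a = Min (f ` S)"
    have a_in: "a \<in> f ` S" and a_le: "\<And>i. i \<in> S \<Longrightarrow> a \<le> f i"
      using False fS by (auto simp: a_def)
    have a0: "0 < a"
      using a_in less.prems(1) by (auto simp: S_def less_le)
    define g where "g i = (if i \<in> S then f i - a else 0)" for i
    have g: "0 \<le> g i" for i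
      using a_le by (auto simp: g_def)
    have sub: "{i\<in>V. g i \<noteq> 0} \<subset> S"
      using a_in SV by (auto simp: g_def)
    have "card {i\<in>V. g i \<noteq> 0} < card S"
      by (rule psubset_card_mono[OF fS sub])
    then have IH: "2 * h * (\<Sum>i\<in>V. g i) \<le> (\<Sum>i\<in>V. \<Sum>j\<in>V. A i j * \<bar>g i - g j\<bar>)"
      using sub less.prems(2) g by (intro less.hyps) (auto simp: S_def)
    define e :: "'a \<Rightarrow> real" where "e i = (if i \<in> S then 1 else 0)" for i
    have fe: "f i = g i + a * e i" if "i \<in> V" for i
      using that by (auto simp: g_def e_def S_def)
    \<comment> \<open>There is no cancellation: \<open>g\<close> is nonnegative and vanishes off
      \<open>S\<close>, so \<open>g i - g j\<close> and \<open>e i - e j\<close> never have opposite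
      signs.\<close>
    have abs: "\<bar>f i - f j\<bar> = \<bar>g i - g j\<bar> + a * \<bar>e i - e j\<bar>" if "i \<in> V" "j \<in> V" for i j
      unfolding fe[OF that(1)] fe[OF that(2)] using g[of i] g[of j] a0
      by (auto simp: e_def) (auto simp: g_def)
    have e_sum: "(\<Sum>i\<in>V. e i) = real (card S)"
      unfolding e_def using V SV by (simp add: sum.If_cases Int_absorb1)
    have "(\<Sum>i\<in>V. \<Sum>j\<in>V. A i j * \<bar>e i - e j\<bar>) =
        (\<Sum>i\<in>V. \<Sum>j\<in>V. (if i \<in> S \<and> j \<notin> S then A i j else 0)) + (\<Sum>i\<in>V. \<Sum>j\<in>V. (if j \<in> S \<and> i \<notin> S then A i j else 0))"
      unfolding sum.distrib[symmetric] by (intro sum.cong refl) (auto simp: e_def)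
    also have "(\<Sum>i\<in>V. \<Sum>j\<in>V. (if j \<in> S \<and> i \<notin> S then A i j else 0)) = (\<Sum>i\<in>V. \<Sum>j\<in>V. (if i \<in> S \<and> j \<notin> S then A i j else 0))"
      by (subst sum.swap) (intro sum.cong refl, use A(1) in auto)
    also have "(\<Sum>i\<in>V. \<Sum>j\<in>V. (if i \<in> S \<and> j \<notin> S then A i j else 0)) = (\<Sum>i\<in>S. \<Sum>j\<in>V - S. A i j)"
    proof -
      have "(\<Sum>i\<in>V. \<Sum>j\<in>V. (if i \<in> S \<and> j \<notin> S then A i j else 0)) = (\<Sum>i\<in>V. if i \<in> S then (\<Sum>j\<in>V - S. A i j) else 0)"
      proof (intro sum.cong refl)
        fix i
        have "(\<Sum>j\<in>V. if j \<notin> S then A i j else 0) = (\<Sum>j\<in>V - S. A i j)"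
          using V by (simp add: sum.If_cases Diff_eq Collect_neg_eq)
        then show "(\<Sum>j\<in>V. if i \<in> S \<and> j \<notin> S then A i j else 0) = (if i \<in> S then sum (A i) (V - S) else 0)"
          by simp
      qed
      also have "\<dots> = (\<Sum>i\<in>S. \<Sum>j\<in>V - S. A i j)"
        using V SV by (simp add: sum.If_cases Int_absorb1)
      finally show ?thesis .
    qed
    finally have e_cut: "2 * h * real (card S) \<le> (\<Sum>i\<in>V. \<Sum>j\<in>V. A i j * \<bar>e i - e j\<bar>)"
      using less.prems(2)[of S] False by (simp add: S_def)
    have "2 * h * (\<Sum>i\<in>V. f i) = 2 * h * (\<Sum>i\<in>V. g i) + a * (2 * h * real (card S))"
      using fe by (simp add: sum.distrib sum_distrib_left[symmetric] e_sum algebra_simps)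
    also have "\<dots> \<le> (\<Sum>i\<in>V. \<Sum>j\<in>V. A i j * \<bar>g i - g j\<bar>) + a * (\<Sum>i\<in>V. \<Sum>j\<in>V. A i j * \<bar>e i - e j\<bar>)"
      using IH e_cut a0 by (intro add_mono mult_left_mono) auto
    also have "\<dots> = (\<Sum>i\<in>V. \<Sum>j\<in>V. A i j * \<bar>f i - f j\<bar>)"
      using abs by (simp add: sum.distrib sum_distrib_left algebra_simps)
    finally show ?thesis .
  qed
qed

lemma Cauchy_Schwarz_weighted:
  fixes a b w :: "'a \<Rightarrow> real"
  assumes "\<And>i. i \<in> I \<Longrightarrow> 0 \<le> w i"
  shows "(\<Sum>i\<in>I. w i * (a i * b i))\<^sup>2 \<le> (\<Sum>i\<in>I. w i * (a i)\<^sup>2) * (\<Sum>i\<in>I. w i * (b i)\<^sup>2)"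
proof -
  have "(\<Sum>i\<in>I. (sqrt (w i) * a i) * (sqrt (w i) * b i))\<^sup>2 \<le>
      (\<Sum>i\<in>I. (sqrt (w i) * a i)\<^sup>2) * (\<Sum>i\<in>I. (sqrt (w i) * b i)\<^sup>2)"
    by (rule Cauchy_Schwarz_ineq_sum)
  moreover have "(\<Sum>i\<in>I. (sqrt (w i) * a i) * (sqrt (w i) * b i)) = (\<Sum>i\<in>I. w i * (a i * b i))"
  proof (intro sum.cong refl)
    fix i assume "i \<in> I"
    then have "sqrt (w i) * sqrt (w i) = w i"
      using assms by simp
    then show "(sqrt (w i) * a i) * (sqrt (w i) * b i) = w i * (a i * b i)"
      by (metis mult.assoc mult.left_commute)
  qed
  ultimately show ?thesis
    using assms by (simp add: power_mult_distrib)
qed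

text \<open>\<open>coarea_lower_bound\<close> is applied to the squares of \<open>x\<close>.
  Factoring the difference of squares, Cauchy-Schwarz with weights \<open>A\<close> separates the
  energy from the sum of \<open>A i j * (x i + x j)^2\<close>, which the degree bound limits to
  \<open>4 * D\<close> times the squared norm of \<open>x\<close>.\<close>

lemma cheeger_small_support:
  fixes x :: "'a \<Rightarrow> real"
  assumes V: "finite V" and x: "\<And>i. i \<in> V \<Longrightarrow> 0 \<le> x i"
    and A: "\<And>i j. i \<in> V \<Longrightarrow> j \<in> V \<Longrightarrow> A j i = A i j" "\<And>i j. 0 \<le> A i j"
    and cut: "\<And>S. S \<subseteq> {i\<in>V. x i \<noteq> 0} \<Longrightarrow> S \<noteq> {} \<Longrightarrow> h * real (card S) \<le> (\<Sum>i\<in>S. \<Sum>j\<in>V - S. A i j)"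
    and deg: "\<And>i. i \<in> V \<Longrightarrow> (\<Sum>j\<in>V. A i j) \<le> D" and h: "0 \<le> h" "0 < D"
  shows "h\<^sup>2 / D * (\<Sum>i\<in>V. (x i)\<^sup>2) \<le> (\<Sum>i\<in>V. \<Sum>j\<in>V. A i j * (x i - x j)\<^sup>2)"
proof -
  define X where "X = (\<Sum>i\<in>V. (x i)\<^sup>2)"
  define E where "E = (\<Sum>i\<in>V. \<Sum>j\<in>V. A i j * (x i - x j)\<^sup>2)"
  have X0: "0 \<le> X" and E0: "0 \<le> E"
    by (auto simp: X_def E_def A intro!: sum_nonneg)
  have "2 * h * X \<le> (\<Sum>i\<in>V. \<Sum>j\<in>V. A i j * \<bar>(x i)\<^sup>2 - (x j)\<^sup>2\<bar>)"
    unfolding X_def using cut by (intro coarea_lower_bound V A) auto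
  also have "\<dots> = (\<Sum>(i,j)\<in>V \<times> V. A i j * (\<bar>x i - x j\<bar> * (x i + x j)))"
    unfolding sum.cartesian_product
    by (intro sum.cong refl) (auto simp: power2_eq_square square_diff_square_factored abs_mult x mult.commute)
  finally have "(2 * h * X)\<^sup>2 \<le> (\<Sum>(i,j)\<in>V \<times> V. A i j * (\<bar>x i - x j\<bar> * (x i + x j)))\<^sup>2"
    using h X0 by (intro power_mono) auto
  also have "\<dots> \<le> (\<Sum>(i,j)\<in>V \<times> V. A i j * \<bar>x i - x j\<bar>\<^sup>2) * (\<Sum>(i,j)\<in>V \<times> V. A i j * (x i + x j)\<^sup>2)"
    using Cauchy_Schwarz_weighted[of "V \<times> V" "\<lambda>(i,j). A i j" "\<lambda>(i,j). \<bar>x i - x j\<bar>" "\<lambda>(i,j). x i + x j"] A(2)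
    by (simp add: case_prod_unfold)
  also have "(\<Sum>(i,j)\<in>V \<times> V. A i j * \<bar>x i - x j\<bar>\<^sup>2) = E"
    by (simp add: E_def sum.cartesian_product)
  also have "(\<Sum>(i,j)\<in>V \<times> V. A i j * (x i + x j)\<^sup>2) \<le> 4 * D * X"
  proof -
    have "(\<Sum>(i,j)\<in>V \<times> V. A i j * (x i + x j)\<^sup>2) \<le> (\<Sum>(i,j)\<in>V \<times> V. 2 * (A i j * (x i)\<^sup>2) + 2 * (A i j * (x j)\<^sup>2))"
    proof (intro sum_mono, clarify)
      fix i j
      have "(x i + x j)\<^sup>2 \<le> 2 * (x i)\<^sup>2 + 2 * (x j)\<^sup>2"
        using zero_le_power2[of "x i - x j"] by (simp add: power2_sum power2_diff)
      from mult_left_mono[OF this A(2)[of i j]]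
      show "A i j * (x i + x j)\<^sup>2 \<le> 2 * (A i j * (x i)\<^sup>2) + 2 * (A i j * (x j)\<^sup>2)"
        by (simp add: algebra_simps)
    qed
    also have "\<dots> = 2 * (\<Sum>i\<in>V. \<Sum>j\<in>V. A i j * (x i)\<^sup>2) + 2 * (\<Sum>i\<in>V. \<Sum>j\<in>V. A i j * (x j)\<^sup>2)"
      by (simp add: sum.distrib sum_distrib_left flip: sum.cartesian_product)
    also have "(\<Sum>i\<in>V. \<Sum>j\<in>V. A i j * (x j)\<^sup>2) = (\<Sum>i\<in>V. \<Sum>j\<in>V. A i j * (x i)\<^sup>2)"
      by (subst sum.swap) (intro sum.cong refl, use A(1) in auto)
    also have "(\<Sum>i\<in>V. \<Sum>j\<in>V. A i j * (x i)\<^sup>2) \<le> (\<Sum>i\<in>V. D * (x i)\<^sup>2)"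
      unfolding sum_distrib_right[symmetric] using deg by (intro sum_mono mult_right_mono) auto
    finally show ?thesis
      by (simp add: X_def sum_distrib_left[symmetric])
  qed
  finally have "(2 * h * X)\<^sup>2 \<le> E * (4 * D * X)"
    using E0 by (simp add: mult_left_mono)
  then have "4 * h\<^sup>2 * X * X \<le> 4 * D * E * X"
    by (simp add: power2_eq_square algebra_simps)
  then have "h\<^sup>2 * X \<le> D * E"
    using X0 E0 h by (cases "X = 0") (auto simp: less_le)
  then show ?thesis
    unfolding X_def[symmetric] E_def[symmetric] using h by (simp add: field_simps)
qed

text \<open>The median is the least value with at most half of the points strictly above it: by
  minimality more than half of the points exceed the next smaller value, so at most half lie below
  the median.\<close>

lemma median_exists:
  fixes v :: "'a \<Rightarrow> real"
  assumes V: "finite V" "V \<noteq> {}"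
  shows "\<exists>c. 2 * card {i\<in>V. c < v i} \<le> card V \<and> 2 * card {i\<in>V. v i < c} \<le> card V"
proof -
  define C where "C = {c \<in> v ` V. 2 * card {i\<in>V. c < v i} \<le> card V}"
  have empty: "{i\<in>V. Max (v ` V) < v i} = {}"
    using V by (auto simp: not_less)
  have "2 * card {i\<in>V. Max (v ` V) < v i} \<le> card V"
    unfolding empty by simp
  then have "Max (v ` V) \<in> C"
    unfolding C_def by (intro CollectI conjI Max_in) (use V in auto)
  then have C: "finite C" "C \<noteq> {}"
    using V by (simp add: C_def, blast)
  define c where "c = Min C"
  have cC: "c \<in> C" using C by (simp add: c_def)
  have "2 * card {i\<in>V. v i < c} \<le> card V"
  proof (cases "{i\<in>V. v i < c} = {}")
    case False
    define b where "b = Max (v ` {i\<in>V. v i < c})"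
    have b: "b \<in> v ` {i\<in>V. v i < c}" "\<And>i. i \<in> V \<Longrightarrow> v i < c \<Longrightarrow> v i \<le> b"
      using False V by (auto simp: b_def simp del: Max_in intro!: Max_in Max_ge)
    then have bc: "b < c" by auto
    have "b \<notin> C"
      using C bc Min_le[of C b] by (auto simp: c_def)
    then have "card V < 2 * card {i\<in>V. b < v i}"
      using b(1) by (auto simp: C_def)
    moreover have "{i\<in>V. b < v i} = V - {i\<in>V. v i < c}"
      using b(2) bc by force
    moreover have "card (V - {i\<in>V. v i < c}) = card V - card {i\<in>V. v i < c}"
      using V by (intro card_Diff_subset) auto
    moreover have "card {i\<in>V. v i < c} \<le> card V"
      using V by (intro card_mono) auto
    ultimately show ?thesis by simp
  next
    case True
    then show ?thesis by (simp only: card.empty)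
  qed
  then show ?thesis
    using cC by (auto simp: C_def)
qed

text \<open>Cut bounds are given only for at most half of the vertices. Splitting \<open>v\<close>
  at a median \<open>c\<close> into positive and negative parts produces two such supports. The
  differences of the two parts have a nonpositive product, so the two energies add up to at most
  that of \<open>v\<close>. This controls the variance of \<open>v\<close>; the contribution of the
  mean is paid by the penalty, which is where \<open>mu \<le> p * real (card V)\<close>
  enters.\<close>

lemma cheeger_poincare:
  fixes v :: "'a \<Rightarrow> real"
  assumes V: "finite V" "V \<noteq> {}"
    and A: "\<And>i j. i \<in> V \<Longrightarrow> j \<in> V \<Longrightarrow> A j i = A i j" "\<And>i j. 0 \<le> A i j"
    and cut: "\<And>S. S \<subseteq> V \<Longrightarrow> S \<noteq> {} \<Longrightarrow> 2 * card S \<le> card V \<Longrightarrow>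
        h * real (card S) \<le> (\<Sum>i\<in>S. \<Sum>j\<in>V - S. A i j)"
    and deg: "\<And>i. i \<in> V \<Longrightarrow> (\<Sum>j\<in>V. A i j) \<le> D" and h: "0 \<le> h" "0 < D"
    and mu: "0 \<le> mu" "mu \<le> h\<^sup>2 / (2 * D)" "mu \<le> p * real (card V)"
  shows "mu * (\<Sum>i\<in>V. (v i)\<^sup>2) \<le> (\<Sum>i\<in>V. \<Sum>j\<in>V. A i j * (v i - v j)\<^sup>2) / 2 + p * (\<Sum>i\<in>V. v i)\<^sup>2"
proof -
  obtain c where c: "2 * card {i\<in>V. c < v i} \<le> card V" "2 * card {i\<in>V. v i < c} \<le> card V"
    using median_exists[OF V] by blast
  define x where "x i = max (v i - c) 0" for i
  define y where "y i = max (c - v i) 0" for i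
  have small: "h * real (card S) \<le> (\<Sum>i\<in>S. \<Sum>j\<in>V - S. A i j)"
    if "S \<subseteq> T" "T \<subseteq> V" "2 * card T \<le> card V" "S \<noteq> {}" for S T
  proof (rule cut)
    have "card S \<le> card T"
      using that V by (meson card_mono finite_subset)
    then show "2 * card S \<le> card V" using that by simp
  qed (use that in auto)
  have "h\<^sup>2 / D * (\<Sum>i\<in>V. (x i)\<^sup>2) \<le> (\<Sum>i\<in>V. \<Sum>j\<in>V. A i j * (x i - x j)\<^sup>2)"
  proof (rule cheeger_small_support)
    fix S assume "S \<subseteq> {i\<in>V. x i \<noteq> 0}" "S \<noteq> {}"
    then show "h * real (card S) \<le> (\<Sum>i\<in>S. \<Sum>j\<in>V - S. A i j)"
      by (intro small[of _ "{i\<in>V. c < v i}"]) (use c in \<open>auto simp: x_def max_def split: if_splits\<close>)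
  qed (use V A deg h in \<open>auto simp: x_def\<close>)
  moreover have "h\<^sup>2 / D * (\<Sum>i\<in>V. (y i)\<^sup>2) \<le> (\<Sum>i\<in>V. \<Sum>j\<in>V. A i j * (y i - y j)\<^sup>2)"
  proof (rule cheeger_small_support)
    fix S assume "S \<subseteq> {i\<in>V. y i \<noteq> 0}" "S \<noteq> {}"
    then show "h * real (card S) \<le> (\<Sum>i\<in>S. \<Sum>j\<in>V - S. A i j)"
      by (intro small[of _ "{i\<in>V. v i < c}"]) (use c in \<open>auto simp: y_def max_def split: if_splits\<close>)
  qed (use V A deg h in \<open>auto simp: y_def\<close>)
  moreover have "(\<Sum>i\<in>V. \<Sum>j\<in>V. A i j * (x i - x j)\<^sup>2) + (\<Sum>i\<in>V. \<Sum>j\<in>V. A i j * (y i - y j)\<^sup>2)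
      \<le> (\<Sum>i\<in>V. \<Sum>j\<in>V. A i j * (v i - v j)\<^sup>2)"
  proof -
    have "(x i - x j)\<^sup>2 + (y i - y j)\<^sup>2 \<le> (v i - v j)\<^sup>2" for i j
    proof -
      have vxy: "v i - v j = (x i - x j) - (y i - y j)" by (simp add: x_def y_def max_def)
      have "(x i - x j) * (y i - y j) \<le> 0"
        by (auto simp: x_def y_def max_def mult_le_0_iff)
      then show ?thesis
        unfolding vxy power2_diff[of "x i - x j"] by (simp only: mult.assoc)
    qed
    then have "A i j * (x i - x j)\<^sup>2 + A i j * (y i - y j)\<^sup>2 \<le> A i j * (v i - v j)\<^sup>2" for i j
      using A(2)[of i j] by (metis distrib_left mult_left_mono)
    then show ?thesis
      unfolding sum.distrib[symmetric] by (intro sum_mono)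
  qed
  moreover have "(\<Sum>i\<in>V. (x i)\<^sup>2) + (\<Sum>i\<in>V. (y i)\<^sup>2) = (\<Sum>i\<in>V. (v i - c)\<^sup>2)"
    unfolding sum.distrib[symmetric]
    by (intro sum.cong refl) (auto simp: x_def y_def max_def power2_commute)
  ultimately have "h\<^sup>2 / D * (\<Sum>i\<in>V. (v i - c)\<^sup>2) \<le> (\<Sum>i\<in>V. \<Sum>j\<in>V. A i j * (v i - v j)\<^sup>2)"
    by (smt (verit) distrib_left)
  then have E: "h\<^sup>2 / (2 * D) * (\<Sum>i\<in>V. (v i - c)\<^sup>2) \<le> (\<Sum>i\<in>V. \<Sum>j\<in>V. A i j * (v i - v j)\<^sup>2) / 2"
    by simp
  define N where "N = real (card V)"
  have N: "N > 0" using V by (simp add: N_def card_gt_0_iff)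
  define s where "s = (\<Sum>i\<in>V. v i)"
  have "(\<Sum>i\<in>V. (v i - c)\<^sup>2) = (\<Sum>i\<in>V. (v i)\<^sup>2) - 2 * c * s + N * c\<^sup>2"
    by (simp add: power2_diff sum.distrib sum_subtractf s_def N_def sum_distrib_left sum_distrib_right algebra_simps)
  \<comment> \<open>Completing the square: among all centres the mean minimises the sum of squared
    deviations.\<close>
  moreover have "N * (c - s / N)\<^sup>2 = s\<^sup>2 / N - 2 * c * s + N * c\<^sup>2"
    using N by (simp add: power2_diff field_simps power2_eq_square)
  ultimately have var: "(\<Sum>i\<in>V. (v i)\<^sup>2) - s\<^sup>2 / N \<le> (\<Sum>i\<in>V. (v i - c)\<^sup>2)"
    using N zero_le_power2[of "c - s / N"] by (smt (verit) mult_nonneg_nonneg)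
  have "mu * (\<Sum>i\<in>V. (v i)\<^sup>2) = mu * ((\<Sum>i\<in>V. (v i)\<^sup>2) - s\<^sup>2 / N) + mu / N * s\<^sup>2"
    by (simp add: algebra_simps)
  also have "\<dots> \<le> mu * (\<Sum>i\<in>V. (v i - c)\<^sup>2) + p * s\<^sup>2"
    using var mu N by (intro add_mono mult_left_mono mult_right_mono) (auto simp: N_def field_simps)
  also have "mu * (\<Sum>i\<in>V. (v i - c)\<^sup>2) \<le> h\<^sup>2 / (2 * D) * (\<Sum>i\<in>V. (v i - c)\<^sup>2)"
    using mu by (intro mult_right_mono sum_nonneg) auto
  also note E
  finally show ?thesis by (simp add: s_def)
qed

subsection \<open>Tail bounds for independent Bernoulli variables\<close>

lemma exp_le_quadratic:
  fixes t :: real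
  assumes "\<bar>t\<bar> \<le> 1"
  shows "exp t \<le> 1 + t + t\<^sup>2"
proof (cases "0 \<le> t")
  case True
  then show ?thesis using assms exp_bound[of t] by simp
next
  case False
  define s where "s = - t"
  have s: "0 < s" "s \<le> 1" using False assms by (auto simp: s_def)
  \<comment> \<open>The goal amounts to \<open>1 \<le> (1 - s + s^2) * exp s\<close>. Replacing
    \<open>exp s\<close> by its quadratic Taylor polynomial leaves a product equal to 1 plus
    nonnegative terms.\<close>
  have "1 + s + s\<^sup>2 / 2 \<le> exp s"
    using exp_lower_Taylor_quadratic[of s] s by simp
  moreover have "0 < 1 - s + s\<^sup>2"
    using s by (intro add_nonneg_pos) auto
  ultimately have "(1 - s + s\<^sup>2) * (1 + s + s\<^sup>2 / 2) \<le> (1 - s + s\<^sup>2) * exp s"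
    by simp
  moreover have "(1 - s + s\<^sup>2) * (1 + s + s\<^sup>2 / 2) = 1 + s\<^sup>2 / 2 + s ^ 3 / 2 + s ^ 4 / 2"
    by (simp add: field_simps power2_eq_square power3_eq_cube power4_eq_xxxx)
  ultimately have "1 \<le> (1 - s + s\<^sup>2) * exp s"
    using s by (smt (verit) divide_nonneg_nonneg zero_le_power)
  then have "exp (- s) \<le> 1 - s + s\<^sup>2"
    by (simp add: exp_minus field_simps)
  then show ?thesis by (simp add: s_def)
qed

text \<open>The exponent keeps the factor \<open>q\<close>, a bound for the variance. For edge
  indicators this is the small number \<open>p\<close>, and it yields tails of Bernstein type; the
  price is the restriction on \<open>a\<close>.\<close>

lemma bernoulli_mgf_le:
  assumes q: "0 \<le> q" "q \<le> 1" and a: "\<bar>a\<bar> \<le> 1"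
  shows "measure_pmf.expectation (bernoulli_pmf q) (\<lambda>x. exp (a * (of_bool x - q))) \<le> exp (a\<^sup>2 * q)"
proof -
  have aq: "\<bar>a * (1 - q)\<bar> \<le> 1" "\<bar>a * (0 - q)\<bar> \<le> 1"
    using q a by (auto simp: abs_mult intro!: mult_le_one)
  have "measure_pmf.expectation (bernoulli_pmf q) (\<lambda>x. exp (a * (of_bool x - q))) =
      exp (a * (1 - q)) * q + exp (a * (0 - q)) * (1 - q)"
    using q by simp
  also have "\<dots> \<le> (1 + a * (1 - q) + (a * (1 - q))\<^sup>2) * q + (1 + a * (0 - q) + (a * (0 - q))\<^sup>2) * (1 - q)"
    using q exp_le_quadratic[OF aq(1)] exp_le_quadratic[OF aq(2)] by (intro add_mono mult_right_mono) auto
  also have "\<dots> = 1 + a\<^sup>2 * (q * (1 - q))"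
    by (simp add: algebra_simps power2_eq_square)
  also have "\<dots> \<le> 1 + a\<^sup>2 * q"
    using q by (intro add_left_mono mult_left_mono) (auto simp: mult_left_le)
  also have "\<dots> \<le> exp (a\<^sup>2 * q)"
    by (rule exp_ge_add_one_self)
  finally show ?thesis .
qed

text \<open>Comparison outcomes gain nothing from a variance factor, but they need arbitrary
  \<open>a\<close>: for a single pair and small \<open>L\<close> the optimal scale exceeds 1. In
  that range \<open>\<bar>a\<bar> \<le> a^2\<close> makes the bound pointwise.\<close>

lemma bernoulli_mgf_subgaussian:
  assumes q: "0 \<le> q" "q \<le> 1"
  shows "measure_pmf.expectation (bernoulli_pmf q) (\<lambda>x. exp (a * (of_bool x - q))) \<le> exp (a\<^sup>2)"
proof (cases "\<bar>a\<bar> \<le> 1")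
  case True
  have "a\<^sup>2 * q \<le> a\<^sup>2"
    using q by (simp add: mult_left_le)
  then show ?thesis
    using bernoulli_mgf_le[OF q True] by (smt (verit) exp_le_cancel_iff)
next
  case False
  have "\<bar>a\<bar> * 1 \<le> \<bar>a\<bar> * \<bar>a\<bar>"
    using False by (intro mult_left_mono) auto
  then have a2: "\<bar>a\<bar> \<le> a\<^sup>2"
    by (simp add: power2_eq_square)
  have "\<bar>a * (1 - q)\<bar> \<le> \<bar>a\<bar>" "\<bar>a * (0 - q)\<bar> \<le> \<bar>a\<bar>"
    using q by (auto simp: abs_mult intro!: mult_left_le)
  then have "a * (1 - q) \<le> a\<^sup>2" "a * (0 - q) \<le> a\<^sup>2"
    using a2 by linarith+
  then have "exp (a * (1 - q)) * q + exp (a * (0 - q)) * (1 - q) \<le> exp (a\<^sup>2) * q + exp (a\<^sup>2) * (1 - q)"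
    using q by (intro add_mono mult_right_mono) auto
  then show ?thesis
    using q by (simp add: algebra_simps)
qed

text \<open>The free parameter of the exponential Markov inequality is absorbed into the
  coefficients \<open>a\<close>, so each application fixes its scale through its choice of
  \<open>a\<close>.\<close>

lemma Pi_bernoulli_chernoff:
  assumes I: "finite I" and q: "\<And>k. k \<in> I \<Longrightarrow> 0 \<le> q k \<and> q k \<le> 1"
    and mgf: "\<And>k. k \<in> I \<Longrightarrow>
      measure_pmf.expectation (bernoulli_pmf (q k)) (\<lambda>x. exp (a k * (of_bool x - q k))) \<le> exp (s k)"
  shows "measure_pmf.prob (Pi_pmf I False (\<lambda>k. bernoulli_pmf (q k)))
      {X. \<tau> \<le> (\<Sum>k\<in>I. a k * (of_bool (X k) - q k))} \<le> exp ((\<Sum>k\<in>I. s k) - \<tau>)"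
proof -
  let ?P = "Pi_pmf I False (\<lambda>k. bernoulli_pmf (q k))"
  let ?f = "\<lambda>X. \<Sum>k\<in>I. a k * (of_bool (X k) - q k)"
  have fin: "finite (set_pmf ?P)"
    using I by (simp add: set_Pi_pmf finite_PiE_dflt)
  have int: "integrable ?P f" for f :: "_ \<Rightarrow> real"
    by (rule integrable_measure_pmf_finite[OF fin])
  have "measure_pmf.prob ?P {X. \<tau> \<le> ?f X} = measure_pmf.expectation ?P (indicator {X. \<tau> \<le> ?f X})"
    by simp
  also have "\<dots> \<le> measure_pmf.expectation ?P (\<lambda>X. exp (- \<tau>) * (\<Prod>k\<in>I. exp (a k * (of_bool (X k) - q k))))"
  proof (intro integral_mono int)
    fix X
    have "exp (- \<tau>) * (\<Prod>k\<in>I. exp (a k * (of_bool (X k) - q k))) = exp (?f X - \<tau>)"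
      using I by (simp add: exp_sum exp_diff exp_minus field_simps)
    then show "indicator {X. \<tau> \<le> ?f X} X \<le> exp (- \<tau>) * (\<Prod>k\<in>I. exp (a k * (of_bool (X k) - q k)))"
      by (auto simp: indicator_def)
  qed
  also have "\<dots> = exp (- \<tau>) * (\<Prod>k\<in>I. measure_pmf.expectation (bernoulli_pmf (q k)) (\<lambda>x. exp (a k * (of_bool x - q k))))"
    by (subst integral_mult_right_zero, subst expectation_prod_Pi_pmf)
       (auto intro!: integrable_measure_pmf_finite I)
  also have "\<dots> \<le> exp (- \<tau>) * (\<Prod>k\<in>I. exp (s k))"
    using mgf by (intro mult_left_mono prod_mono) auto
  also have "\<dots> = exp ((\<Sum>k\<in>I. s k) - \<tau>)"
    using I by (simp add: exp_sum exp_diff exp_minus field_simps)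
  finally show ?thesis .
qed

section \<open>Conditioning and decoupling in product distributions\<close>

lemma prob_pair_pmf_le:
  assumes "\<And>y. measure_pmf.prob P {x. B x y} \<le> c"
  shows "measure_pmf.prob (pair_pmf P Q) {(x, y). B x y} \<le> c"
proof -
  have c: "0 \<le> c"
    using assms measure_nonneg order_trans by metis
  have "emeasure (measure_pmf (pair_pmf P Q)) {(x, y). B x y} =
      (\<integral>\<^sup>+z. indicator {(x, y). B x y} z \<partial>measure_pmf (pair_pmf P Q))"
    by simp
  also have "\<dots> = (\<integral>\<^sup>+z. indicator {(x, y). B x y} (case z of (y, x) \<Rightarrow> (x, y)) \<partial>measure_pmf (pair_pmf Q P))"
    by (subst pair_commute_pmf) simp
  also have "\<dots> = (\<integral>\<^sup>+y. \<integral>\<^sup>+x. indicator {x. B x y} x \<partial>measure_pmf P \<partial>measure_pmf Q)"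
  proof -
    have "indicator {(x, y). B x y} (x, y) = (indicator {x. B x y} x :: ennreal)" for x y
      by (simp add: indicator_def)
    then show ?thesis
      by (simp only: nn_integral_pair_pmf' prod.case)
  qed
  also have "\<dots> \<le> (\<integral>\<^sup>+y. ennreal c \<partial>measure_pmf Q)"
    using assms by (intro nn_integral_mono) (auto simp: measure_pmf.emeasure_eq_measure intro!: ennreal_leI)
  also have "\<dots> = ennreal c"
    by simp
  finally show ?thesis
    using c by (simp add: measure_pmf.emeasure_eq_measure)
qed

lemma prob_pair_pmf_le':
  assumes "\<And>x. measure_pmf.prob Q {y. B x y} \<le> c"
  shows "measure_pmf.prob (pair_pmf P Q) {(x, y). B x y} \<le> c"
proof -
  have "measure_pmf.prob (pair_pmf P Q) {(x, y). B x y} = measure_pmf.prob (pair_pmf Q P) {(y, x). B x y}"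
    by (subst pair_commute_pmf) (simp add: measure_map_pmf vimage_def case_prod_unfold)
  also have "\<dots> \<le> c"
    using assms by (rule prob_pair_pmf_le)
  finally show ?thesis .
qed

lemma prob_pair_pmf_fst: "measure_pmf.prob (pair_pmf P Q) {(x, y). B x} = measure_pmf.prob P {x. B x}"
proof -
  have "measure_pmf.prob P {x. B x} = measure_pmf.prob (map_pmf fst (pair_pmf P Q)) {x. B x}"
    by (simp add: map_fst_pair_pmf)
  then show ?thesis
    by (simp add: measure_map_pmf vimage_def case_prod_unfold)
qed

text \<open>The test reads only the coordinates in \<open>A\<close>, its parameter
  \<open>u X\<close> only those in \<open>B\<close>. Given the coordinates in \<open>B\<close> the
  parameter is a constant, and the bound for fixed \<open>v\<close> applies. This turns the
  independence of the leave-one-out minimiser into a tail bound.\<close>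

lemma Pi_pmf_decoupling:
  assumes fin: "finite A" "finite B" and disj: "A \<inter> B = {}"
    and bad: "\<And>v X X'. (\<And>x. x \<in> A \<Longrightarrow> X x = X' x) \<Longrightarrow> bad v X = bad v X'"
    and u: "\<And>X X'. (\<And>x. x \<in> B \<Longrightarrow> X x = X' x) \<Longrightarrow> u X = u X'"
    and le: "\<And>v. measure_pmf.prob (Pi_pmf (A \<union> B) d p) {X. bad v X} \<le> c"
  shows "measure_pmf.prob (Pi_pmf (A \<union> B) d p) {X. bad (u X) X} \<le> c"
proof -
  let ?merge = "\<lambda>f g x. if x \<in> A then f x else g x"
  have split: "measure_pmf.prob (Pi_pmf (A \<union> B) d p) {X. R X} =
      measure_pmf.prob (pair_pmf (Pi_pmf A d p) (Pi_pmf B d p)) {(f, g). R (?merge f g)}" for R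
    by (subst Pi_pmf_union[OF fin disj]) (simp add: measure_map_pmf vimage_def case_prod_unfold)
  have "measure_pmf.prob (Pi_pmf A d p) {f. bad v f} \<le> c" for v
  proof -
    have "{(f, g). bad v (?merge f g)} = {(f, g). bad v f}"
      using bad[of "?merge _ _" _ v] by auto
    then show ?thesis
      using le[of v] unfolding split by (simp add: prob_pair_pmf_fst)
  qed
  then have "measure_pmf.prob (pair_pmf (Pi_pmf A d p) (Pi_pmf B d p)) {(f, g). bad (u g) f} \<le> c"
    by (rule prob_pair_pmf_le)
  moreover have "bad (u (?merge f g)) (?merge f g) = bad (u g) f" for f g
  proof -
    have "u (?merge f g) = u g" using disj by (intro u) auto
    moreover have "bad v (?merge f g) = bad v f" for v by (rule bad) auto
    ultimately show ?thesis by simp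
  qed
  ultimately show ?thesis
    unfolding split by simp
qed

subsection \<open>Tail bounds for graph and comparisons\<close>

definition pairs :: "nat \<Rightarrow> (nat \<times> nat) set" where
  "pairs n = {(i, j). i < j \<and> j < n}"

lemma finite_pairs [simp]: "finite (pairs n)"
  by (rule finite_subset[of _ "{..<n} \<times> {..<n}"]) (auto simp: pairs_def)

lemma sum_square_pairs:
  fixes f :: "nat \<Rightarrow> nat \<Rightarrow> real"
  assumes "\<And>i. i < n \<Longrightarrow> f i i = 0"
  shows "(\<Sum>i<n. \<Sum>j<n. f i j) = (\<Sum>(i,j)\<in>pairs n. f i j + f j i)"
  using assms
proof (induction n)
  case 0
  then show ?case by (simp add: pairs_def)
next
  case (Suc n)
  have "pairs (Suc n) = pairs n \<union> (\<lambda>i. (i, n)) ` {..<n}"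
    by (auto simp: pairs_def less_Suc_eq)
  moreover have "pairs n \<inter> (\<lambda>i. (i, n)) ` {..<n} = {}"
    by (auto simp: pairs_def)
  ultimately have "(\<Sum>(i,j)\<in>pairs (Suc n). f i j + f j i) =
      (\<Sum>(i,j)\<in>pairs n. f i j + f j i) + (\<Sum>(i,j)\<in>(\<lambda>i. (i, n)) ` {..<n}. f i j + f j i)"
    by (simp add: sum.union_disjoint)
  also have "(\<Sum>(i,j)\<in>(\<lambda>i. (i, n)) ` {..<n}. f i j + f j i) = (\<Sum>i<n. f i n + f n i)"
    by (subst sum.reindex) (auto simp: inj_on_def)
  finally show ?case
    using Suc by (simp add: sum.distrib)
qed

definition adj :: "(nat \<times> nat \<Rightarrow> bool) \<Rightarrow> nat \<Rightarrow> nat \<Rightarrow> real" where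
  "adj G i j = of_bool (i \<noteq> j \<and> G (min i j, max i j))"

lemma adj_sym: "adj G j i = adj G i j"
  by (auto simp: adj_def min.commute max.commute)

lemma adj_self [simp]: "adj G i i = 0"
  by (simp add: adj_def)

lemma adj_cases: "adj G i j = 0 \<or> adj G i j = 1"
  by (auto simp: adj_def)

lemma adj_bounds: "0 \<le> adj G i j" "adj G i j \<le> 1"
  by (auto simp: adj_def)

text \<open>At most one of \<open>b i j\<close> and \<open>b j i\<close> is nonzero, so each
  independent edge bit occurs once, with a coefficient of modulus at most 1, and the squares of
  \<open>b\<close> add up to those of the actual coefficients.\<close>

lemma edge_tail:
  assumes p: "0 \<le> p" "p \<le> 1"
    and b: "\<And>i. b i i = 0" "\<And>i j. b i j = 0 \<or> b j i = 0" "\<And>i j. \<bar>b i j\<bar> \<le> 1"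
  shows "measure_pmf.prob (btl_edges_pmf n p) {G. \<tau> \<le> (\<Sum>i<n. \<Sum>j<n. b i j * (adj G i j - p))}
      \<le> exp (p * (\<Sum>i<n. \<Sum>j<n. (b i j)\<^sup>2) - \<tau>)"
proof -
  define a where "a = (\<lambda>(i,j). b i j + b j i)"
  have "(\<Sum>i<n. \<Sum>j<n. b i j * (adj G i j - p)) = (\<Sum>k\<in>pairs n. a k * (of_bool (G k) - p))" for G
  proof -
    have "(\<Sum>i<n. \<Sum>j<n. b i j * (adj G i j - p)) = (\<Sum>(i,j)\<in>pairs n. b i j * (adj G i j - p) + b j i * (adj G j i - p))"
      using b by (intro sum_square_pairs) auto
    also have "\<dots> = (\<Sum>k\<in>pairs n. a k * (of_bool (G k) - p))"
      by (intro sum.cong refl) (auto simp: a_def pairs_def adj_def algebra_simps)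
    finally show ?thesis .
  qed
  moreover have "p * (\<Sum>i<n. \<Sum>j<n. (b i j)\<^sup>2) = (\<Sum>k\<in>pairs n. (a k)\<^sup>2 * p)"
  proof -
    have "(\<Sum>i<n. \<Sum>j<n. (b i j)\<^sup>2) = (\<Sum>(i,j)\<in>pairs n. (b i j)\<^sup>2 + (b j i)\<^sup>2)"
      using b by (intro sum_square_pairs) auto
    also have "\<dots> = (\<Sum>k\<in>pairs n. (a k)\<^sup>2)"
    proof (intro sum.cong refl, clarify)
      fix i j show "(b i j)\<^sup>2 + (b j i)\<^sup>2 = (a (i, j))\<^sup>2"
        using b(2)[of i j] by (auto simp: a_def)
    qed
    finally show ?thesis
      by (simp add: sum_distrib_left mult.commute)
  qed
  moreover have "\<bar>a k\<bar> \<le> 1" for k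
  proof (cases k)
    case (Pair i j)
    then show ?thesis
      using b(2)[of i j] b(3)[of i j] b(3)[of j i] by (auto simp: a_def)
  qed
  ultimately show ?thesis
    unfolding btl_edges_pmf_def pairs_def[symmetric]
    using Pi_bernoulli_chernoff[of "pairs n" "\<lambda>_. p" a "\<lambda>k. (a k)\<^sup>2 * p" \<tau>] p bernoulli_mgf_le
    by simp
qed

text \<open>The fraction of comparisons between \<open>i\<close> and \<open>j\<close> won by
  \<open>i\<close>, whichever orientation is stored; its mean is
  \<open>sigmoid (ln (w i) - ln (w j))\<close>.\<close>

definition obs :: "nat \<Rightarrow> (nat \<times> nat \<times> nat \<Rightarrow> bool) \<Rightarrow> nat \<Rightarrow> nat \<Rightarrow> real" where
  "obs L Y i j = (if j < i then btl_avg L Y j i else 1 - btl_avg L Y i j)"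

lemma obs_flip: "i \<noteq> j \<Longrightarrow> obs L Y j i = 1 - obs L Y i j"
  by (auto simp: obs_def)

lemma comparison_tail:
  assumes w: "\<And>i. i < n \<Longrightarrow> 0 < w i" and L: "L \<ge> 1"
    and b: "\<And>i. b i i = 0" "\<And>i j. b i j = 0 \<or> b j i = 0"
  shows "measure_pmf.prob (btl_comp_pmf n L w) {Y. \<tau> \<le> (\<Sum>i<n. \<Sum>j<n. b i j * (obs L Y i j - w i / (w j + w i)))}
      \<le> exp ((\<Sum>i<n. \<Sum>j<n. (b i j)\<^sup>2) / real L - \<tau>)"
proof -
  define T where "T = {(i,j,l). i < j \<and> j < n \<and> l < L}"
  define q where "q = (\<lambda>(i,j,l::nat). w j / (w i + w j))"
  \<comment> \<open>For \<open>i < j\<close> a true bit is a win of \<open>j\<close>, so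
    \<open>obs L Y i j\<close> contributes with a minus sign. Each of the \<open>L\<close> bits has
    weight \<open>1 / L\<close>, which leaves the factor \<open>1 / L\<close> in the sum of
    squares.\<close>
  define a where "a = (\<lambda>(i,j,l::nat). (b j i - b i j) / real L)"
  have T_eq: "T = (\<lambda>((i,j),l). (i,j,l)) ` (pairs n \<times> {..<L})"
    by (force simp: T_def pairs_def)
  then have finT: "finite T" by simp
  have inj: "inj_on (\<lambda>((i::nat,j::nat),l::nat). (i,j,l)) (pairs n \<times> {..<L})"
    by (auto simp: inj_on_def)
  have sumT: "(\<Sum>k\<in>T. f k) = (\<Sum>(i,j)\<in>pairs n. \<Sum>l<L. f (i,j,l))" for f :: "_ \<Rightarrow> real"
  proof -
    have "(\<Sum>k\<in>T. f k) = (\<Sum>(k,l)\<in>pairs n \<times> {..<L}. f (fst k, snd k, l))"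
      unfolding T_eq sum.reindex[OF inj] by (simp add: case_prod_unfold)
    also have "\<dots> = (\<Sum>k\<in>pairs n. \<Sum>l<L. f (fst k, snd k, l))"
      by (rule sum.cartesian_product[symmetric])
    finally show ?thesis
      by (simp add: case_prod_unfold)
  qed
  have q01: "0 \<le> q k \<and> q k \<le> 1" if "k \<in> T" for k
  proof -
    obtain i j l where k: "k = (i,j,l)"
      by (cases k)
    then have "i < n" "j < n"
      using that by (auto simp: T_def)
    then show ?thesis unfolding k
      using w[of i] w[of j] by (simp add: q_def)
  qed
  have main: "(\<Sum>i<n. \<Sum>j<n. b i j * (obs L Y i j - w i / (w j + w i))) = (\<Sum>k\<in>T. a k * (of_bool (Y k) - q k))" for Y
  proof -
    have "(\<Sum>i<n. \<Sum>j<n. b i j * (obs L Y i j - w i / (w j + w i))) =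
        (\<Sum>(i,j)\<in>pairs n. b i j * (obs L Y i j - w i / (w j + w i)) + b j i * (obs L Y j i - w j / (w i + w j)))"
      using b by (intro sum_square_pairs) auto
    also have "\<dots> = (\<Sum>(i,j)\<in>pairs n. \<Sum>l<L. a (i,j,l) * (of_bool (Y (i,j,l)) - q (i,j,l)))"
    proof (intro sum.cong refl, clarify)
      fix i j assume "(i, j) \<in> pairs n"
      then have ij: "i < j" "i < n" "j < n" by (auto simp: pairs_def)
      have flip: "w i / (w j + w i) = 1 - w j / (w i + w j)"
        using w[OF ij(2)] w[OF ij(3)] by (simp add: field_simps)
      have "b i j * (obs L Y i j - w i / (w j + w i)) + b j i * (obs L Y j i - w j / (w i + w j))
          = (b j i - b i j) * (btl_avg L Y i j - w j / (w i + w j))"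
        unfolding flip using ij by (simp add: obs_def left_diff_distrib right_diff_distrib diff_divide_distrib)
      also have "btl_avg L Y i j - w j / (w i + w j) = (\<Sum>l<L. of_bool (Y (i,j,l)) - w j / (w i + w j)) / real L"
        using L by (simp add: btl_avg_def sum_subtractf diff_divide_distrib of_bool_def)
      finally show "b i j * (obs L Y i j - w i / (w j + w i)) + b j i * (obs L Y j i - w j / (w i + w j))
          = (\<Sum>l<L. a (i,j,l) * (of_bool (Y (i,j,l)) - q (i,j,l)))"
        by (simp add: a_def q_def sum_distrib_left sum_divide_distrib)
    qed
    also have "\<dots> = (\<Sum>k\<in>T. a k * (of_bool (Y k) - q k))"
      by (simp add: sumT)
    finally show ?thesis .
  qed
  have "(\<Sum>k\<in>T. (a k)\<^sup>2) = (\<Sum>(i,j)\<in>pairs n. (b i j)\<^sup>2 + (b j i)\<^sup>2) / real L"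
    unfolding sumT sum_divide_distrib
  proof (intro sum.cong refl, clarify)
    fix i j
    have "(b j i - b i j)\<^sup>2 = (b i j)\<^sup>2 + (b j i)\<^sup>2"
      using b(2)[of i j] by auto
    then show "(\<Sum>l<L. (a (i,j,l))\<^sup>2) = ((b i j)\<^sup>2 + (b j i)\<^sup>2) / real L"
      using L by (simp add: a_def power_divide) (simp add: power2_eq_square)
  qed
  also have "(\<Sum>(i,j)\<in>pairs n. (b i j)\<^sup>2 + (b j i)\<^sup>2) = (\<Sum>i<n. \<Sum>j<n. (b i j)\<^sup>2)"
    using b by (intro sum_square_pairs[symmetric]) auto
  finally have sq: "(\<Sum>k\<in>T. (a k)\<^sup>2) = (\<Sum>i<n. \<Sum>j<n. (b i j)\<^sup>2) / real L" .
  have "btl_comp_pmf n L w = Pi_pmf T False (\<lambda>k. bernoulli_pmf (q k))"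
    unfolding btl_comp_pmf_def T_def q_def by (simp add: case_prod_unfold)
  then show ?thesis
    unfolding main sq[symmetric]
    using Pi_bernoulli_chernoff[of T q a "\<lambda>k. (a k)\<^sup>2" \<tau>] finT q01 bernoulli_mgf_subgaussian by simp
qed

subsection \<open>The deterministic leave-one-out bound\<close>

text \<open>The vertex stays as an isolated index, so the full and the reduced problem live in the
  same space.\<close>

definition delete_vertex :: "nat \<Rightarrow> (nat \<Rightarrow> nat \<Rightarrow> real) \<Rightarrow> nat \<Rightarrow> nat \<Rightarrow> real" where
  "delete_vertex m A i j = (if i = m \<or> j = m then 0 else A i j)"

definition unit_radius :: "nat \<Rightarrow> nat \<Rightarrow> real" where
  "unit_radius n i = of_bool (i < n)"

lemma sum_mult_le_L2:
  fixes f g :: "'a \<Rightarrow> real"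
  shows "\<bar>\<Sum>i\<in>I. f i * g i\<bar> \<le> L2_set f I * L2_set g I"
proof -
  have "\<bar>\<Sum>i\<in>I. f i * g i\<bar> \<le> (\<Sum>i\<in>I. \<bar>f i\<bar> * \<bar>g i\<bar>)"
    using sum_abs[of "\<lambda>i. f i * g i" I] by (simp add: abs_mult)
  also have "\<dots> \<le> L2_set f I * L2_set g I"
    by (rule L2_set_mult_ineq)
  finally show ?thesis .
qed

lemma sum_abs_le_L2: "(\<Sum>i<n. \<bar>f i\<bar>) \<le> sqrt (real n) * L2_set f {..<n}"
  using L2_set_mult_ineq[of "\<lambda>_. 1" f "{..<n}"] by (simp add: L2_set_def)

lemma L2_set_square: "(\<Sum>i\<in>I. (f i)\<^sup>2) = (L2_set f I)\<^sup>2"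
  by (simp add: L2_set_def sum_nonneg)

lemma sum_delete_vertex:
  "(\<Sum>i<n. \<Sum>j<n. delete_vertex m A i j * f i j) = (\<Sum>i\<in>{..<n}-{m}. \<Sum>j\<in>{..<n}-{m}. A i j * f i j)"
proof -
  have "(\<Sum>i<n. \<Sum>j<n. delete_vertex m A i j * f i j) = (\<Sum>i\<in>{..<n}-{m}. \<Sum>j<n. delete_vertex m A i j * f i j)"
    by (intro sum.mono_neutral_right) (auto simp: delete_vertex_def)
  also have "\<dots> = (\<Sum>i\<in>{..<n}-{m}. \<Sum>j\<in>{..<n}-{m}. A i j * f i j)"
  proof (rule sum.cong[OF refl])
    fix i assume i: "i \<in> {..<n} - {m}"
    have "(\<Sum>j<n. delete_vertex m A i j * f i j) = (\<Sum>j\<in>{..<n}-{m}. delete_vertex m A i j * f i j)"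
      by (intro sum.mono_neutral_right) (auto simp: delete_vertex_def)
    also have "\<dots> = (\<Sum>j\<in>{..<n}-{m}. A i j * f i j)"
      using i by (intro sum.cong refl) (auto simp: delete_vertex_def)
    finally show "(\<Sum>j<n. delete_vertex m A i j * f i j) = (\<Sum>j\<in>{..<n}-{m}. A i j * f i j)" .
  qed
  finally show ?thesis .
qed

text \<open>The deterministic facts about one realisation on which the error bound rests;
  \<open>l\<close> stands for \<open>ln n\<close> and \<open>u m\<close> for the minimiser without
  the edges at \<open>m\<close>. In \<open>cut\<close> an index \<open>m\<close> outside
  \<open>{..<n}\<close> deletes nothing and describes the full graph. In \<open>bernstein\<close>
  the bounds \<open>b\<close> and \<open>V\<close> are free because they are later expressed through
  the error of \<open>x\<close>.\<close>

locale btl_event =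
  fixes n :: nat and A y :: "nat \<Rightarrow> nat \<Rightarrow> real" and lam p B c0 l eps clam :: real
    and ts x :: "nat \<Rightarrow> real" and u :: "nat \<Rightarrow> nat \<Rightarrow> real"
  assumes n2: "2 \<le> n" and p: "0 < p" "p \<le> 1"
    and A_sym: "\<And>i j. A j i = A i j" and A_01: "\<And>i j. A i j = 0 \<or> A i j = 1" and A_irrefl: "\<And>i. A i i = 0"
    and y_flip: "\<And>i j. i \<noteq> j \<Longrightarrow> y j i = 1 - y i j"
    and ts_sum: "(\<Sum>i<n. ts i) = 0" and ts_bound: "\<And>i. i < n \<Longrightarrow> \<bar>ts i\<bar> \<le> B"
    and cut: "\<And>m S. S \<subseteq> {..<n} - {m} \<Longrightarrow> S \<noteq> {} \<Longrightarrow> 2 * card S \<le> card ({..<n} - {m}) \<Longrightarrow>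
        real n * p / 8 * real (card S) \<le> (\<Sum>i\<in>S. \<Sum>j\<in>{..<n} - {m} - S. A i j)"
    and deg: "\<And>i. i < n \<Longrightarrow> (\<Sum>j<n. A i j) \<le> 3 * (real n * p)"
    and noise_pair: "\<And>i j. i < n \<Longrightarrow> j < n \<Longrightarrow> i \<noteq> j \<Longrightarrow>
        \<bar>y i j - sigmoid (ts i - ts j)\<bar> \<le> 6 * (sqrt (real n * p) * eps)"
    and noise_vertex: "\<And>i. i < n \<Longrightarrow> \<bar>\<Sum>j<n. A i j * (y i j - sigmoid (ts i - ts j))\<bar> \<le> 11 * (real n * p * eps)"
    and lam: "lam = clam * (real n * p * eps)" and clam: "0 < clam"
    and l: "1 / 2 \<le> l" "c0 * l \<le> real n * p" and c0: "2 \<le> c0" and eps: "0 < eps"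
    and x_min: "rect_minimizer n A y lam p ts (unit_radius n) x"
    and u_min: "\<And>m. m < n \<Longrightarrow> rect_minimizer n (delete_vertex m A) y lam p ts ((unit_radius n)(m := 0)) (u m)"
    and bernstein: "\<And>m b V. m < n \<Longrightarrow> (\<And>j. j < n \<Longrightarrow> \<bar>u m j - ts j\<bar> \<le> b) \<Longrightarrow> (\<Sum>j<n. (u m j - ts j)\<^sup>2) \<le> V \<Longrightarrow>
        \<bar>\<Sum>j\<in>{..<n} - {m}. (A m j - p) * (u m j - ts j)\<bar> \<le> 8 * (l * b + sqrt (p * l * V))"
begin

definition Delta where "Delta = real n * p"
text \<open>Two coordinates of \<open>ts\<close> differ by at most \<open>2 * B\<close>, and the
  unit box adds 1 for each of them.\<close>

definition R where "R = 2 * B + 2"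
definition c where "c = exp (- R) / 4"
text \<open>The spectral gap is \<open>(Delta / 8)^2 / (2 * (3 * Delta)) = Delta / 384\<close>, and
  \<open>11 + clam * B\<close> bounds the gradient entries at \<open>ts\<close> in units of
  \<open>Delta * eps\<close>: noise plus ridge.\<close>

definition K_l2 where "K_l2 = 384 / c * (11 + clam * B)"
text \<open>Here \<open>4608 = 12 * 384\<close>, where 12 is the larger coefficient in the bound
  \<open>5 * (M / sqrt Delta) + 12 * eps\<close> of the leave-one-out comparison.\<close>

definition K_loo where "K_loo = 4608 / c"
definition d where "d i = x i - ts i"
definition N2 where "N2 = L2_set d {..<n}"

lemma B0: "0 \<le> B"
  using ts_bound[of 0] n2 by fastforce

lemma c_pos: "0 < c"
  by (simp add: c_def)

lemma K_l2_pos: "0 < K_l2"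
  using c_pos B0 clam by (auto simp: K_l2_def intro!: mult_pos_pos divide_pos_pos add_pos_nonneg)

lemma K_loo_pos: "0 < K_loo"
  using c_pos by (simp add: K_loo_def)

lemma Delta_ge: "c0 / 2 \<le> Delta" "c0 * l \<le> Delta" "1 \<le> Delta"
proof -
  have "c0 * (1 / 2) \<le> c0 * l"
    using l c0 by (intro mult_left_mono) auto
  then show "c0 / 2 \<le> Delta" "c0 * l \<le> Delta" "1 \<le> Delta"
    using l(2) c0 unfolding Delta_def by linarith+
qed

lemma A_nonneg: "0 \<le> A i j"
  using A_01[of i j] by auto

lemma edge_flip: "A i j \<noteq> 0 \<Longrightarrow> y j i = 1 - y i j"
  using A_irrefl y_flip by metis

lemma x_variational:
  assumes "z \<in> rect ts (unit_radius n)"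
  shows "0 \<le> (\<Sum>i<n. pgrad n A y lam p x i * (z i - x i))"
  by (rule rect_minimizer_variational[OF _ _ x_min assms]) (rule A_sym, erule edge_flip)

lemma A_square: "(A i j)\<^sup>2 = A i j"
  using A_01[of i j] by auto

lemma A_L2: "i < n \<Longrightarrow> L2_set (A i) {..<n} \<le> 2 * sqrt Delta"
proof -
  assume i: "i < n"
  have "L2_set (A i) {..<n} = sqrt (\<Sum>j<n. A i j)"
    by (simp add: L2_set_def A_square)
  also have "\<dots> \<le> sqrt (4 * Delta)"
    using deg[OF i] Delta_ge by (simp add: Delta_def)
  finally show ?thesis by (simp add: real_sqrt_mult)
qed

lemma p_sqrt_n: "p * sqrt (real n) \<le> sqrt Delta"
proof -
  have "p * sqrt (real n) = sqrt (p * p * real n)"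
    using p by (simp add: real_sqrt_mult)
  also have "\<dots> \<le> sqrt Delta"
    unfolding Delta_def using p mult_right_mono[of "p * p" p "real n"]
    by (simp add: mult_left_le_one_le mult.commute)
  finally show ?thesis .
qed

lemma x_bound: "\<bar>d i\<bar> \<le> unit_radius n i" "i < n \<Longrightarrow> \<bar>d i\<bar> \<le> 1"
  using x_min by (auto simp: rect_minimizer_def rect_def d_def unit_radius_def of_bool_def split: if_splits)

lemma diff_bound:
  assumes "i < n" "j < n" "\<bar>z i - ts i\<bar> \<le> 1" "\<bar>z j - ts j\<bar> \<le> 1"
  shows "\<bar>z i - z j\<bar> \<le> R"
  using assms ts_bound[of i] ts_bound[of j] unfolding R_def by linarith

text \<open>A vector vanishing at \<open>m\<close> does not see that the deleted vertex is isolated,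
  so Cheeger's inequality on the remaining vertices suffices. Taking \<open>m = n\<close> gives the
  gap of the full graph.\<close>

lemma spectral_gap:
  assumes v: "m < n \<Longrightarrow> v m = 0"
  shows "Delta / 384 * (\<Sum>i<n. (v i)\<^sup>2) \<le>
     (\<Sum>i<n. \<Sum>j<n. delete_vertex m A i j * (v i - v j)\<^sup>2) / 2 + p * (\<Sum>i<n. v i)\<^sup>2"
proof -
  let ?V = "{..<n} - {m}"
  have D: "1 \<le> Delta" by (rule Delta_ge)
  have card: "real n / 2 \<le> real (card ?V)"
    using n2 by (cases "m < n") auto
  then have ne: "?V \<noteq> {}"
    using n2 by force
  have "Delta / 384 * (\<Sum>i\<in>?V. (v i)\<^sup>2) \<le>
     (\<Sum>i\<in>?V. \<Sum>j\<in>?V. A i j * (v i - v j)\<^sup>2) / 2 + p * (\<Sum>i\<in>?V. v i)\<^sup>2"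
  proof (rule cheeger_poincare[where h = "Delta / 8" and D = "3 * Delta"])
    fix i assume i: "i \<in> ?V"
    have "(\<Sum>j\<in>?V. A i j) \<le> (\<Sum>j<n. A i j)"
      by (intro sum_mono2) (auto simp: A_nonneg)
    then show "(\<Sum>j\<in>?V. A i j) \<le> 3 * Delta"
      using deg[of i] i by (simp add: Delta_def)
  next
    show "Delta / 384 \<le> (Delta / 8)\<^sup>2 / (2 * (3 * Delta))"
      using D by (simp add: power2_eq_square field_simps)
    have "Delta / 384 \<le> p * (real n / 2)"
      using D by (simp add: Delta_def field_simps)
    also have "\<dots> \<le> p * real (card ?V)"
      using card p by (intro mult_left_mono) auto
    finally show "Delta / 384 \<le> p * real (card ?V)" .
  next
    fix S assume "S \<subseteq> ?V" "S \<noteq> {}" "2 * card S \<le> card ?V"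
    then show "Delta / 8 * real (card S) \<le> (\<Sum>i\<in>S. \<Sum>j\<in>?V - S. A i j)"
      using cut[of S m] by (simp add: Delta_def)
  qed (use D ne A_sym A_nonneg in auto)
  moreover have "(\<Sum>i<n. (v i)\<^sup>2) = (\<Sum>i\<in>?V. (v i)\<^sup>2)" "(\<Sum>i<n. v i) = (\<Sum>i\<in>?V. v i)"
    by (intro sum.mono_neutral_right; use v in auto)+
  ultimately show ?thesis
    unfolding sum_delete_vertex by simp
qed

lemma delete_vertex_n: "i < n \<Longrightarrow> j < n \<Longrightarrow> delete_vertex n A i j = A i j"
  by (simp add: delete_vertex_def)

text \<open>Since \<open>ts\<close> lies in the box, the gradient at \<open>x\<close> paired with
  \<open>d\<close> is at most 0. Strong monotonicity then bounds the squared norm by the gradient at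
  the truth paired with \<open>-d\<close>, whose entries consist of noise and ridge only. The factor
  \<open>sqrt n\<close> comes from comparing the l1 and l2 norms.\<close>

lemma l2_bound: "N2 \<le> K_l2 * (sqrt (real n) * eps)"
proof -
  define g where "g = (11 + clam * B) * (Delta * eps)"
  have D: "1 \<le> Delta" by (rule Delta_ge)
  have ts_in: "ts \<in> rect ts (unit_radius n)"
    by (simp add: rect_def unit_radius_def)
  have "0 \<le> (\<Sum>i<n. pgrad n A y lam p x i * (ts i - x i))"
    by (rule x_variational[OF ts_in])
  moreover have "(\<Sum>i<n. pgrad n A y lam p x i * (ts i - x i)) = - (\<Sum>i<n. pgrad n A y lam p x i * d i)"
    unfolding sum_negf[symmetric] by (intro sum.cong refl) (simp add: d_def algebra_simps)
  ultimately have 1: "(\<Sum>i<n. pgrad n A y lam p x i * d i) \<le> 0"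
    by simp
  have 2: "c * (Delta / 384) * (\<Sum>i<n. (x i - ts i)\<^sup>2) \<le>
      (\<Sum>i<n. (pgrad n A y lam p x i - pgrad n A y lam p ts i) * (x i - ts i))"
    unfolding c_def
  proof (rule pgrad_strongly_monotone)
    show "Delta / 384 * (\<Sum>i<n. (x i - ts i)\<^sup>2) \<le>
        (\<Sum>i<n. \<Sum>j<n. A i j * (x i - ts i - (x j - ts j))\<^sup>2) / 2 + p * (\<Sum>i<n. x i - ts i)\<^sup>2"
      using spectral_gap[of n "\<lambda>i. x i - ts i"] by (simp add: delete_vertex_n)
    show "\<bar>x i - x j\<bar> \<le> R" if "i < n" "j < n" for i j
      using x_bound(2)[OF that(1)] x_bound(2)[OF that(2)] that by (intro diff_bound) (auto simp: d_def)
    show "\<bar>ts i - ts j\<bar> \<le> R" if "i < n" "j < n" for i j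
      using that by (intro diff_bound) auto
    show "0 \<le> R" using B0 by (simp add: R_def)
    show "0 \<le> lam" using clam eps D by (simp add: lam Delta_def)
  qed (use A_sym A_nonneg p in auto)
  have grad: "\<bar>pgrad n A y lam p ts i\<bar> \<le> g" if i: "i < n" for i
  proof -
    have "pgrad n A y lam p ts i = - (\<Sum>j<n. A i j * (y i j - sigmoid (ts i - ts j))) + lam * ts i"
      unfolding pgrad_def ts_sum sum_negf[symmetric] by (simp add: algebra_simps)
    moreover have "\<bar>lam * ts i\<bar> \<le> clam * (Delta * eps) * B"
      using ts_bound[OF i] clam eps D by (auto simp: lam Delta_def[symmetric] abs_mult intro!: mult_left_mono)
    ultimately show ?thesis
      using noise_vertex[OF i] unfolding g_def Delta_def by (simp add: algebra_simps)
  qed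
  have "c * (Delta / 384) * N2\<^sup>2 \<le> (\<Sum>i<n. (pgrad n A y lam p x i - pgrad n A y lam p ts i) * d i)"
    using 2 by (simp add: N2_def L2_set_square[symmetric] d_def)
  also have "\<dots> \<le> (\<Sum>i<n. - pgrad n A y lam p ts i * d i)"
    using 1 by (simp add: left_diff_distrib sum_subtractf sum_negf)
  also have "\<dots> \<le> (\<Sum>i<n. g * \<bar>d i\<bar>)"
  proof (intro sum_mono)
    fix i assume "i \<in> {..<n}"
    then have "\<bar>pgrad n A y lam p ts i\<bar> * \<bar>d i\<bar> \<le> g * \<bar>d i\<bar>"
      by (intro mult_right_mono grad) auto
    moreover have "- pgrad n A y lam p ts i * d i \<le> \<bar>pgrad n A y lam p ts i\<bar> * \<bar>d i\<bar>"
      using abs_ge_self[of "- pgrad n A y lam p ts i * d i"] by (simp add: abs_mult)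
    ultimately show "- pgrad n A y lam p ts i * d i \<le> g * \<bar>d i\<bar>"
      by linarith
  qed
  also have "\<dots> \<le> g * (sqrt (real n) * N2)"
    unfolding sum_distrib_left[symmetric] N2_def
    using clam B0 eps D by (intro mult_left_mono sum_abs_le_L2) (auto simp: g_def)
  finally have main: "c * (Delta / 384) * N2\<^sup>2 \<le> g * (sqrt (real n) * N2)" .
  show ?thesis
  proof (cases "N2 = 0")
    case True
    then show ?thesis using K_l2_pos eps by simp
  next
    case False
    then have N2: "0 < N2"
      using L2_set_nonneg[of d "{..<n}"] unfolding N2_def by linarith
    have "N2 * (c * (Delta / 384) * N2) \<le> N2 * (g * sqrt (real n))"
      using main by (simp add: power2_eq_square algebra_simps)
    then have "c * (Delta / 384) * N2 \<le> g * sqrt (real n)"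
      using N2 by simp
    then have "Delta * (c / 384 * N2) \<le> Delta * ((11 + clam * B) * eps * sqrt (real n))"
      by (simp add: g_def algebra_simps)
    then have "c / 384 * N2 \<le> (11 + clam * B) * eps * sqrt (real n)"
      using D by simp
    then show ?thesis
      using c_pos by (simp add: K_l2_def field_simps)
  qed
qed

section \<open>Distance to the leave-one-out minimisers\<close>

definition v where "v m i = (if i = m then 0 else x i - u m i)"

text \<open>The two minimisers belong to different boxes, so each is tested against a hybrid:
  \<open>u m\<close> with its \<open>m\<close>-th entry taken from \<open>x\<close>, and
  \<open>x\<close> with its \<open>m\<close>-th entry reset to \<open>ts m\<close>. Both directions
  are multiples of \<open>v m\<close>. Off \<open>m\<close> the two gradients differ only by the
  edge to \<open>m\<close>, of size at most \<open>2 * M\<close> plus the noise of one pair, and by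
  the change \<open>p * d m\<close> of the penalty. As \<open>m\<close> has at most
  \<open>3 * Delta\<close> neighbours, Cauchy-Schwarz gains a factor \<open>1 / sqrt Delta\<close>
  over the spectral gap.\<close>

lemma leave_one_out_bound:
  assumes m: "m < n" and M: "\<And>i. i < n \<Longrightarrow> \<bar>d i\<bar> \<le> M"
  shows "L2_set (v m) {..<n} \<le> K_loo * (eps + M / sqrt Delta)"
proof -
  define A' where "A' = delete_vertex m A"
  define x' where "x' = x(m := ts m)"
  define N where "N = L2_set (v m) {..<n}"
  have D: "1 \<le> Delta" by (rule Delta_ge)
  have M0: "0 \<le> M" using M[OF m] by linarith
  have A': "A' j i = A' i j" "0 \<le> A' i j" "A' i j \<noteq> 0 \<Longrightarrow> y j i = 1 - y i j" for i j
    using A_sym[of i j] A_nonneg[of i j] edge_flip[of i j] by (auto simp: A'_def delete_vertex_def split: if_splits)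
  have u_in: "u m \<in> rect ts ((unit_radius n)(m := 0))"
    using u_min[OF m] by (simp add: rect_minimizer_def)
  have u_m: "u m m = ts m"
    using u_in unfolding rect_def by (auto dest: spec[of _ m])
  have u_r: "\<bar>u m i - ts i\<bar> \<le> unit_radius n i" for i
    using u_in u_m by (cases "i = m") (auto simp: rect_def unit_radius_def dest: spec[of _ i])
  have x_r: "\<bar>x i - ts i\<bar> \<le> unit_radius n i" for i
    using x_bound(1)[of i] by (simp add: d_def)
  \<comment> \<open>Keeping the entry \<open>x m\<close> in the test point makes the direction
    exactly \<open>- v m\<close>.\<close>
  have "0 \<le> (\<Sum>i<n. pgrad n A y lam p x i * ((if i = m then x m else u m i) - x i))"
    by (rule x_variational) (use u_r x_r in \<open>auto simp: rect_def\<close>)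
  moreover have "(\<Sum>i<n. pgrad n A y lam p x i * ((if i = m then x m else u m i) - x i))
      = - (\<Sum>i<n. pgrad n A y lam p x i * v m i)"
    unfolding sum_negf[symmetric] by (intro sum.cong refl) (auto simp: v_def algebra_simps)
  ultimately have 1: "(\<Sum>i<n. pgrad n A y lam p x i * v m i) \<le> 0"
    by simp
  have x'u: "x' i - u m i = v m i" for i
    by (simp add: x'_def v_def u_m)
  have x'_in: "x' \<in> rect ts ((unit_radius n)(m := 0))"
    using x_r by (auto simp: rect_def x'_def)
  have "0 \<le> (\<Sum>i<n. pgrad n A' y lam p (u m) i * (x' i - u m i))"
    by (rule rect_minimizer_variational[OF _ _ u_min[OF m, folded A'_def] x'_in]) (rule A'(1), erule A'(3))
  then have 2: "0 \<le> (\<Sum>i<n. pgrad n A' y lam p (u m) i * v m i)"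
    by (simp add: x'u)
  have "c * (Delta / 384) * (\<Sum>i<n. (x' i - u m i)\<^sup>2) \<le>
      (\<Sum>i<n. (pgrad n A' y lam p x' i - pgrad n A' y lam p (u m) i) * (x' i - u m i))"
    unfolding c_def
  proof (rule pgrad_strongly_monotone)
    show "Delta / 384 * (\<Sum>i<n. (x' i - u m i)\<^sup>2) \<le>
        (\<Sum>i<n. \<Sum>j<n. A' i j * (x' i - u m i - (x' j - u m j))\<^sup>2) / 2 + p * (\<Sum>i<n. x' i - u m i)\<^sup>2"
      using spectral_gap[of m "v m"] unfolding x'u by (simp add: v_def A'_def)
    show "\<bar>x' i - x' j\<bar> \<le> R" if "i < n" "j < n" for i j
      using x_bound(2)[OF that(1)] x_bound(2)[OF that(2)] that by (intro diff_bound) (auto simp: d_def x'_def)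
    show "\<bar>u m i - u m j\<bar> \<le> R" if "i < n" "j < n" for i j
      using u_r[of i] u_r[of j] that by (intro diff_bound) (auto simp: unit_radius_def)
    show "0 \<le> R" using B0 by (simp add: R_def)
    show "0 \<le> lam" using clam eps D by (simp add: lam Delta_def)
  qed (use A'(1,2) p in auto)
  then have "c * (Delta / 384) * N\<^sup>2 \<le> (\<Sum>i<n. (pgrad n A' y lam p x' i - pgrad n A' y lam p (u m) i) * v m i)"
    by (simp add: N_def x'u L2_set_square)
  \<comment> \<open>By the two variational inequalities, \<open>u m\<close> in its own problem may
    be replaced by \<open>x\<close> in the full problem.\<close>
  also have "\<dots> \<le> (\<Sum>i<n. (pgrad n A' y lam p x' i - pgrad n A y lam p x i) * v m i)"
    using 1 2 by (simp add: left_diff_distrib sum_subtractf)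
  also have "\<dots> \<le> (\<Sum>i<n. (2 * M + 6 * (sqrt Delta * eps)) * (A m i * \<bar>v m i\<bar>) + p * M * \<bar>v m i\<bar>)"
  proof (intro sum_mono)
    fix i assume "i \<in> {..<n}"
    then have i: "i < n" by simp
    show "(pgrad n A' y lam p x' i - pgrad n A y lam p x i) * v m i \<le>
      (2 * M + 6 * (sqrt Delta * eps)) * (A m i * \<bar>v m i\<bar>) + p * M * \<bar>v m i\<bar>"
    proof (cases "i = m")
      case True
      then show ?thesis by (simp add: v_def)
    next
      case False
      have "(\<Sum>j<n. A' i j * (sigmoid (x' i - x' j) - y i j)) =
          (\<Sum>j\<in>{..<n}-{m}. A i j * (sigmoid (x i - x j) - y i j))"
      proof -
        have "(\<Sum>j<n. A' i j * (sigmoid (x' i - x' j) - y i j)) =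
            (\<Sum>j\<in>{..<n}-{m}. A' i j * (sigmoid (x' i - x' j) - y i j))"
          by (intro sum.mono_neutral_right) (auto simp: A'_def delete_vertex_def)
        also have "\<dots> = (\<Sum>j\<in>{..<n}-{m}. A i j * (sigmoid (x i - x j) - y i j))"
          using False by (intro sum.cong refl) (auto simp: A'_def delete_vertex_def x'_def)
        finally show ?thesis .
      qed
      moreover have "(\<Sum>j<n. A i j * (sigmoid (x i - x j) - y i j)) =
          A i m * (sigmoid (x i - x m) - y i m) + (\<Sum>j\<in>{..<n}-{m}. A i j * (sigmoid (x i - x j) - y i j))"
        using m by (intro sum.remove) auto
      moreover have "(\<Sum>k<n. x' k) = (\<Sum>k<n. x k) - d m"
        using m by (simp add: x'_def sum.remove[of "{..<n}" m] d_def)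
      ultimately have eq: "pgrad n A' y lam p x' i - pgrad n A y lam p x i =
          - (A i m * (sigmoid (x i - x m) - y i m)) - p * d m"
        using False by (simp add: pgrad_def x'_def right_diff_distrib)
      have "\<bar>sigmoid (x i - x m) - sigmoid (ts i - ts m)\<bar> \<le> \<bar>(x i - x m) - (ts i - ts m)\<bar>"
        by (rule sigmoid_lipschitz)
      also have "\<dots> \<le> 2 * M"
        using M[OF i] M[OF m] by (simp add: d_def)
      finally have "\<bar>sigmoid (x i - x m) - y i m\<bar> \<le> 2 * M + 6 * (sqrt Delta * eps)"
        using noise_pair[OF i m False] by (simp add: Delta_def)
      then have "A m i * \<bar>sigmoid (x i - x m) - y i m\<bar> \<le> A m i * (2 * M + 6 * (sqrt Delta * eps))"
        by (intro mult_left_mono A_nonneg)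
      moreover have "p * \<bar>d m\<bar> \<le> p * M"
        using p M[OF m] by simp
      moreover have "\<bar>A i m * (sigmoid (x i - x m) - y i m)\<bar> = A m i * \<bar>sigmoid (x i - x m) - y i m\<bar>"
        using A_nonneg[of m i] A_sym[of m i] by (simp add: abs_mult)
      moreover have "\<bar>p * d m\<bar> = p * \<bar>d m\<bar>"
        using p by (simp add: abs_mult)
      ultimately have "\<bar>pgrad n A' y lam p x' i - pgrad n A y lam p x i\<bar> \<le> A m i * (2 * M + 6 * (sqrt Delta * eps)) + p * M"
        unfolding eq by linarith
      then have "\<bar>pgrad n A' y lam p x' i - pgrad n A y lam p x i\<bar> * \<bar>v m i\<bar> \<le>
          (A m i * (2 * M + 6 * (sqrt Delta * eps)) + p * M) * \<bar>v m i\<bar>"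
        by (intro mult_right_mono) auto
      moreover have "(pgrad n A' y lam p x' i - pgrad n A y lam p x i) * v m i \<le>
          \<bar>pgrad n A' y lam p x' i - pgrad n A y lam p x i\<bar> * \<bar>v m i\<bar>"
        by (metis abs_ge_self abs_mult)
      ultimately show ?thesis
        by (simp add: algebra_simps)
    qed
  qed
  also have "\<dots> = (2 * M + 6 * (sqrt Delta * eps)) * (\<Sum>i<n. A m i * \<bar>v m i\<bar>) + p * M * (\<Sum>i<n. \<bar>v m i\<bar>)"
    by (simp add: sum.distrib sum_distrib_left)
  also have "\<dots> \<le> (2 * M + 6 * (sqrt Delta * eps)) * (2 * sqrt Delta * N) + p * M * (sqrt (real n) * N)"
  proof -
    have "(\<Sum>i<n. A m i * \<bar>v m i\<bar>) \<le> L2_set (A m) {..<n} * N"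
      using L2_set_mult_ineq[of "A m" "v m" "{..<n}"] by (simp add: A_nonneg N_def)
    also have "\<dots> \<le> 2 * sqrt Delta * N"
      by (intro mult_right_mono A_L2 m) (simp add: N_def L2_set_nonneg)
    finally show ?thesis
      using M0 p eps D sum_abs_le_L2[of "v m" n]
      by (intro add_mono mult_left_mono) (auto simp: N_def)
  qed
  also have "\<dots> \<le> (2 * M + 6 * (sqrt Delta * eps)) * (2 * sqrt Delta * N) + M * (sqrt Delta * N)"
  proof -
    have "0 \<le> M * N"
      using M0 by (simp add: N_def L2_set_nonneg)
    from mult_left_mono[OF p_sqrt_n this] show ?thesis
      by (simp add: algebra_simps)
  qed
  also have "\<dots> = N * (5 * (M * sqrt Delta) + 12 * (Delta * eps))"
  proof -
    define r where "r = sqrt Delta"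
    have "Delta = r * r" using D by (simp add: r_def)
    then show ?thesis unfolding r_def[symmetric] by (simp add: algebra_simps)
  qed
  finally have main: "c * (Delta / 384) * N\<^sup>2 \<le> N * (5 * (M * sqrt Delta) + 12 * (Delta * eps))" .
  show ?thesis
  proof (cases "N = 0")
    case True
    then show ?thesis
      using K_loo_pos eps M0 D by (simp add: N_def)
  next
    case False
    then have N: "0 < N"
      using L2_set_nonneg[of "v m" "{..<n}"] unfolding N_def by linarith
    have "N * (c * (Delta / 384) * N) \<le> N * (5 * (M * sqrt Delta) + 12 * (Delta * eps))"
      using main by (simp add: power2_eq_square algebra_simps)
    then have "c * (Delta / 384) * N \<le> 5 * (M * sqrt Delta) + 12 * (Delta * eps)"
      using N by simp
    moreover have "M * sqrt Delta = Delta * (M / sqrt Delta)"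
      using D by (simp add: field_simps)
    ultimately have "Delta * (c / 384 * N) \<le> Delta * (5 * (M / sqrt Delta) + 12 * eps)"
      by (simp add: algebra_simps)
    then have "c / 384 * N \<le> 5 * (M / sqrt Delta) + 12 * eps"
      using D by simp
    also have "\<dots> \<le> 12 * (eps + M / sqrt Delta)"
    proof -
      have "0 \<le> M / sqrt Delta" using M0 D by simp
      then show ?thesis by simp
    qed
    finally show ?thesis
      using c_pos by (simp add: K_loo_def N_def field_simps)
  qed
qed

text \<open>Off \<open>m\<close> one has \<open>d = w + v m\<close>, where
  \<open>w = u m - ts\<close> is independent of the edges at \<open>m\<close>. The sum splits into a
  centred form in \<open>w\<close> (Bernstein), \<open>p\<close> times the plain sum of
  \<open>w\<close> (the l2 bound), and a part in \<open>v m\<close> (Cauchy-Schwarz). Every term in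
  \<open>M\<close> carries \<open>Delta / c0\<close>, by \<open>l \<le> Delta / c0\<close> and
  \<open>1 \<le> 2 * Delta / c0\<close>.\<close>

lemma neighbour_sum_bound:
  assumes m: "m < n" and M: "\<And>i. i < n \<Longrightarrow> \<bar>d i\<bar> \<le> M"
  shows "\<bar>\<Sum>j<n. A m j * d j\<bar> \<le> (9 * K_l2 + 19 * K_loo) * (Delta * eps) + (8 + 30 * K_loo) * (Delta * M / c0)"
proof -
  define N where "N = L2_set (v m) {..<n}"
  define w where "w j = u m j - ts j" for j
  have D: "1 \<le> Delta" by (rule Delta_ge)
  have M0: "0 \<le> M" using M[OF m] by linarith
  have N0: "0 \<le> N" by (simp add: N_def L2_set_nonneg)
  have N20: "0 \<le> N2" by (simp add: N2_def L2_set_nonneg)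
  have N: "N \<le> K_loo * (eps + M / sqrt Delta)"
    unfolding N_def by (rule leave_one_out_bound[OF m M])
  have w_m: "w m = 0"
    using u_min[OF m] by (auto simp: rect_minimizer_def rect_def w_def dest!: spec[of _ m])
  have split: "d j = w j + v m j" if "j \<noteq> m" for j
    using that by (simp add: d_def w_def v_def)
  have v_le: "\<bar>v m j\<bar> \<le> N" if "j < n" for j
    using member_le_L2_set[of "{..<n}" j "\<lambda>j. \<bar>v m j\<bar>"] that
    by (simp add: N_def L2_set_def)
  have w_inf: "\<bar>w j\<bar> \<le> M + N" if "j < n" for j
    using split[of j] w_m M[OF that] v_le[OF that] M0 N0 by (cases "j = m") auto
  have w_2: "L2_set w {..<n} \<le> N2 + N"
  proof -
    have "L2_set w {..<n} \<le> L2_set (\<lambda>j. d j + (- v m j)) {..<n}"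
      unfolding L2_set_def
    proof (intro real_sqrt_le_mono sum_mono)
      fix j show "(w j)\<^sup>2 \<le> (d j + (- v m j))\<^sup>2"
        using split[of j] w_m by (cases "j = m") auto
    qed
    also have "\<dots> \<le> N2 + N"
      using L2_set_triangle_ineq[of d "\<lambda>j. - v m j" "{..<n}"] by (simp add: N2_def N_def L2_set_def)
    finally show ?thesis .
  qed
  have "\<bar>\<Sum>j\<in>{..<n} - {m}. (A m j - p) * w j\<bar> \<le> 8 * (l * (M + N) + sqrt (p * l * (N2 + N)\<^sup>2))"
    unfolding w_def
  proof (rule bernstein[OF m])
    show "(\<Sum>j<n. (u m j - ts j)\<^sup>2) \<le> (N2 + N)\<^sup>2"
      using power_mono[OF w_2 L2_set_nonneg, of 2] by (simp add: L2_set_square[symmetric] w_def)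
  qed (use w_inf in \<open>simp add: w_def\<close>)
  also have "sqrt (p * l * (N2 + N)\<^sup>2) = sqrt (p * l) * (N2 + N)"
    using N0 N20 by (simp add: real_sqrt_mult)
  also have "sqrt (p * l) * (N2 + N) \<le> p * sqrt (real n) * (N2 + N)"
  proof (intro mult_right_mono)
    have "1 * l \<le> c0 * l" using c0 l by (intro mult_right_mono) auto
    then have "l \<le> real n * p" using l(2) by linarith
    then have "p * l \<le> p * (p * real n)"
      using p by (simp add: mult.commute)
    then have "sqrt (p * l) \<le> sqrt (p * (p * real n))"
      by simp
    also have "\<dots> = p * sqrt (real n)"
      using p by (simp add: real_sqrt_mult flip: mult.assoc)
    finally show "sqrt (p * l) \<le> p * sqrt (real n)" .
  qed (use N0 N20 in auto)
  finally have 1: "\<bar>\<Sum>j\<in>{..<n} - {m}. (A m j - p) * w j\<bar> \<le> 8 * (l * (M + N)) + 8 * (p * sqrt (real n) * (N2 + N))"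
    by simp
  have 2: "\<bar>p * (\<Sum>j\<in>{..<n} - {m}. w j)\<bar> \<le> p * sqrt (real n) * (N2 + N)"
  proof -
    have "\<bar>\<Sum>j\<in>{..<n} - {m}. w j\<bar> \<le> (\<Sum>j\<in>{..<n} - {m}. \<bar>w j\<bar>)"
      by (rule sum_abs)
    also have "\<dots> \<le> (\<Sum>j<n. \<bar>w j\<bar>)"
      by (intro sum_mono2) auto
    also have "\<dots> \<le> sqrt (real n) * L2_set w {..<n}"
      by (rule sum_abs_le_L2)
    also have "\<dots> \<le> sqrt (real n) * (N2 + N)"
      using w_2 by (intro mult_left_mono) auto
    finally show ?thesis
      using p by (simp add: abs_mult mult.assoc)
  qed
  have 3: "\<bar>\<Sum>j<n. A m j * v m j\<bar> \<le> 2 * sqrt Delta * N"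
  proof -
    have "\<bar>\<Sum>j<n. A m j * v m j\<bar> \<le> L2_set (A m) {..<n} * N"
      unfolding N_def by (rule sum_mult_le_L2)
    also have "\<dots> \<le> 2 * sqrt Delta * N"
      using N0 by (intro mult_right_mono A_L2 m)
    finally show ?thesis .
  qed
  have "(\<Sum>j<n. A m j * d j) = (\<Sum>j<n. A m j * w j) + (\<Sum>j<n. A m j * v m j)"
    unfolding sum.distrib[symmetric] by (intro sum.cong refl) (metis A_irrefl distrib_left mult_zero_left split add_0)
  also have "(\<Sum>j<n. A m j * w j) = (\<Sum>j\<in>{..<n} - {m}. A m j * w j)"
    by (intro sum.mono_neutral_right) (auto simp: A_irrefl)
  also have "\<dots> = (\<Sum>j\<in>{..<n} - {m}. (A m j - p) * w j) + p * (\<Sum>j\<in>{..<n} - {m}. w j)"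
    by (simp add: left_diff_distrib sum_subtractf sum_distrib_left)
  finally have "\<bar>\<Sum>j<n. A m j * d j\<bar> \<le> 8 * (l * (M + N)) + 9 * (p * sqrt (real n) * (N2 + N)) + 2 * sqrt Delta * N"
    using 1 2 3 by linarith
  moreover have "p * sqrt (real n) * (N2 + N) \<le> K_l2 * (Delta * eps) + sqrt Delta * N"
  proof -
    have "p * sqrt (real n) * N2 \<le> p * sqrt (real n) * (K_l2 * (sqrt (real n) * eps))"
      using p l2_bound by (intro mult_left_mono) auto
    also have "\<dots> = p * (sqrt (real n) * sqrt (real n)) * K_l2 * eps"
      by (simp only: mult_ac)
    also have "\<dots> = K_l2 * (Delta * eps)"
      by (simp add: Delta_def)
    finally show ?thesis
      using mult_right_mono[OF p_sqrt_n N0] by (simp add: distrib_left)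
  qed
  moreover have "sqrt Delta * N \<le> K_loo * (Delta * eps) + 2 * K_loo * (Delta * M / c0)"
  proof -
    have "sqrt Delta * N \<le> sqrt Delta * (K_loo * (eps + M / sqrt Delta))"
      using N D by (intro mult_left_mono) auto
    also have "\<dots> = K_loo * (sqrt Delta * eps + M)"
      using D by (simp add: field_simps)
    also have "\<dots> \<le> K_loo * (Delta * eps + 2 * (Delta * M / c0))"
    proof (intro mult_left_mono add_mono mult_right_mono)
      show "sqrt Delta \<le> Delta"
        using D by (intro real_le_lsqrt) (auto simp: power2_eq_square)
      have "c0 * M \<le> 2 * Delta * M"
        using Delta_ge(1) M0 by (intro mult_right_mono) auto
      then show "M \<le> 2 * (Delta * M / c0)"
        using c0 by (simp add: field_simps)
    qed (use K_loo_pos eps in auto)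
    finally show ?thesis by (simp add: algebra_simps)
  qed
  moreover have "l * (M + N) \<le> Delta * M / c0 + (K_loo * (Delta * eps) + K_loo * (Delta * M / c0))"
  proof -
    have "l * (M + N) \<le> Delta / c0 * (M + N)"
      using Delta_ge(2) c0 M0 N0 by (intro mult_right_mono) (auto simp: field_simps)
    moreover have "Delta / c0 * N \<le> K_loo * (Delta * eps) + K_loo * (Delta * M / c0)"
    proof -
      have "Delta / c0 * N \<le> Delta / c0 * (K_loo * (eps + M / sqrt Delta))"
        using N D c0 by (intro mult_left_mono) auto
      also have "\<dots> = K_loo * (Delta / c0 * eps + Delta / c0 * (M / sqrt Delta))"
        by (simp add: algebra_simps)
      also have "\<dots> \<le> K_loo * (Delta * eps + Delta / c0 * M)"
      proof (intro mult_left_mono add_mono mult_right_mono)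
        show "Delta / c0 \<le> Delta"
          using c0 D by (simp add: field_simps)
        show "M / sqrt Delta \<le> M"
          using M0 D by (simp add: divide_le_eq mult_le_cancel_left1)
      qed (use K_loo_pos eps D c0 in auto)
      finally show ?thesis by (simp add: algebra_simps)
    qed
    moreover have "Delta / c0 * (M + N) = Delta * M / c0 + Delta / c0 * N"
      by (simp add: distrib_left)
    ultimately show ?thesis by linarith
  qed
  moreover have "(9 * K_l2 + 19 * K_loo) * E + (8 + 30 * K_loo) * F = 9 * (K_l2 * E) + 19 * (K_loo * E) + 8 * F + 30 * (K_loo * F)" for E F
    by (simp add: algebra_simps)
  \<comment> \<open>The final coefficients: substituting for \<open>q\<close> and then
    \<open>s\<close> gives \<open>19 = 8 + 9 + 2\<close> for \<open>b\<close> and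
    \<open>30 = 8 + 2 * (9 + 2)\<close> for \<open>g\<close>. Here \<open>h\<close>,
    \<open>q\<close>, \<open>s\<close> stand for \<open>l * (M + N)\<close>,
    \<open>p * sqrt n * (N2 + N)\<close> and \<open>sqrt Delta * N\<close>.\<close>
  moreover have "S \<le> 9 * a + 19 * b + 8 * f + 30 * g"
    if "S \<le> 8 * h + 9 * q + 2 * s" "q \<le> a + s" "s \<le> b + 2 * g" "h \<le> f + (b + g)" for S a b f g h q s :: real
    using that by linarith
  ultimately show ?thesis
    by (simp only: mult.assoc)
qed

definition K_sup where "K_sup = 16 / c * (c * (9 * K_l2 + 19 * K_loo) + 11 + clam * B + K_l2)"

text \<open>At a coordinate \<open>m\<close> with \<open>\<bar>d m\<bar> = M\<close>, all
  differences \<open>M - s * d j\<close> are nonnegative, so each neighbour pulls \<open>x m\<close>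
  towards the truth with force at least \<open>c * (M - s * d j)\<close>. Moving \<open>x m\<close>
  to \<open>ts m\<close> stays in the box, which gives \<open>s * pgrad \<le> 0\<close> on the
  boundary as well. Noise, ridge, penalty and neighbour sum must then balance
  \<open>c * Delta * M / 8\<close>.\<close>

theorem sup_norm_bound:
  assumes c0_large: "16 * (8 + 30 * K_loo) \<le> c0" and k: "k < n"
  shows "\<bar>x k - ts k\<bar> \<le> K_sup * eps"
proof -
  define M where "M = Max ((\<lambda>i. \<bar>d i\<bar>) ` {..<n})"
  have M: "\<bar>d i\<bar> \<le> M" if "i < n" for i
    using that by (auto simp: M_def)
  have "M \<in> (\<lambda>i. \<bar>d i\<bar>) ` {..<n}"
    unfolding M_def using n2 by (intro Max_in) (auto simp: lessThan_empty_iff)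
  then obtain m where m: "m < n" "M = \<bar>d m\<bar>" by auto
  have D: "1 \<le> Delta" by (rule Delta_ge)
  have M0: "0 \<le> M" using m by simp
  define s where "s = sgn (d m)"
  have K_sup_pos: "0 \<le> K_sup"
    using c_pos K_l2_pos K_loo_pos clam B0 by (simp add: K_sup_def)
  have "M \<le> K_sup * eps"
  proof (cases "M = 0")
    case True
    then show ?thesis using K_sup_pos eps by simp
  next
    case False
    then have Mpos: "0 < M" using M0 by simp
    have s: "s * s = 1" "\<bar>s\<bar> = 1" "s * d m = M" "d m = s * M"
      using Mpos m(2) by (auto simp: s_def sgn_if)
    have "x(m := ts m) \<in> rect ts (unit_radius n)"
      using x_bound(1) by (auto simp: rect_def d_def unit_radius_def)
    then have "0 \<le> (\<Sum>i<n. pgrad n A y lam p x i * ((x(m := ts m)) i - x i))"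
      by (rule x_variational)
    also have "\<dots> = (\<Sum>i\<in>{m}. pgrad n A y lam p x i * ((x(m := ts m)) i - x i))"
      using m by (intro sum.mono_neutral_right) auto
    also have "\<dots> = - (pgrad n A y lam p x m * d m)"
      by (simp add: d_def algebra_simps)
    also have "\<dots> = - (M * (s * pgrad n A y lam p x m))"
      by (simp add: s(4))
    finally have grad: "s * pgrad n A y lam p x m \<le> 0"
      using Mpos by (simp add: mult_le_0_iff)
    have sum_x: "(\<Sum>i<n. x i) = (\<Sum>i<n. d i)"
      using ts_sum by (simp add: d_def sum_subtractf)
    have lower: "c * (Delta / 8 * M - s * (\<Sum>j<n. A m j * d j)) \<le>
        s * (\<Sum>j<n. A m j * (sigmoid (x m - x j) - sigmoid (ts m - ts j)))"
    proof -
      have degm: "Delta / 8 \<le> (\<Sum>j<n. A m j)"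
      proof -
        \<comment> \<open>The cut around a single vertex, with nothing deleted (index
          \<open>n\<close>), is a lower bound for its degree.\<close>
        have "Delta / 8 * real (card {m}) \<le> (\<Sum>i\<in>{m}. \<Sum>j\<in>{..<n} - {n} - {m}. A i j)"
          unfolding Delta_def by (rule cut) (use m n2 in auto)
        also have "\<dots> \<le> (\<Sum>j<n. A m j)"
          by (simp, intro sum_mono2) (auto simp: A_nonneg)
        finally show ?thesis by simp
      qed
      have "c * (Delta / 8 * M - s * (\<Sum>j<n. A m j * d j)) \<le> c * ((\<Sum>j<n. A m j) * M - s * (\<Sum>j<n. A m j * d j))"
        using degm M0 c_pos by (intro mult_left_mono diff_right_mono mult_right_mono) auto
      also have "\<dots> = (\<Sum>j<n. A m j * (c * (M - s * d j)))"
        by (simp add: sum_distrib_left sum_distrib_right sum_subtractf algebra_simps)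
      also have "\<dots> \<le> (\<Sum>j<n. A m j * (s * (sigmoid (x m - x j) - sigmoid (ts m - ts j))))"
      proof (intro sum_mono mult_left_mono A_nonneg)
        fix j assume "j \<in> {..<n}"
        then have j: "j < n" by simp
        have b1: "\<bar>x m - x j\<bar> \<le> R"
          using x_bound(2)[OF m(1)] x_bound(2)[OF j] j m by (intro diff_bound) (auto simp: d_def)
        have b2: "\<bar>ts m - ts j\<bar> \<le> R"
          using j m by (intro diff_bound) auto
        consider "s = 1" | "s = -1"
          using s(2) by linarith
        then show "c * (M - s * d j) \<le> s * (sigmoid (x m - x j) - sigmoid (ts m - ts j))"
        proof cases
          case 1
          have "ts m - ts j \<le> x m - x j"
            using M[OF j] s(3) 1 by (simp add: d_def)
          moreover have "M - s * d j = (x m - x j) - (ts m - ts j)"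
            using s(3) 1 by (simp add: d_def)
          ultimately show ?thesis
            using sigmoid_diff_bounds[OF _ b1 b2] 1 by (simp add: c_def)
        next
          case 2
          have "x m - x j \<le> ts m - ts j"
            using M[OF j] s(3) 2 by (simp add: d_def)
          moreover have "M - s * d j = (ts m - ts j) - (x m - x j)"
            using s(3) 2 by (simp add: d_def)
          ultimately show ?thesis
            using sigmoid_diff_bounds[OF _ b2 b1] 2 by (simp add: c_def)
        qed
      qed
      also have "\<dots> = s * (\<Sum>j<n. A m j * (sigmoid (x m - x j) - sigmoid (ts m - ts j)))"
        by (simp add: sum_distrib_left algebra_simps)
      finally show ?thesis .
    qed
    define S1 where "S1 = (\<Sum>j<n. A m j * (sigmoid (x m - x j) - sigmoid (ts m - ts j)))"
    define S2 where "S2 = (\<Sum>j<n. A m j * (y m j - sigmoid (ts m - ts j)))"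
    have "pgrad n A y lam p x m = S1 - S2 + lam * x m + p * (\<Sum>i<n. d i)"
      unfolding pgrad_def sum_x S1_def S2_def sum_subtractf[symmetric] by (simp add: algebra_simps)
    then have "s * pgrad n A y lam p x m = s * S1 - s * S2 + s * (lam * x m) + s * (p * (\<Sum>i<n. d i))"
      by (simp only: distrib_left right_diff_distrib)
    then have "s * S1 \<le> s * S2 - s * (lam * x m) - s * (p * (\<Sum>i<n. d i))"
      using grad by linarith
    moreover have "s * S2 \<le> 11 * (Delta * eps)"
    proof -
      have "s * S2 \<le> \<bar>s\<bar> * \<bar>S2\<bar>" by (metis abs_ge_self abs_mult)
      then show ?thesis using noise_vertex[OF m(1)] s(2) by (simp add: S2_def Delta_def)
    qed
    moreover have "- (s * (lam * x m)) \<le> clam * (Delta * eps) * B"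
    proof -
      have lam0: "0 \<le> lam" using clam eps D by (simp add: lam Delta_def)
      \<comment> \<open>The ridge also pulls against the error \<open>M\<close>; only the pull on
        \<open>ts m\<close> has to be paid for.\<close>
      have "s * x m = s * ts m + M"
        using s(3) by (simp add: d_def algebra_simps)
      moreover have "\<bar>s * ts m\<bar> \<le> B"
        using ts_bound[OF m(1)] s(2) by (simp add: abs_mult)
      ultimately have "- (s * x m) \<le> B"
        using M0 by linarith
      from mult_left_mono[OF this lam0] show ?thesis
        by (simp add: lam Delta_def algebra_simps)
    qed
    moreover have "- (s * (p * (\<Sum>i<n. d i))) \<le> K_l2 * (Delta * eps)"
    proof -
      have "- (s * (p * (\<Sum>i<n. d i))) \<le> \<bar>s\<bar> * (p * \<bar>\<Sum>i<n. d i\<bar>)"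
        using p abs_ge_minus_self[of "s * (p * (\<Sum>i<n. d i))"] by (simp add: abs_mult)
      also have "\<dots> \<le> p * (sqrt (real n) * N2)"
        using p s(2) order_trans[OF sum_abs[of d "{..<n}"] sum_abs_le_L2] by (simp add: N2_def)
      also have "\<dots> \<le> p * (sqrt (real n) * (K_l2 * (sqrt (real n) * eps)))"
        using p l2_bound by (intro mult_left_mono) auto
      also have "\<dots> = p * (sqrt (real n) * sqrt (real n)) * K_l2 * eps"
        by (simp only: mult_ac)
      also have "\<dots> = K_l2 * (Delta * eps)"
        by (simp add: Delta_def)
      finally show ?thesis .
    qed
    moreover have "c * (s * (\<Sum>j<n. A m j * d j)) \<le>
        c * ((9 * K_l2 + 19 * K_loo) * (Delta * eps) + (8 + 30 * K_loo) * (Delta * M / c0))"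
    proof (intro mult_left_mono)
      have "s * (\<Sum>j<n. A m j * d j) \<le> \<bar>s\<bar> * \<bar>\<Sum>j<n. A m j * d j\<bar>"
        by (metis abs_ge_self abs_mult)
      then show "s * (\<Sum>j<n. A m j * d j) \<le> (9 * K_l2 + 19 * K_loo) * (Delta * eps) + (8 + 30 * K_loo) * (Delta * M / c0)"
        using neighbour_sum_bound[OF m(1) M] s(2) by simp
    qed (use c_pos in simp)
    \<comment> \<open>This is the absorption: half of the main term \<open>Delta * M / 8\<close> is
      left over.\<close>
    moreover have "(8 + 30 * K_loo) * (Delta * M / c0) \<le> Delta * M / 16"
    proof -
      have "16 * (8 + 30 * K_loo) * (Delta * M) \<le> c0 * (Delta * M)"
        using c0_large D M0 by (intro mult_right_mono) auto
      then show ?thesis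
        using c0 by (simp add: field_simps)
    qed
    then have "c * ((8 + 30 * K_loo) * (Delta * M / c0)) \<le> c * (Delta * M / 16)"
      using c_pos by (intro mult_left_mono) auto
    ultimately have "c * (Delta / 8 * M) \<le> 11 * (Delta * eps) + clam * (Delta * eps) * B + K_l2 * (Delta * eps)
        + c * ((9 * K_l2 + 19 * K_loo) * (Delta * eps)) + c * (Delta * M / 16)"
      using lower[folded S1_def, unfolded right_diff_distrib[of c]] unfolding distrib_left[of c] by linarith
    then have "Delta * (c / 16 * M) \<le> Delta * ((c * (9 * K_l2 + 19 * K_loo) + 11 + clam * B + K_l2) * eps)"
      by (simp add: algebra_simps)
    then have "c / 16 * M \<le> (c * (9 * K_l2 + 19 * K_loo) + 11 + clam * B + K_l2) * eps"
      using D by simp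
    then have "16 / c * (c / 16 * M) \<le> 16 / c * ((c * (9 * K_l2 + 19 * K_loo) + 11 + clam * B + K_l2) * eps)"
      using c_pos by (intro mult_left_mono) auto
    moreover have "16 / c * (c / 16 * M) = M"
      using c_pos by simp
    ultimately show ?thesis
      unfolding K_sup_def by (simp only: mult.assoc)
  qed
  then show ?thesis
    using M[OF k] by (simp add: d_def)
qed

end

subsection \<open>The MLE as an interior minimiser\<close>

lemma ln_one_plus_exp_minus: "ln (1 + exp (- t)) = ln (1 + exp t) - (t::real)"
proof -
  have pos: "1 + exp t > 0" by (simp add: add_pos_pos)
  have "1 + exp (- t) = (1 + exp t) / exp t"
    by (simp add: exp_minus field_simps)
  then show ?thesis
    using pos by (simp add: ln_div)
qed

lemma btl_reg_loss_eq_pobj: "btl_reg_loss n L lam G Y x = pobj n (adj G) (obs L Y) lam 0 x"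
proof -
  define f where "f i j = adj G i j * (ln (1 + exp (x i - x j)) - obs L Y i j * (x i - x j))" for i j
  have sym: "f i j = f j i" if "i \<noteq> j" for i j
  proof -
    have "ln (1 + exp (x j - x i)) - obs L Y j i * (x j - x i) = ln (1 + exp (x i - x j)) - obs L Y i j * (x i - x j)"
      unfolding obs_flip[OF that] using ln_one_plus_exp_minus[of "x i - x j"] by (simp add: algebra_simps)
    then show ?thesis
      by (simp add: f_def adj_sym[of G i j])
  qed
  have "(\<Sum>i<n. \<Sum>j<n. f i j) = (\<Sum>(i,j)\<in>pairs n. f i j + f j i)"
    by (rule sum_square_pairs) (simp add: f_def)
  also have "\<dots> = (\<Sum>(j,i)\<in>pairs n. 2 * f i j)"
    by (intro sum.cong refl) (use sym in \<open>auto simp: pairs_def\<close>)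
  also have "\<dots> = (\<Sum>(j,i)\<in>{(j,i). j < i \<and> i < n \<and> G (j,i)}. 2 * f i j)"
    by (intro sum.mono_neutral_right finite_pairs) (auto simp: pairs_def f_def adj_def)
  also have "\<dots> = 2 * btl_loss n L G Y x"
    unfolding btl_loss_def sum_distrib_left
    by (intro sum.cong refl) (auto simp: f_def adj_def obs_def)
  finally show ?thesis
    unfolding btl_reg_loss_def pobj_def f_def by simp
qed

text \<open>Summing the stationarity equations over all coordinates cancels the antisymmetric
  residuals and leaves \<open>lam\<close> times the sum of \<open>\<theta>\<close>. Hence that sum
  vanishes, the penalty has zero gradient at \<open>\<theta>\<close>, and stationarity holds for
  every \<open>p\<close>.\<close>

lemma mle_stationary:
  assumes mle: "btl_is_reg_mle n L lam G Y \<theta>" and lam: "lam > 0"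
  shows "i < n \<Longrightarrow> pgrad n (adj G) (obs L Y) lam p \<theta> i = 0"
proof -
  let ?g = "pgrad n (adj G) (obs L Y) lam 0 \<theta>"
  have flip: "obs L Y j i = 1 - obs L Y i j" if "adj G i j \<noteq> 0" for i j
    using that by (intro obs_flip) (auto simp: adj_def)
  have "0 \<le> (\<Sum>i<n. ?g i * d i)" for d
  proof (rule directional_derivative_nonneg[OF pobj_directional_derivative, where e = 1])
    show "pobj n (adj G) (obs L Y) lam 0 (\<lambda>i. \<theta> i + 0 * d i) \<le> pobj n (adj G) (obs L Y) lam 0 (\<lambda>i. \<theta> i + t * d i)" for t
      using mle by (simp add: btl_is_reg_mle_def btl_reg_loss_eq_pobj)
    show "obs L Y j i = 1 - obs L Y i j" if "adj G i j \<noteq> 0" for i j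
      using that by (rule flip)
  qed (simp_all add: adj_sym)
  from this[of "\<lambda>i. - ?g i"] have "(\<Sum>i<n. (?g i)\<^sup>2) \<le> 0"
    by (simp add: sum_negf power2_eq_square)
  then have "(\<Sum>i<n. (?g i)\<^sup>2) = 0"
    by (intro antisym sum_nonneg) auto
  then have g0: "?g i = 0" if "i < n" for i
    using that by (simp add: sum_nonneg_eq_0_iff)
  \<comment> \<open>With the constant function 1 in \<open>sum_antisym\<close> the left side is
    zero, so the residuals sum to zero.\<close>
  have "(\<Sum>i<n. \<Sum>j<n. (adj G i j * (sigmoid (\<theta> i - \<theta> j) - obs L Y i j)) * (1 - 1)) =
      2 * (\<Sum>i<n. \<Sum>j<n. (adj G i j * (sigmoid (\<theta> i - \<theta> j) - obs L Y i j)) * 1)"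
  proof (rule sum_antisym)
    fix i j
    have "sigmoid (\<theta> j - \<theta> i) = 1 - sigmoid (\<theta> i - \<theta> j)"
      using sigmoid_minus[of "\<theta> i - \<theta> j"] by simp
    then show "adj G j i * (sigmoid (\<theta> j - \<theta> i) - obs L Y j i) = - (adj G i j * (sigmoid (\<theta> i - \<theta> j) - obs L Y i j))"
      using adj_sym[of G i j] flip[of i j] by (cases "adj G i j = 0") (simp_all add: right_diff_distrib)
  qed
  then have "(\<Sum>i<n. \<Sum>j<n. adj G i j * (sigmoid (\<theta> i - \<theta> j) - obs L Y i j)) = 0"
    by simp
  then have "(\<Sum>i<n. ?g i) = lam * (\<Sum>i<n. \<theta> i)"
    by (simp add: pgrad_def sum.distrib sum_distrib_left)
  then have "(\<Sum>i<n. \<theta> i) = 0"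
    using g0 lam by simp
  then show "i < n \<Longrightarrow> pgrad n (adj G) (obs L Y) lam p \<theta> i = 0"
    using g0[of i] by (simp add: pgrad_def)
qed

text \<open>At an interior minimiser each coordinate can move both ways, so the gradient vanishes
  there too. Two zeros of the same gradient coincide by \<open>pgrad_monotone\<close>, which does
  not ask \<open>\<theta>\<close> to lie in the box.\<close>

lemma stationary_eq_interior_minimizer:
  assumes A: "\<And>i j. A j i = A i j" "\<And>i j. 0 \<le> A i j"
    and y: "\<And>i j. A i j \<noteq> 0 \<Longrightarrow> y j i = 1 - y i j"
    and x: "rect_minimizer n A y lam p ts (unit_radius n) x"
    and interior: "\<And>i. i < n \<Longrightarrow> \<bar>x i - ts i\<bar> < 1"
    and stat: "\<And>i. i < n \<Longrightarrow> pgrad n A y lam p \<theta> i = 0"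
    and pos: "0 < lam" "0 \<le> p" and k: "k < n"
  shows "\<theta> k = x k"
proof -
  have x_in: "x \<in> rect ts (unit_radius n)"
    using x by (simp add: rect_minimizer_def)
  have "pgrad n A y lam p x i = 0" if i: "i < n" for i
  proof -
    define s where "s = 1 - \<bar>x i - ts i\<bar>"
    have s: "s > 0" using interior[OF i] by (simp add: s_def)
    have *: "0 \<le> pgrad n A y lam p x i * e" if "\<bar>e\<bar> = s" for e
    proof -
      have "x(i := x i + e) \<in> rect ts (unit_radius n)"
        using x_in i that by (auto simp: rect_def unit_radius_def s_def)
      then have "0 \<le> (\<Sum>j<n. pgrad n A y lam p x j * ((x(i := x i + e)) j - x j))"
        by (rule rect_minimizer_variational[OF _ _ x, rotated 2]) (rule A(1), erule y)
      also have "\<dots> = (\<Sum>j\<in>{i}. pgrad n A y lam p x j * ((x(i := x i + e)) j - x j))"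
        using i by (intro sum.mono_neutral_right) auto
      finally show ?thesis by simp
    qed
    show ?thesis
      using *[of s] *[of "- s"] s by (auto simp: zero_le_mult_iff mult_le_0_iff)
  qed
  then have "lam * (\<Sum>i<n. (\<theta> i - x i)\<^sup>2) \<le> 0"
    using pgrad_monotone[of n A p lam \<theta> x y] A pos stat by simp
  moreover have "0 \<le> (\<Sum>i<n. (\<theta> i - x i)\<^sup>2)"
    by (intro sum_nonneg) auto
  ultimately have "(\<Sum>i<n. (\<theta> i - x i)\<^sup>2) = 0"
    using pos by (simp add: mult_le_0_iff)
  then show ?thesis
    using k by (simp add: sum_nonneg_eq_0_iff)
qed

subsection \<open>High-probability events\<close>

text \<open>Statistics at one vertex are fed to the matrix tail bounds by coefficients supported in
  row \<open>m\<close>; the diagonal is avoided by excluding \<open>m\<close> from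
  \<open>J\<close>.\<close>

lemma row_sum:
  fixes f :: "nat \<Rightarrow> real"
  assumes "m < n" "J \<subseteq> {..<n}"
  shows "(\<Sum>i<n. \<Sum>j<n. (if i = m \<and> j \<in> J then f j else 0) * g i j) = (\<Sum>j\<in>J. f j * g m j)"
proof -
  have "(\<Sum>i<n. \<Sum>j<n. (if i = m \<and> j \<in> J then f j else 0) * g i j) =
      (\<Sum>i\<in>{m}. \<Sum>j<n. (if i = m \<and> j \<in> J then f j else 0) * g i j)"
    using assms by (intro sum.mono_neutral_right) auto
  also have "\<dots> = (\<Sum>j\<in>J. f j * g m j)"
    using assms by (simp, intro sum.mono_neutral_cong_right) auto
  finally show ?thesis .
qed

lemma exp_minus_ln_power: "0 < (x::real) \<Longrightarrow> exp (- (real k * ln x)) = 1 / x ^ k"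
  by (simp add: exp_minus exp_of_nat_mult inverse_eq_divide)

lemma prob_abs_le:
  assumes "\<And>x. t < \<bar>f x\<bar> \<Longrightarrow> P x \<or> Q x"
    and "measure_pmf.prob M {x. P x} \<le> e" "measure_pmf.prob M {x. Q x} \<le> e"
  shows "measure_pmf.prob M {x. t < \<bar>f x\<bar>} \<le> 2 * e"
proof -
  have "measure_pmf.prob M {x. t < \<bar>f x\<bar>} \<le> measure_pmf.prob M ({x. P x} \<union> {x. Q x})"
    using assms(1) by (intro measure_pmf.finite_measure_mono) auto
  also have "\<dots> \<le> measure_pmf.prob M {x. P x} + measure_pmf.prob M {x. Q x}"
    by (intro measure_Un_le) auto
  finally show ?thesis using assms by simp
qed

lemma noise_tail:
  assumes w: "\<And>i. i < n \<Longrightarrow> 0 < w i" and L: "L \<ge> 1" and n: "n \<ge> 2"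
    and m: "m < n" and J: "J \<subseteq> {..<n} - {m}" and N: "0 < N" "real (card J) \<le> N"
  shows "measure_pmf.prob (btl_comp_pmf n L w)
     {Y. 6 * sqrt (N * ln (real n) / real L) < \<bar>\<Sum>j\<in>J. obs L Y m j - w m / (w j + w m)\<bar>} \<le> 2 * (1 / real n ^ 9)"
proof -
  define l where "l = ln (real n)"
  define Z where "Z Y = (\<Sum>j\<in>J. obs L Y m j - w m / (w j + w m))" for Y
  have l: "0 < l" using n by (simp add: l_def)
  \<comment> \<open>With this scale the moment term is at most \<open>9 * l\<close>, while the
    deviation \<open>6 * sqrt (N * l / L)\<close> becomes \<open>18 * l\<close>; the difference is
    the exponent of \<open>n ^ 9\<close>.\<close>
  define s where "s = 3 * sqrt (real L * l / N)"
  have s: "0 < s" using l L N by (simp add: s_def)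
  have s2: "s\<^sup>2 = 9 * (real L * l / N)"
    using l L N by (simp add: s_def power_mult_distrib)
  have one: "measure_pmf.prob (btl_comp_pmf n L w) {Y. 18 * l \<le> e * Z Y} \<le> 1 / real n ^ 9" if e: "e\<^sup>2 = s\<^sup>2" for e
  proof -
    define b where "b i j = (if i = m \<and> j \<in> J then e else 0)" for i j
    have "(\<Sum>i<n. \<Sum>j<n. b i j * (obs L Y i j - w i / (w j + w i))) = e * Z Y" for Y
      unfolding b_def Z_def sum_distrib_left using m J by (intro row_sum) auto
    moreover have "(\<Sum>i<n. \<Sum>j<n. (b i j)\<^sup>2) = real (card J) * s\<^sup>2"
    proof -
      have "(\<Sum>i<n. \<Sum>j<n. (b i j)\<^sup>2) = (\<Sum>i<n. \<Sum>j<n. (if i = m \<and> j \<in> J then e\<^sup>2 else 0) * 1)"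
        by (intro sum.cong refl) (simp add: b_def)
      also have "\<dots> = (\<Sum>j\<in>J. e\<^sup>2 * 1)"
        using m J by (intro row_sum) auto
      finally show ?thesis using e by simp
    qed
    moreover have "measure_pmf.prob (btl_comp_pmf n L w)
        {Y. 18 * l \<le> (\<Sum>i<n. \<Sum>j<n. b i j * (obs L Y i j - w i / (w j + w i)))}
        \<le> exp ((\<Sum>i<n. \<Sum>j<n. (b i j)\<^sup>2) / real L - 18 * l)"
      using w L J by (intro comparison_tail) (auto simp: b_def)
    ultimately have "measure_pmf.prob (btl_comp_pmf n L w) {Y. 18 * l \<le> e * Z Y}
        \<le> exp (real (card J) * s\<^sup>2 / real L - 18 * l)"
      by simp
    also have "\<dots> \<le> exp (- (real 9 * l))"
    proof -
      have "real (card J) * s\<^sup>2 / real L = 9 * l * (real (card J) / N)"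
        unfolding s2 using L by simp
      also have "\<dots> \<le> 9 * l * 1"
        using l N by (intro mult_left_mono) auto
      finally show ?thesis by simp
    qed
    also have "\<dots> = 1 / real n ^ 9"
      unfolding l_def using n by (intro exp_minus_ln_power) simp
    finally show ?thesis .
  qed
  have "measure_pmf.prob (btl_comp_pmf n L w) {Y. 6 * sqrt (N * l / real L) < \<bar>Z Y\<bar>} \<le> 2 * (1 / real n ^ 9)"
  proof (rule prob_abs_le)
    show "measure_pmf.prob (btl_comp_pmf n L w) {Y. 18 * l \<le> s * Z Y} \<le> 1 / real n ^ 9"
      "measure_pmf.prob (btl_comp_pmf n L w) {Y. 18 * l \<le> (- s) * Z Y} \<le> 1 / real n ^ 9"
      by (rule one, simp)+
    fix Y assume "6 * sqrt (N * l / real L) < \<bar>Z Y\<bar>"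
    then have "s * (6 * sqrt (N * l / real L)) \<le> s * \<bar>Z Y\<bar>"
      using s by (intro mult_left_mono) auto
    moreover have "s * (6 * sqrt (N * l / real L)) = 18 * l"
    proof -
      have "sqrt (real L * l / N) * sqrt (N * l / real L) = sqrt (l * l)"
        unfolding real_sqrt_mult[symmetric] using L N by simp
      then show ?thesis using l by (simp add: s_def)
    qed
    ultimately show "18 * l \<le> s * Z Y \<or> 18 * l \<le> (- s) * Z Y"
      by (cases "0 \<le> Z Y") auto
  qed
  then show ?thesis by (simp add: Z_def l_def)
qed

lemma linear_form_tail:
  assumes p: "0 \<le> p" "p \<le> 1" and n: "n \<ge> 2" and m: "m < n"
    and b: "\<And>j. j < n \<Longrightarrow> \<bar>v j\<bar> \<le> b"
  shows "measure_pmf.prob (btl_edges_pmf n p)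
     {G. 8 * (ln (real n) * b + sqrt (p * ln (real n) * (\<Sum>j<n. (v j)\<^sup>2)))
        < \<bar>\<Sum>j\<in>{..<n} - {m}. (adj G m j - p) * v j\<bar>} \<le> 2 * (1 / real n ^ 7)"
proof -
  define l where "l = ln (real n)"
  define V where "V = (\<Sum>j<n. (v j)\<^sup>2)"
  define Z where "Z G = (\<Sum>j\<in>{..<n} - {m}. (adj G m j - p) * v j)" for G
  \<comment> \<open>Dividing by \<open>r\<close> meets both needs of \<open>edge_tail\<close>:
    \<open>r \<ge> b\<close> keeps coefficients at most 1, and
    \<open>r \<ge> sqrt (p * V / l)\<close> keeps the moment term at most \<open>l\<close>. The
    threshold becomes \<open>8 * l\<close>, leaving \<open>n ^ 7\<close>.\<close>
  define r where "r = b + sqrt (p * V / l)"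
  have l: "0 < l" using n by (simp add: l_def)
  have V0: "0 \<le> V" by (simp add: V_def sum_nonneg)
  have b0: "0 \<le> b" using b[OF m] by linarith
  have thr: "8 * (l * b + sqrt (p * l * V)) = 8 * l * r"
  proof -
    have "l * sqrt (p * V / l) = sqrt (l * l * (p * V / l))"
      using l by (simp only: real_sqrt_mult) simp
    also have "l * l * (p * V / l) = p * l * V"
      using l by simp
    finally show ?thesis by (simp add: r_def algebra_simps)
  qed
  have "measure_pmf.prob (btl_edges_pmf n p) {G. 8 * l * r < \<bar>Z G\<bar>} \<le> 2 * (1 / real n ^ 7)"
  proof (cases "r = 0")
    case True
    have "0 \<le> sqrt (p * V / l)" using p l V0 by simp
    then have "b = 0" using True b0 unfolding r_def by linarith
    then have "Z G = 0" for G
      using b by (auto simp: Z_def intro!: sum.neutral)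
    then show ?thesis by (simp add: True)
  next
    case False
    then have r: "0 < r"
      using b0 p l V0 by (simp add: r_def less_le)
    have one: "measure_pmf.prob (btl_edges_pmf n p) {G. 8 * l \<le> e / r * Z G} \<le> 1 / real n ^ 7" if e: "e = 1 \<or> e = -1" for e
    proof -
      define a where "a i j = (if i = m \<and> j \<in> {..<n} - {m} then e / r * v j else 0)" for i j
      have "(\<Sum>i<n. \<Sum>j<n. a i j * (adj G i j - p)) = e / r * Z G" for G
      proof -
        have "(\<Sum>i<n. \<Sum>j<n. a i j * (adj G i j - p)) = (\<Sum>j\<in>{..<n} - {m}. e / r * v j * (adj G m j - p))"
          unfolding a_def using m by (intro row_sum) auto
        then show ?thesis by (simp add: Z_def sum_distrib_left mult_ac)
      qed
      moreover have "(\<Sum>i<n. \<Sum>j<n. (a i j)\<^sup>2) \<le> V / r\<^sup>2"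
      proof -
        have "(\<Sum>i<n. \<Sum>j<n. (a i j)\<^sup>2) = (\<Sum>i<n. \<Sum>j<n. (if i = m \<and> j \<in> {..<n} - {m} then (e / r * v j)\<^sup>2 else 0) * 1)"
          by (intro sum.cong refl) (simp add: a_def)
        also have "\<dots> = (\<Sum>j\<in>{..<n} - {m}. (e / r * v j)\<^sup>2 * 1)"
          using m by (intro row_sum) auto
        also have "\<dots> \<le> (\<Sum>j<n. (e / r * v j)\<^sup>2 * 1)"
          by (intro sum_mono2) auto
        also have "\<dots> = V / r\<^sup>2"
          using e by (auto simp: V_def power_mult_distrib power_divide sum_divide_distrib)
        finally show ?thesis .
      qed
      then have "p * (\<Sum>i<n. \<Sum>j<n. (a i j)\<^sup>2) \<le> p * (V / r\<^sup>2)"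
        using p by (intro mult_left_mono) auto
      moreover have "p * (V / r\<^sup>2) \<le> l"
      proof -
        have "(sqrt (p * V / l))\<^sup>2 \<le> r\<^sup>2"
          using b0 p l V0 by (intro power_mono) (auto simp: r_def)
        then have "p * V / l \<le> r\<^sup>2" using p l V0 by simp
        then show ?thesis using l r by (simp add: field_simps)
      qed
      moreover have "measure_pmf.prob (btl_edges_pmf n p) {G. 8 * l \<le> (\<Sum>i<n. \<Sum>j<n. a i j * (adj G i j - p))}
          \<le> exp (p * (\<Sum>i<n. \<Sum>j<n. (a i j)\<^sup>2) - 8 * l)"
      proof (rule edge_tail[OF p])
        fix i j
        have "\<bar>v j\<bar> \<le> r" if "j < n"
          using b[OF that] p l V0 by (simp add: r_def add_increasing2)
        then show "\<bar>a i j\<bar> \<le> 1"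
          using r e by (auto simp: a_def abs_mult)
      qed (auto simp: a_def)
      ultimately have "measure_pmf.prob (btl_edges_pmf n p) {G. 8 * l \<le> e / r * Z G}
          \<le> exp (p * (\<Sum>i<n. \<Sum>j<n. (a i j)\<^sup>2) - 8 * l)" "p * (\<Sum>i<n. \<Sum>j<n. (a i j)\<^sup>2) - 8 * l \<le> - (real 7 * l)"
        by simp_all
      then have "measure_pmf.prob (btl_edges_pmf n p) {G. 8 * l \<le> e / r * Z G} \<le> exp (- (real 7 * l))"
        by (meson exp_le_cancel_iff order_trans)
      also have "\<dots> = 1 / real n ^ 7"
        unfolding l_def using n by (intro exp_minus_ln_power) simp
      finally show ?thesis .
    qed
    show ?thesis
    proof (rule prob_abs_le)
      show "measure_pmf.prob (btl_edges_pmf n p) {G. 8 * l \<le> 1 / r * Z G} \<le> 1 / real n ^ 7"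
        "measure_pmf.prob (btl_edges_pmf n p) {G. 8 * l \<le> - 1 / r * Z G} \<le> 1 / real n ^ 7"
        by (rule one, simp)+
      fix G assume "8 * l * r < \<bar>Z G\<bar>"
      then have "8 * l < \<bar>Z G\<bar> / r"
        using r by (simp add: less_divide_eq)
      then show "8 * l \<le> 1 / r * Z G \<or> 8 * l \<le> - 1 / r * Z G"
        by (cases "0 \<le> Z G") auto
    qed
  qed
  then show ?thesis
    unfolding thr[symmetric] by (simp add: l_def V_def Z_def)
qed

lemma cut_tail:
  assumes p: "0 \<le> p" "p \<le> 1" and ST: "S \<subseteq> {..<n}" "T \<subseteq> {..<n}" "S \<inter> T = {}" and T: "real n / 4 \<le> real (card T)"
  shows "measure_pmf.prob (btl_edges_pmf n p)
     {G. (\<Sum>i\<in>S. \<Sum>j\<in>T. adj G i j) < real n * p / 8 * real (card S)} \<le> exp (- (real n * p / 64)) ^ card S"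
proof -
  define q where "q = p * (real (card S) * real (card T))"
  \<comment> \<open>The Chernoff parameter is \<open>1 / 4\<close>. A violated cut has fewer than
    \<open>q / 2\<close> edges, so the form is at least \<open>q / 8\<close>; the moment term is
    \<open>q / 16\<close>, and \<open>- q / 16\<close> is at most
    \<open>- (n p / 64) * card S\<close>.\<close>
  define b :: "nat \<Rightarrow> nat \<Rightarrow> real" where "b i j = (if i \<in> S \<and> j \<in> T then - 1 / 4 else 0)" for i j
  have restrict: "(\<Sum>i<n. \<Sum>j<n. if i \<in> S \<and> j \<in> T then g i j else 0) = (\<Sum>i\<in>S. \<Sum>j\<in>T. g i j)" for g :: "nat \<Rightarrow> nat \<Rightarrow> real"
  proof -
    have "(\<Sum>i<n. \<Sum>j<n. if i \<in> S \<and> j \<in> T then g i j else 0) = (\<Sum>i\<in>S. \<Sum>j<n. if i \<in> S \<and> j \<in> T then g i j else 0)"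
      using ST by (intro sum.mono_neutral_right) auto
    also have "\<dots> = (\<Sum>i\<in>S. \<Sum>j\<in>T. g i j)"
      by (rule sum.cong[OF refl], rule sum.mono_neutral_cong_right) (use ST in auto)
    finally show ?thesis .
  qed
  have q_ge: "real n * p / 4 * real (card S) \<le> q"
  proof -
    have "p * real (card S) * (real n / 4) \<le> p * real (card S) * real (card T)"
      using T p by (intro mult_left_mono) auto
    then show ?thesis by (simp add: q_def algebra_simps)
  qed
  have lin: "(\<Sum>i<n. \<Sum>j<n. b i j * (adj G i j - p)) = (q - (\<Sum>i\<in>S. \<Sum>j\<in>T. adj G i j)) / 4" for G
  proof -
    have "(\<Sum>i<n. \<Sum>j<n. b i j * (adj G i j - p)) = (\<Sum>i<n. \<Sum>j<n. if i \<in> S \<and> j \<in> T then (p - adj G i j) / 4 else 0)"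
      by (intro sum.cong refl) (auto simp: b_def field_simps)
    also have "\<dots> = (\<Sum>i\<in>S. \<Sum>j\<in>T. (p - adj G i j) / 4)"
      by (rule restrict)
    finally show ?thesis
      by (simp add: q_def sum_subtractf sum_divide_distrib[symmetric] mult_ac)
  qed
  have sq: "(\<Sum>i<n. \<Sum>j<n. (b i j)\<^sup>2) = real (card S) * real (card T) / 16"
  proof -
    have "(\<Sum>i<n. \<Sum>j<n. (b i j)\<^sup>2) = (\<Sum>i<n. \<Sum>j<n. if i \<in> S \<and> j \<in> T then 1 / 16 else 0)"
      by (intro sum.cong refl) (auto simp: b_def power2_eq_square)
    also have "\<dots> = (\<Sum>i\<in>S. \<Sum>j\<in>T. 1 / 16)"
      by (rule restrict)
    finally show ?thesis by simp
  qed
  have "measure_pmf.prob (btl_edges_pmf n p) {G. (\<Sum>i\<in>S. \<Sum>j\<in>T. adj G i j) < real n * p / 8 * real (card S)}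
      \<le> measure_pmf.prob (btl_edges_pmf n p) {G. q / 8 \<le> (\<Sum>i<n. \<Sum>j<n. b i j * (adj G i j - p))}"
    unfolding lin using q_ge by (intro measure_pmf.finite_measure_mono) auto
  also have "\<dots> \<le> exp (p * (\<Sum>i<n. \<Sum>j<n. (b i j)\<^sup>2) - q / 8)"
    using ST by (intro edge_tail p) (auto simp: b_def)
  also have "\<dots> \<le> exp (- (real n * p / 64) * real (card S))"
    unfolding sq using q_ge by (simp add: q_def mult_ac)
  also have "\<dots> = exp (- (real n * p / 64)) ^ card S"
    by (metis exp_of_nat_mult mult.commute)
  finally show ?thesis .
qed

lemma degree_tail:
  assumes p: "0 \<le> p" "p \<le> 1" and m: "m < n"
  shows "measure_pmf.prob (btl_edges_pmf n p) {G. 3 * (real n * p) < (\<Sum>j<n. adj G m j)} \<le> exp (- (real n * p))"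
proof -
  \<comment> \<open>With parameter 1 the mean and the moment term are each at most
    \<open>n p\<close>, so a degree above \<open>3 * (n p)\<close> leaves the exponent
    \<open>- n p\<close>.\<close>
  define b :: "nat \<Rightarrow> nat \<Rightarrow> real" where "b i j = (if i = m \<and> j \<in> {..<n} - {m} then 1 else 0)" for i j
  have lin: "(\<Sum>i<n. \<Sum>j<n. b i j * (adj G i j - p)) = (\<Sum>j<n. adj G m j) - real (n - 1) * p" for G
  proof -
    have "(\<Sum>i<n. \<Sum>j<n. b i j * (adj G i j - p)) = (\<Sum>j\<in>{..<n} - {m}. 1 * (adj G m j - p))"
      unfolding b_def using m by (intro row_sum) auto
    also have "\<dots> = (\<Sum>j\<in>{..<n} - {m}. adj G m j) - real (n - 1) * p"
      using m by (simp add: sum_subtractf)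
    also have "(\<Sum>j\<in>{..<n} - {m}. adj G m j) = (\<Sum>j<n. adj G m j)"
      by (intro sum.mono_neutral_left) auto
    finally show ?thesis .
  qed
  have sq: "(\<Sum>i<n. \<Sum>j<n. (b i j)\<^sup>2) = real (n - 1)"
  proof -
    have "(\<Sum>i<n. \<Sum>j<n. (b i j)\<^sup>2) = (\<Sum>i<n. \<Sum>j<n. (if i = m \<and> j \<in> {..<n} - {m} then 1 else 0) * 1)"
      by (intro sum.cong refl) (simp add: b_def)
    also have "\<dots> = (\<Sum>j\<in>{..<n} - {m}. 1 * 1)"
      using m by (intro row_sum) auto
    finally show ?thesis using m by simp
  qed
  have le: "real (n - 1) * p \<le> real n * p"
    using p by (intro mult_right_mono) auto
  have "measure_pmf.prob (btl_edges_pmf n p) {G. 3 * (real n * p) < (\<Sum>j<n. adj G m j)}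
      \<le> measure_pmf.prob (btl_edges_pmf n p) {G. 2 * (real n * p) \<le> (\<Sum>i<n. \<Sum>j<n. b i j * (adj G i j - p))}"
    unfolding lin using le by (intro measure_pmf.finite_measure_mono) auto
  also have "\<dots> \<le> exp (p * (\<Sum>i<n. \<Sum>j<n. (b i j)\<^sup>2) - 2 * (real n * p))"
    by (intro edge_tail p) (auto simp: b_def)
  also have "\<dots> \<le> exp (- (real n * p))"
    unfolding sq using le by (simp add: mult.commute)
  finally show ?thesis .
qed

lemma prob_finite_Ex_le:
  assumes "finite I"
  shows "measure_pmf.prob M {x. \<exists>i\<in>I. P i x} \<le> (\<Sum>i\<in>I. measure_pmf.prob M {x. P i x})"
proof -
  have "{x. \<exists>i\<in>I. P i x} = (\<Union>i\<in>I. {x. P i x})" by auto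
  then show ?thesis
    using measure_UNION_le[OF assms, of "\<lambda>i. {x. P i x}" "measure_pmf M"] by simp
qed

lemma prob_finite_Ex_le_const:
  assumes "finite I" "\<And>i. i \<in> I \<Longrightarrow> measure_pmf.prob M {x. P i x} \<le> e"
  shows "measure_pmf.prob M {x. \<exists>i\<in>I. P i x} \<le> real (card I) * e"
proof -
  have "(\<Sum>i\<in>I. measure_pmf.prob M {x. P i x}) \<le> real (card I) * e"
    using assms(2) by (rule sum_bounded_above)
  then show ?thesis
    using prob_finite_Ex_le[OF assms(1), of M P] by linarith
qed

text \<open>By the binomial theorem the sum is \<open>(1 + q) ^ n - 1\<close>. Because failure
  probabilities of cuts decay geometrically in \<open>card S\<close>, the union over all sets costs
  at most twice the union over singletons.\<close>

lemma sum_nonempty_subsets_power: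
  fixes q :: real
  assumes q: "0 \<le> q" "real n * q \<le> 1"
  shows "(\<Sum>S\<in>Pow {..<n} - {{}}. q ^ card S) \<le> 2 * (real n * q)"
proof -
  have "(1 + q) ^ n = (\<Sum>S\<in>Pow {..<n}. q ^ card S)"
    using prod_add[of "{..<n}" "\<lambda>_. q" "\<lambda>_. 1"] by (simp add: add.commute)
  also have "\<dots> = 1 + (\<Sum>S\<in>Pow {..<n} - {{}}. q ^ card S)"
    by (subst sum.remove[of _ "{}"]) auto
  finally have "(\<Sum>S\<in>Pow {..<n} - {{}}. q ^ card S) = (1 + q) ^ n - 1"
    by simp
  also have "(1 + q) ^ n \<le> exp q ^ n"
    using q by (intro power_mono exp_ge_add_one_self) auto
  also have "exp q ^ n = exp (real n * q)"
    by (simp add: exp_of_nat_mult)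
  also have "\<dots> \<le> 1 + real n * q + (real n * q)\<^sup>2"
    using q by (intro exp_le_quadratic) auto
  also have "(real n * q)\<^sup>2 \<le> real n * q"
    using q by (simp add: power2_eq_square mult_left_le)
  finally show ?thesis by (simp add: mult.commute)
qed

definition cut_violated :: "nat \<Rightarrow> real \<Rightarrow> (nat \<times> nat \<Rightarrow> bool) \<Rightarrow> nat \<Rightarrow> nat set \<Rightarrow> bool" where
  "cut_violated n p G m S \<longleftrightarrow> S \<subseteq> {..<n} - {m} \<and> 2 * card S \<le> card ({..<n} - {m}) \<and>
     (\<Sum>i\<in>S. \<Sum>j\<in>{..<n} - {m} - S. adj G i j) < real n * p / 8 * real (card S)"

lemma cut_violated_prob:
  assumes p: "0 \<le> p" "p \<le> 1" and n: "n \<ge> 2" and np: "512 * ln (real n) \<le> real n * p"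
  shows "measure_pmf.prob (btl_edges_pmf n p) {G. \<exists>m\<in>{..n}. \<exists>S\<in>Pow {..<n} - {{}}. cut_violated n p G m S} \<le> 4 / real n ^ 5"
proof -
  \<comment> \<open>Since \<open>512 = 8 * 64\<close>, each cut fails with probability at most
    \<open>q ^ card S\<close>. Summation over \<open>S\<close> gives \<open>2 / n ^ 7\<close>, and
    the \<open>n + 1 \<le> 2 * n\<close> values of \<open>m\<close> give
    \<open>4 / n ^ 6\<close>.\<close>
  define q where "q = 1 / real n ^ 8"
  have npos: "0 < real n" using n by simp
  have nq: "real n * q = 1 / real n ^ 7"
    using npos by (simp add: q_def field_simps eval_nat_numeral)
  have exp_le: "exp (- (real n * p / 64)) \<le> q"
  proof -
    have "exp (- (real n * p / 64)) \<le> exp (- (real 8 * ln (real n)))"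
      using np by simp
    also have "\<dots> = q"
      unfolding q_def using npos by (rule exp_minus_ln_power)
    finally show ?thesis .
  qed
  have single: "measure_pmf.prob (btl_edges_pmf n p) {G. cut_violated n p G m S} \<le> q ^ card S" for m S
  proof (cases "S \<subseteq> {..<n} - {m} \<and> 2 * card S \<le> card ({..<n} - {m})")
    case True
    let ?T = "{..<n} - {m} - S"
    have fin: "finite S" using True finite_subset by blast
    have "card ?T = card ({..<n} - {m}) - card S"
      using True fin by (intro card_Diff_subset) auto
    moreover have "n \<le> card ({..<n} - {m}) + 1"
      by (cases "m < n") auto
    ultimately have "n \<le> 4 * card ?T"
      using True n by linarith
    then have "real n / 4 \<le> real (card ?T)"
      by linarith
    then have "measure_pmf.prob (btl_edges_pmf n p) {G. (\<Sum>i\<in>S. \<Sum>j\<in>?T. adj G i j) < real n * p / 8 * real (card S)}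
        \<le> exp (- (real n * p / 64)) ^ card S"
      using True by (intro cut_tail p) auto
    also have "\<dots> \<le> q ^ card S"
      using exp_le by (intro power_mono) auto
    finally show ?thesis
      using True by (simp add: cut_violated_def)
  next
    case False
    then have "{G. cut_violated n p G m S} = {}" by (auto simp: cut_violated_def)
    then show ?thesis by (simp add: q_def)
  qed
  have "measure_pmf.prob (btl_edges_pmf n p) {G. \<exists>m\<in>{..n}. \<exists>S\<in>Pow {..<n} - {{}}. cut_violated n p G m S}
      \<le> real (card {..n}) * (2 * (real n * q))"
  proof (rule prob_finite_Ex_le_const)
    fix m
    have "measure_pmf.prob (btl_edges_pmf n p) {G. \<exists>S\<in>Pow {..<n} - {{}}. cut_violated n p G m S}
        \<le> (\<Sum>S\<in>Pow {..<n} - {{}}. measure_pmf.prob (btl_edges_pmf n p) {G. cut_violated n p G m S})"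
      by (rule prob_finite_Ex_le) auto
    also have "\<dots> \<le> (\<Sum>S\<in>Pow {..<n} - {{}}. q ^ card S)"
      by (intro sum_mono single)
    also have "\<dots> \<le> 2 * (real n * q)"
    proof (rule sum_nonempty_subsets_power)
      show "real n * q \<le> 1" unfolding nq using n by simp
    qed (simp add: q_def)
    finally show "measure_pmf.prob (btl_edges_pmf n p) {G. \<exists>S\<in>Pow {..<n} - {{}}. cut_violated n p G m S} \<le> 2 * (real n * q)" .
  qed simp
  also have "\<dots> \<le> (2 * real n) * (2 * (1 / real n ^ 7))"
    unfolding nq using n by (intro mult_right_mono) auto
  also have "\<dots> = 4 / real n ^ 6"
    using npos by (simp add: field_simps eval_nat_numeral)
  also have "\<dots> \<le> 4 / real n ^ 5"
    using n by (intro divide_left_mono power_increasing) auto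
  finally show ?thesis .
qed

section \<open>Linear forms in the leave-one-out minimisers\<close>

definition loo :: "nat \<Rightarrow> nat \<Rightarrow> real \<Rightarrow> real \<Rightarrow> (nat \<Rightarrow> real) \<Rightarrow> nat \<Rightarrow> (nat \<times> nat \<Rightarrow> bool) \<Rightarrow> (nat \<times> nat \<times> nat \<Rightarrow> bool) \<Rightarrow> nat \<Rightarrow> real" where
  "loo n L lam p ts m G Y = (SOME u. rect_minimizer n (delete_vertex m (adj G)) (obs L Y) lam p ts ((unit_radius n)(m := 0)) u)"

lemma loo_minimizer:
  "rect_minimizer n (delete_vertex m (adj G)) (obs L Y) lam p ts ((unit_radius n)(m := 0)) (loo n L lam p ts m G Y)"
  unfolding loo_def by (rule someI_ex[OF rect_minimizer_exists]) (simp add: unit_radius_def)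

text \<open>The threshold uses the exact sup norm and l2 norm of \<open>v\<close>, making this a
  single event per vector; the bounds for larger \<open>b\<close> and \<open>V\<close> follow by
  monotonicity.\<close>

definition linear_form_violated :: "nat \<Rightarrow> real \<Rightarrow> nat \<Rightarrow> (nat \<Rightarrow> real) \<Rightarrow> (nat \<times> nat \<Rightarrow> bool) \<Rightarrow> bool" where
  "linear_form_violated n p m v G \<longleftrightarrow>
     8 * (ln (real n) * vnorm_inf n v + sqrt (p * ln (real n) * (\<Sum>j<n. (v j)\<^sup>2)))
        < \<bar>\<Sum>j\<in>{..<n} - {m}. (adj G m j - p) * v j\<bar>"

lemma vnorm_inf_ge: "j < n \<Longrightarrow> \<bar>v j\<bar> \<le> vnorm_inf n v"
  by (auto simp: vnorm_inf_def)

lemma vnorm_inf_le: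
  assumes "0 < n" "\<And>j. j < n \<Longrightarrow> \<bar>v j\<bar> \<le> b"
  shows "vnorm_inf n v \<le> b"
  using assms by (auto simp: vnorm_inf_def lessThan_empty_iff)

text \<open>The comparisons \<open>Y\<close> are fixed. The form reads only the edges at
  \<open>m\<close>, the minimiser only the other edges, so decoupling reduces the claim to a fixed
  vector.\<close>

lemma loo_linear_form_prob:
  assumes p: "0 \<le> p" "p \<le> 1" and n: "n \<ge> 2" and m: "m < n"
  shows "measure_pmf.prob (btl_edges_pmf n p)
     {G. linear_form_violated n p m (\<lambda>j. loo n L lam p ts m G Y j - ts j) G} \<le> 2 * (1 / real n ^ 7)"
proof -
  define A where "A = {(i, j) \<in> pairs n. i = m \<or> j = m}"
  define B where "B = pairs n - A"
  have AB: "A \<union> B = pairs n" "A \<inter> B = {}" "finite A" "finite B"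
    using finite_subset[OF _ finite_pairs, of A n] by (auto simp: A_def B_def)
  have edges: "btl_edges_pmf n p = Pi_pmf (A \<union> B) False (\<lambda>_. bernoulli_pmf p)"
    unfolding AB(1) by (simp add: btl_edges_pmf_def pairs_def)
  show ?thesis
    unfolding edges
  proof (rule Pi_pmf_decoupling[where bad = "linear_form_violated n p m" and u = "\<lambda>G j. loo n L lam p ts m G Y j - ts j"])
    show "finite A" "finite B" "A \<inter> B = {}" by fact+
  next
    fix v and G G' :: "nat \<times> nat \<Rightarrow> bool" assume eq: "\<And>k. k \<in> A \<Longrightarrow> G k = G' k"
    have "adj G m j = adj G' m j" if "j < n" for j
    proof (cases "j = m")
      case False
      then have "(min m j, max m j) \<in> A"
        using that m by (auto simp: A_def pairs_def min_def max_def)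
      then show ?thesis by (simp add: adj_def eq)
    qed simp
    then have "(\<Sum>j\<in>{..<n} - {m}. (adj G m j - p) * v j) = (\<Sum>j\<in>{..<n} - {m}. (adj G' m j - p) * v j)"
      by (intro sum.cong refl) auto
    then show "linear_form_violated n p m v G = linear_form_violated n p m v G'"
      by (simp add: linear_form_violated_def)
  next
    fix G G' :: "nat \<times> nat \<Rightarrow> bool" assume eq: "\<And>k. k \<in> B \<Longrightarrow> G k = G' k"
    have "delete_vertex m (adj G) i j = delete_vertex m (adj G') i j" if "i < n" "j < n" for i j
    proof (cases "i = j \<or> i = m \<or> j = m")
      case False
      then have "(min i j, max i j) \<in> B"
        using that by (auto simp: A_def B_def pairs_def min_def max_def)
      then show ?thesis by (simp add: adj_def delete_vertex_def eq)
    qed (auto simp: delete_vertex_def)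
    then have "pobj n (delete_vertex m (adj G)) (obs L Y) lam p x = pobj n (delete_vertex m (adj G')) (obs L Y) lam p x" for x
      by (simp add: pobj_def)
    \<comment> \<open>Equal objectives have the same set of minimisers, from which
      \<open>SOME\<close> selects the same point; this makes the choice a function of the edges away
      from \<open>m\<close>.\<close>
    then have "loo n L lam p ts m G Y = loo n L lam p ts m G' Y"
      by (simp add: loo_def rect_minimizer_def)
    then show "(\<lambda>j. loo n L lam p ts m G Y j - ts j) = (\<lambda>j. loo n L lam p ts m G' Y j - ts j)"
      by simp
  next
    fix v
    show "measure_pmf.prob (Pi_pmf (A \<union> B) False (\<lambda>_. bernoulli_pmf p)) {G. linear_form_violated n p m v G} \<le> 2 * (1 / real n ^ 7)"
      unfolding edges[symmetric] linear_form_violated_def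
      by (intro linear_form_tail p n m vnorm_inf_ge)
  qed
qed

subsection \<open>The sup-norm error bound\<close>

lemma half_le_ln: "2 \<le> (n::nat) \<Longrightarrow> 1 / 2 \<le> ln (real n)"
proof -
  assume n: "2 \<le> n"
  have "exp (1 / 2) \<le> 1 + 1 / 2 + (1 / 2 :: real)\<^sup>2"
    by (rule exp_le_quadratic) simp
  also have "\<dots> \<le> 2"
    by (simp add: power2_eq_square)
  also have "\<dots> \<le> real n"
    using n by simp
  finally show ?thesis
    using n by (subst ln_ge_iff) auto
qed

lemma exp_relative_error:
  fixes a b :: real
  assumes "\<bar>a - b\<bar> \<le> 1"
  shows "\<bar>exp a - exp b\<bar> \<le> exp b * (2 * \<bar>a - b\<bar>)"
proof -
  define t where "t = a - b"
  have t: "\<bar>t\<bar> \<le> 1" using assms by (simp add: t_def)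
  have "t\<^sup>2 \<le> \<bar>t\<bar>"
    using mult_left_mono[OF t abs_ge_zero[of t]] by (simp add: power2_eq_square)
  then have "\<bar>exp t - 1\<bar> \<le> 2 * \<bar>t\<bar>"
    using exp_le_quadratic[OF t] exp_ge_add_one_self[of t] by linarith
  then have "exp b * \<bar>exp t - 1\<bar> \<le> exp b * (2 * \<bar>t\<bar>)"
    by (intro mult_left_mono) auto
  moreover have "exp b * \<bar>exp t - 1\<bar> = \<bar>exp b * (exp t - 1)\<bar>"
    by (simp add: abs_mult)
  moreover have "exp b * (exp t - 1) = exp a - exp b"
    by (simp add: t_def right_diff_distrib exp_diff)
  ultimately show ?thesis by (simp only: t_def)
qed

text \<open>The 11 is \<open>4 + 1 + 2 + 2 + 2\<close>, one summand for each failure event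
  \<open>E1\<close> to \<open>E5\<close>. Of the conditions on \<open>c0\<close>, the first serves
  the graph events, the second the absorption in \<open>sup_norm_bound\<close>, and the third puts
  \<open>x\<close> inside the box. The factor 2 in the error bound comes from
  \<open>exp_relative_error\<close>.\<close>

lemma btl_sup_norm_whp:
  fixes n L :: nat and p lam c0 clam B wmin wmax :: real and w :: "nat \<Rightarrow> real"
  assumes n: "n \<ge> 2" and w: "0 < wmin" "\<And>i. i < n \<Longrightarrow> wmin \<le> w i \<and> w i \<le> wmax" and B: "ln (wmax / wmin) \<le> B"
    and np: "c0 * ln (real n) \<le> real n * p" and p1: "p \<le> 1" and L: "L \<ge> 1"
    and lam: "lam = clam * sqrt (real n * p * ln (real n) / real L)" and clam: "0 < clam"
    and c0: "512 \<le> c0" "16 * (8 + 30 * btl_event.K_loo B) \<le> c0" "(2 * btl_event.K_sup B clam)\<^sup>2 \<le> c0"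
  shows "1 - 11 / real n ^ 5 \<le> measure_pmf.prob (pair_pmf (btl_edges_pmf n p) (btl_comp_pmf n L w))
          {(G, Y). \<forall>\<theta>. btl_is_reg_mle n L lam G Y \<theta> \<longrightarrow>
             vnorm_inf n (\<lambda>i. exp (\<theta> i) - btl_centered n w i) / vnorm_inf n (btl_centered n w)
               \<le> 2 * btl_event.K_sup B clam * sqrt (ln (real n) / (real n * p * real L))}"
proof -
  define l where "l = ln (real n)"
  define mean where "mean = (\<Sum>k<n. ln (w k)) / real n"
  define ts where "ts i = (if i < n then ln (w i) - mean else 0)" for i
  define eps where "eps = sqrt (l / (real n * p * real L))"
  define K where "K = btl_event.K_sup B clam"
  define P where "P = pair_pmf (btl_edges_pmf n p) (btl_comp_pmf n L w)"
  have npos: "0 < real n" and l_half: "1 / 2 \<le> l"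
    using n half_le_ln[OF n] by (auto simp: l_def)
  have l: "0 < l" using l_half by linarith
  have np512: "512 * l \<le> real n * p"
    using mult_right_mono[OF c0(1), of l] l np unfolding l_def by linarith
  then have np_pos: "0 < real n * p" using l by linarith
  then have p: "0 < p" "0 \<le> p" using npos by (auto simp: zero_less_mult_iff)
  have Lpos: "0 < real L" using L by simp
  have wpos: "0 < w i" if "i < n" for i
    using w(1) w(2)[OF that] by linarith
  have eps_pos: "0 < eps"
    using l np_pos Lpos by (simp add: eps_def)
  have np_eps: "real n * p * eps = sqrt (real n * p * l / real L)"
  proof -
    have "real n * p * eps = sqrt ((real n * p)\<^sup>2 * (l / (real n * p * real L)))"
      using np_pos unfolding eps_def real_sqrt_mult by simp
    also have "(real n * p)\<^sup>2 * (l / (real n * p * real L)) = real n * p * l / real L"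
      using np_pos by (simp add: power2_eq_square)
    finally show ?thesis .
  qed
  have sqrt_np_eps: "sqrt (real n * p) * eps = sqrt (l / real L)"
    using p npos unfolding eps_def real_sqrt_mult[symmetric] by simp
  have ts_sigmoid: "sigmoid (ts i - ts j) = w i / (w j + w i)" if "i < n" "j < n" for i j
    using sigmoid_ln_diff[OF wpos[OF that(1)] wpos[OF that(2)]] that by (simp add: ts_def)
  have ts_sum: "(\<Sum>i<n. ts i) = 0"
    using npos by (simp add: ts_def sum_subtractf mean_def)
  have ts_bound: "\<bar>ts i\<bar> \<le> B" if i: "i < n" for i
  proof -
    have wmax: "0 < wmax" using w(1) w(2)[OF i] by linarith
    have lnw: "ln wmin \<le> ln (w k)" "ln (w k) \<le> ln wmax" if "k < n" for k
      using w(1) w(2)[OF that] wpos[OF that] wmax by auto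
    have "real n * ln wmin \<le> (\<Sum>k<n. ln (w k))"
      using sum_bounded_below[of "{..<n}" "ln wmin" "\<lambda>k. ln (w k)"] lnw by simp
    moreover have "(\<Sum>k<n. ln (w k)) \<le> real n * ln wmax"
      using sum_bounded_above[of "{..<n}" "\<lambda>k. ln (w k)" "ln wmax"] lnw by simp
    ultimately have "ln wmin \<le> mean" "mean \<le> ln wmax"
      using npos by (simp_all add: mean_def field_simps)
    moreover have "ln wmax - ln wmin \<le> B"
      using B w(1) wmax by (simp add: ln_div)
    ultimately show ?thesis
      using lnw[OF i] i unfolding ts_def by (simp add: abs_le_iff)
  qed
  define nb where "nb G m = {j \<in> {..<n}. adj G m j = 1}" for G m
  have nb_sum: "(\<Sum>j<n. adj G m j * f j) = (\<Sum>j\<in>nb G m. f j)" for G m and f :: "nat \<Rightarrow> real"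
    unfolding nb_def using adj_cases by (intro sum.mono_neutral_cong_right) auto
  have nb_card: "(\<Sum>j<n. adj G m j) = real (card (nb G m))" for G m
    using nb_sum[of G m "\<lambda>_. 1"] by simp
  define noise where "noise Y i j = obs L Y i j - w i / (w j + w i)" for Y i j

  define E1 where "E1 G \<longleftrightarrow> (\<exists>m\<in>{..n}. \<exists>S\<in>Pow {..<n} - {{}}. cut_violated n p G m S)" for G
  define E2 where "E2 G \<longleftrightarrow> (\<exists>m\<in>{..<n}. 3 * (real n * p) < (\<Sum>j<n. adj G m j))" for G
  \<comment> \<open>The singleton sum lets \<open>noise_tail\<close> with \<open>N = 1\<close> cover
    a single pair.\<close>
  define E3 where "E3 Y \<longleftrightarrow> (\<exists>i\<in>{..<n}. \<exists>j\<in>{..<n} - {i}. 6 * sqrt (1 * l / real L) < \<bar>\<Sum>j\<in>{j}. noise Y i j\<bar>)" for Y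
  \<comment> \<open>The degree condition is part of the event, so that for every fixed graph either
    the event is empty or \<open>noise_tail\<close> applies with \<open>N = 3 * (n p)\<close>.
    Outside \<open>E2\<close> the condition always holds.\<close>
  define E4 where "E4 G Y \<longleftrightarrow> (\<exists>m\<in>{..<n}. real (card (nb G m)) \<le> 3 * (real n * p) \<and>
      6 * sqrt (3 * (real n * p) * l / real L) < \<bar>\<Sum>j\<in>nb G m. noise Y m j\<bar>)" for G Y
  define E5 where "E5 G Y \<longleftrightarrow> (\<exists>m\<in>{..<n}. linear_form_violated n p m (\<lambda>j. loo n L lam p ts m G Y j - ts j) G)" for G Y

  have n_powers: "real n * (1 / real n ^ 8) \<le> 1 / real n ^ 5" "real n * (real n * (2 * (1 / real n ^ 9))) \<le> 2 / real n ^ 5"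
    "real n * (2 * (1 / real n ^ 9)) \<le> 2 / real n ^ 5" "real n * (2 * (1 / real n ^ 7)) \<le> 2 / real n ^ 5"
  proof -
    have mono: "a / real n ^ k \<le> a / real n ^ 5" if "5 \<le> k" "0 \<le> a" for a k
      using n that by (intro divide_left_mono power_increasing) auto
    have "real n * (1 / real n ^ 8) = 1 / real n ^ 7"
      "real n * (real n * (2 * (1 / real n ^ 9))) = 2 / real n ^ 7"
      "real n * (2 * (1 / real n ^ 9)) = 2 / real n ^ 8"
      "real n * (2 * (1 / real n ^ 7)) = 2 / real n ^ 6"
      using npos by (simp_all add: field_simps eval_nat_numeral)
    then show "real n * (1 / real n ^ 8) \<le> 1 / real n ^ 5"
      "real n * (real n * (2 * (1 / real n ^ 9))) \<le> 2 / real n ^ 5"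
      "real n * (2 * (1 / real n ^ 9)) \<le> 2 / real n ^ 5"
      "real n * (2 * (1 / real n ^ 7)) \<le> 2 / real n ^ 5"
      using mono[of 7 1] mono[of 7 2] mono[of 8 2] mono[of 6 2] by linarith+
  qed
  have P1: "measure_pmf.prob P {(G, Y). E1 G} \<le> 4 / real n ^ 5"
    unfolding P_def prob_pair_pmf_fst E1_def
    using np512 by (intro cut_violated_prob p p1 n) (simp add: l_def)
  have P2: "measure_pmf.prob P {(G, Y). E2 G} \<le> 1 / real n ^ 5"
  proof -
    have "exp (- (real n * p)) \<le> exp (- (real 8 * l))"
      using np512 l by simp
    also have "\<dots> = 1 / real n ^ 8"
      unfolding l_def using npos by (rule exp_minus_ln_power)
    finally have "exp (- (real n * p)) \<le> 1 / real n ^ 8" .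
    then have "measure_pmf.prob (btl_edges_pmf n p) {G. E2 G} \<le> real (card {..<n}) * (1 / real n ^ 8)"
      unfolding E2_def by (intro prob_finite_Ex_le_const order_trans[OF degree_tail] p p1) auto
    then show ?thesis
      unfolding P_def prob_pair_pmf_fst using n_powers by simp
  qed
  have P3: "measure_pmf.prob P {(G, Y). E3 Y} \<le> 2 / real n ^ 5"
    unfolding P_def
  proof (rule prob_pair_pmf_le')
    have "measure_pmf.prob (btl_comp_pmf n L w) {Y. E3 Y} \<le> real (card {..<n}) * (real n * (2 * (1 / real n ^ 9)))"
      unfolding E3_def
    proof (intro prob_finite_Ex_le_const)
      fix i assume i: "i \<in> {..<n}"
      have "measure_pmf.prob (btl_comp_pmf n L w) {Y. \<exists>j\<in>{..<n} - {i}. 6 * sqrt (1 * l / real L) < \<bar>\<Sum>j\<in>{j}. noise Y i j\<bar>}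
          \<le> real (card ({..<n} - {i})) * (2 * (1 / real n ^ 9))"
        unfolding noise_def l_def
        by (intro prob_finite_Ex_le_const noise_tail wpos L n) (use i in auto)
      also have "\<dots> \<le> real n * (2 * (1 / real n ^ 9))"
        using i by (intro mult_right_mono) auto
      finally show "measure_pmf.prob (btl_comp_pmf n L w) {Y. \<exists>j\<in>{..<n} - {i}. 6 * sqrt (1 * l / real L) < \<bar>\<Sum>j\<in>{j}. noise Y i j\<bar>}
          \<le> real n * (2 * (1 / real n ^ 9))" .
    qed simp
    then show "measure_pmf.prob (btl_comp_pmf n L w) {Y. E3 Y} \<le> 2 / real n ^ 5"
      using n_powers by simp
  qed
  have P4: "measure_pmf.prob P {(G, Y). E4 G Y} \<le> 2 / real n ^ 5"
    unfolding P_def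
  proof (rule prob_pair_pmf_le')
    fix G
    have "measure_pmf.prob (btl_comp_pmf n L w) {Y. E4 G Y} \<le> real (card {..<n}) * (2 * (1 / real n ^ 9))"
      unfolding E4_def
    proof (intro prob_finite_Ex_le_const)
      fix m assume m: "m \<in> {..<n}"
      show "measure_pmf.prob (btl_comp_pmf n L w) {Y. real (card (nb G m)) \<le> 3 * (real n * p) \<and>
          6 * sqrt (3 * (real n * p) * l / real L) < \<bar>\<Sum>j\<in>nb G m. noise Y m j\<bar>} \<le> 2 * (1 / real n ^ 9)"
      proof (cases "real (card (nb G m)) \<le> 3 * (real n * p)")
        case True
        then show ?thesis
          unfolding noise_def l_def using m np_pos
          by (simp only: True simp_thms, intro noise_tail wpos L n) (auto simp: nb_def)
      qed simp
    qed simp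
    then show "measure_pmf.prob (btl_comp_pmf n L w) {Y. E4 G Y} \<le> 2 / real n ^ 5"
      using n_powers by simp
  qed
  have P5: "measure_pmf.prob P {(G, Y). E5 G Y} \<le> 2 / real n ^ 5"
    unfolding P_def
  proof (rule prob_pair_pmf_le)
    fix Y
    have "measure_pmf.prob (btl_edges_pmf n p) {G. E5 G Y} \<le> real (card {..<n}) * (2 * (1 / real n ^ 7))"
      unfolding E5_def by (intro prob_finite_Ex_le_const loo_linear_form_prob p p1 n) auto
    then show "measure_pmf.prob (btl_edges_pmf n p) {G. E5 G Y} \<le> 2 / real n ^ 5"
      using n_powers by simp
  qed

  define good where "good = {(G, Y). \<forall>\<theta>. btl_is_reg_mle n L lam G Y \<theta> \<longrightarrow>
             vnorm_inf n (\<lambda>i. exp (\<theta> i) - btl_centered n w i) / vnorm_inf n (btl_centered n w) \<le> 2 * K * eps}"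
  have det: "(G, Y) \<in> good" if ok: "\<not> E1 G" "\<not> E2 G" "\<not> E3 Y" "\<not> E4 G Y" "\<not> E5 G Y" for G Y
  proof -
    obtain x where x: "rect_minimizer n (adj G) (obs L Y) lam p ts (unit_radius n) x"
      using rect_minimizer_exists[of "unit_radius n" n "adj G" "obs L Y" lam p ts] by (auto simp: unit_radius_def)
    have flip: "obs L Y j i = 1 - obs L Y i j" if "adj G i j \<noteq> 0" for i j
      using that by (intro obs_flip) (auto simp: adj_def)
    have deg: "(\<Sum>j<n. adj G i j) \<le> 3 * (real n * p)" if "i < n" for i
      using ok(2) that by (auto simp: E2_def not_less)
    interpret event: btl_event n "adj G" "obs L Y" lam p B c0 l eps clam ts x "\<lambda>m. loo n L lam p ts m G Y"
    proof
      show "2 \<le> n" "0 < p" "p \<le> 1" "1 / 2 \<le> l" "0 < eps" "0 < clam" "(\<Sum>i<n. ts i) = 0" by fact+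
      show "adj G j i = adj G i j" for i j by (rule adj_sym)
      show "adj G i j = 0 \<or> adj G i j = 1" for i j by (rule adj_cases)
      show "adj G i i = 0" for i by simp
      show "obs L Y j i = 1 - obs L Y i j" if "i \<noteq> j" for i j using that by (rule obs_flip)
      show "\<bar>ts i\<bar> \<le> B" if "i < n" for i using that by (rule ts_bound)
      show "(\<Sum>j<n. adj G i j) \<le> 3 * (real n * p)" if "i < n" for i using that by (rule deg)
      show "lam = clam * (real n * p * eps)" unfolding np_eps lam l_def ..
      show "c0 * l \<le> real n * p" using np by (simp add: l_def)
      show "2 \<le> c0" using c0(1) by simp
      show "rect_minimizer n (adj G) (obs L Y) lam p ts (unit_radius n) x" by fact
      show "rect_minimizer n (delete_vertex m (adj G)) (obs L Y) lam p ts ((unit_radius n)(m := 0)) (loo n L lam p ts m G Y)" for m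
        by (rule loo_minimizer)
      show "real n * p / 8 * real (card S) \<le> (\<Sum>i\<in>S. \<Sum>j\<in>{..<n} - {m} - S. adj G i j)"
        if S: "S \<subseteq> {..<n} - {m}" "S \<noteq> {}" "2 * card S \<le> card ({..<n} - {m})" for m S
      proof -
        \<comment> \<open>The locale asks for all \<open>m\<close>, the event covers
          \<open>m \<le> n\<close>; every larger \<open>m\<close> deletes nothing, as
          \<open>n\<close> does.\<close>
        define m' where "m' = min m n"
        have V: "{..<n} - {m} = {..<n} - {m'}" by (auto simp: m'_def min_def)
        have "\<not> cut_violated n p G m' S"
        proof -
          have "m' \<in> {..n}" "S \<in> Pow {..<n} - {{}}"
            using S by (auto simp: m'_def)
          then show ?thesis using ok(1) unfolding E1_def by blast
        qed
        then show ?thesis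
          using S unfolding V by (simp add: cut_violated_def not_less)
      qed
      show "\<bar>obs L Y i j - sigmoid (ts i - ts j)\<bar> \<le> 6 * (sqrt (real n * p) * eps)" if "i < n" "j < n" "i \<noteq> j" for i j
        using ok(3) that unfolding sqrt_np_eps by (auto simp: E3_def not_less noise_def ts_sigmoid)
      show "\<bar>\<Sum>j<n. adj G i j * (obs L Y i j - sigmoid (ts i - ts j))\<bar> \<le> 11 * (real n * p * eps)" if i: "i < n" for i
      proof -
        have "(\<Sum>j<n. adj G i j * (obs L Y i j - sigmoid (ts i - ts j))) = (\<Sum>j\<in>nb G i. noise Y i j)"
          unfolding nb_sum by (intro sum.cong refl) (auto simp: nb_def noise_def ts_sigmoid i)
        moreover have "\<bar>\<Sum>j\<in>nb G i. noise Y i j\<bar> \<le> 6 * sqrt (3 * (real n * p) * l / real L)"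
          using ok(4) i deg[OF i] unfolding nb_card by (auto simp: E4_def not_less)
        moreover have "sqrt (3 * (real n * p) * l / real L) = sqrt 3 * (real n * p * eps)"
          unfolding np_eps real_sqrt_mult[symmetric] by simp
        \<comment> \<open>The 6 is the constant of \<open>noise_tail\<close>, and
          \<open>sqrt 3\<close> comes from the degree bound \<open>3 * (n p)\<close>; this is the 11
          in \<open>noise_vertex\<close>.\<close>
        moreover have "6 * sqrt 3 \<le> (11::real)"
        proof -
          have "sqrt 3 \<le> (11 / 6 :: real)"
            by (rule real_le_lsqrt) (auto simp: power2_eq_square)
          then show ?thesis by simp
        qed
        then have "6 * sqrt 3 * (real n * p * eps) \<le> 11 * (real n * p * eps)"
          using np_pos eps_pos by (intro mult_right_mono) auto
        ultimately show ?thesis by simp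
      qed
      show "\<bar>\<Sum>j\<in>{..<n} - {m}. (adj G m j - p) * (loo n L lam p ts m G Y j - ts j)\<bar> \<le> 8 * (l * b + sqrt (p * l * V))"
        if m: "m < n" and b: "\<And>j. j < n \<Longrightarrow> \<bar>loo n L lam p ts m G Y j - ts j\<bar> \<le> b"
          and V: "(\<Sum>j<n. (loo n L lam p ts m G Y j - ts j)\<^sup>2) \<le> V" for m b V
      proof -
        let ?v = "\<lambda>j. loo n L lam p ts m G Y j - ts j"
        have "\<bar>\<Sum>j\<in>{..<n} - {m}. (adj G m j - p) * ?v j\<bar> \<le>
            8 * (l * vnorm_inf n ?v + sqrt (p * l * (\<Sum>j<n. (?v j)\<^sup>2)))"
          using ok(5) m by (auto simp: E5_def linear_form_violated_def not_less l_def)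
        also have "\<dots> \<le> 8 * (l * b + sqrt (p * l * V))"
        proof (intro mult_left_mono add_mono real_sqrt_le_mono)
          show "vnorm_inf n ?v \<le> b" using n by (intro vnorm_inf_le b) auto
        qed (use l p V in auto)
        finally show ?thesis .
      qed
    qed
    have close: "\<bar>x k - ts k\<bar> \<le> K * eps" if "k < n" for k
      unfolding K_def using c0(2) that by (rule event.sup_norm_bound)
    \<comment> \<open>From \<open>c0 * l \<le> n p\<close> and \<open>L \<ge> 1\<close> one gets
      \<open>eps^2 \<le> 1 / c0\<close>, and \<open>c0\<close> dominates \<open>(2 * K)^2\<close>.
      This yields interiority and the smallness required for comparing exponentials.\<close>
    have small: "K * eps \<le> 1 / 2"
    proof -
      have "(2 * K * eps)\<^sup>2 = (2 * K)\<^sup>2 * (l / (real n * p * real L))"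
        using l np_pos Lpos by (simp add: eps_def power_mult_distrib)
      also have "\<dots> \<le> c0 * (l / (real n * p * real L))"
        using c0(3) l np_pos Lpos by (intro mult_right_mono) (auto simp: K_def)
      also have "\<dots> \<le> 1"
      proof -
        have "c0 * l \<le> real n * p * 1" using np by (simp add: l_def)
        also have "\<dots> \<le> real n * p * real L"
          using np_pos L by (intro mult_left_mono) auto
        finally show ?thesis using np_pos Lpos by (simp add: divide_le_eq)
      qed
      finally have "(2 * K * eps)\<^sup>2 \<le> 1\<^sup>2" by simp
      then have "2 * K * eps \<le> 1"
        by (rule power2_le_imp_le) simp
      then show ?thesis by simp
    qed
    have lam_pos: "0 < lam"
      using clam l np_pos Lpos by (simp add: lam l_def)
    have "vnorm_inf n (\<lambda>i. exp (\<theta> i) - btl_centered n w i) / vnorm_inf n (btl_centered n w) \<le> 2 * K * eps"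
      if mle: "btl_is_reg_mle n L lam G Y \<theta>" for \<theta>
    proof -
      have eq: "\<theta> k = x k" if "k < n" for k
      proof (rule stationary_eq_interior_minimizer[of "adj G" "obs L Y" n lam p ts])
        show "\<bar>x i - ts i\<bar> < 1" if "i < n" for i
          using close[OF that] small by linarith
        show "pgrad n (adj G) (obs L Y) lam p \<theta> i = 0" if "i < n" for i
          using mle lam_pos that by (rule mle_stationary)
        show "obs L Y j i = 1 - obs L Y i j" if "adj G i j \<noteq> 0" for i j
          using that by (rule flip)
      qed (use x lam_pos p that in \<open>auto simp: adj_sym adj_bounds\<close>)
      have centered: "btl_centered n w i = exp (ts i)" if "i < n" for i
        using that by (simp add: btl_centered_def ts_def mean_def)
      have pos: "0 < vnorm_inf n (btl_centered n w)"
        using vnorm_inf_ge[of 0 n "btl_centered n w"] n by (simp add: centered less_le_trans[OF exp_gt_zero])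
      have "vnorm_inf n (\<lambda>i. exp (\<theta> i) - btl_centered n w i) \<le> vnorm_inf n (btl_centered n w) * (2 * K * eps)"
      proof (rule vnorm_inf_le)
        fix j assume j: "j < n"
        have "\<bar>exp (\<theta> j) - btl_centered n w j\<bar> \<le> exp (ts j) * (2 * \<bar>x j - ts j\<bar>)"
          unfolding centered[OF j] eq[OF j] using close[OF j] small by (intro exp_relative_error) linarith
        also have "\<dots> \<le> vnorm_inf n (btl_centered n w) * (2 * K * eps)"
        proof (rule mult_mono)
          show "exp (ts j) \<le> vnorm_inf n (btl_centered n w)"
            using vnorm_inf_ge[OF j, of "btl_centered n w"] by (simp add: centered[OF j])
          show "2 * \<bar>x j - ts j\<bar> \<le> 2 * K * eps"
            using close[OF j] by simp
        qed (use pos in auto)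
        finally show "\<bar>exp (\<theta> j) - btl_centered n w j\<bar> \<le> vnorm_inf n (btl_centered n w) * (2 * K * eps)" .
      qed (use n in simp)
      then show ?thesis
        using pos by (simp add: divide_le_eq mult.commute)
    qed
    then show ?thesis by (simp add: good_def)
  qed
  have "UNIV \<subseteq> good \<union> ({(G, Y). E1 G} \<union> ({(G, Y). E2 G} \<union> ({(G, Y). E3 Y} \<union> ({(G, Y). E4 G Y} \<union> {(G, Y). E5 G Y}))))"
    using det by auto
  then have "1 \<le> measure_pmf.prob P (good \<union> ({(G, Y). E1 G} \<union> ({(G, Y). E2 G} \<union> ({(G, Y). E3 Y} \<union> ({(G, Y). E4 G Y} \<union> {(G, Y). E5 G Y})))))"
    by (simp add: top.extremum_unique measure_pmf.prob_space[simplified])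
  also have "\<dots> \<le> measure_pmf.prob P good + (measure_pmf.prob P {(G, Y). E1 G} + (measure_pmf.prob P {(G, Y). E2 G}
      + (measure_pmf.prob P {(G, Y). E3 Y} + (measure_pmf.prob P {(G, Y). E4 G Y} + measure_pmf.prob P {(G, Y). E5 G Y}))))"
    by (intro order_trans[OF measure_Un_le] add_left_mono) auto
  also have "\<dots> \<le> measure_pmf.prob P good + (4 / real n ^ 5 + (1 / real n ^ 5 + (2 / real n ^ 5 + (2 / real n ^ 5 + 2 / real n ^ 5))))"
    using P1 P2 P3 P4 P5 by (intro add_mono) auto
  finally have "1 \<le> measure_pmf.prob P good + 11 / real n ^ 5"
    by simp
  then show ?thesis
    unfolding good_def P_def K_def eps_def l_def by simp
qed

theorem theorem4:
  fixes kappa0 c2 c3 c_lam :: real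
  assumes "kappa0 \<ge> 1" "c2 > 0" "c3 > 0" "c_lam > 0"
  shows "\<exists>c0>0. \<exists>C>0. \<exists>C'>0. \<forall>(n::nat) (p::real) (L::nat) (w::nat \<Rightarrow> real) (wmin::real) (wmax::real) (lam::real).
    (n \<ge> 2 \<and> 0 < wmin \<and> (\<forall>i<n. wmin \<le> w i \<and> w i \<le> wmax)
     \<and> (\<forall>i j. i \<le> j \<and> j < n \<longrightarrow> w j \<le> w i)
     \<and> wmax / wmin \<le> kappa0
     \<and> c0 * ln (real n) / real n \<le> p \<and> p \<le> 1
     \<and> L \<ge> 1 \<and> real L \<le> c2 * real n powr c3
     \<and> lam = c_lam * sqrt (real n * p * ln (real n) / real L))
    \<longrightarrow> measure_pmf.prob (pair_pmf (btl_edges_pmf n p) (btl_comp_pmf n L w))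
          {(G, Y). \<forall>\<theta>. btl_is_reg_mle n L lam G Y \<theta> \<longrightarrow>
             vnorm_inf n (\<lambda>i. exp (\<theta> i) - btl_centered n w i) / vnorm_inf n (btl_centered n w)
               \<le> C * sqrt (ln (real n) / (real n * p * real L))}
        \<ge> 1 - C' / real n ^ 5"
proof -
  \<comment> \<open>The centred scores are bounded by the range of \<open>ln (w i)\<close>. The
    constants exported from the locale depend on \<open>B\<close> and \<open>c_lam\<close> only,
    hence are fixed before \<open>n\<close>, \<open>p\<close>, \<open>L\<close> and
    \<open>w\<close>.\<close>
  define B where "B = ln kappa0"
  define K where "K = btl_event.K_sup B c_lam"
  define c0 where "c0 = max 512 (max (16 * (8 + 30 * btl_event.K_loo B)) ((2 * K)\<^sup>2))"
  \<comment> \<open>The maximum with 1 makes \<open>C\<close> positive at once; the sign of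
    \<open>K_sup\<close> is established only under the assumptions of the locale.\<close>
  define C where "C = max 1 (2 * K)"
  have c0: "512 \<le> c0" "16 * (8 + 30 * btl_event.K_loo B) \<le> c0" "(2 * K)\<^sup>2 \<le> c0"
    by (auto simp: c0_def)
  have whp: "1 - 11 / real n ^ 5 \<le> measure_pmf.prob (pair_pmf (btl_edges_pmf n p) (btl_comp_pmf n L w))
          {(G, Y). \<forall>\<theta>. btl_is_reg_mle n L lam G Y \<theta> \<longrightarrow>
             vnorm_inf n (\<lambda>i. exp (\<theta> i) - btl_centered n w i) / vnorm_inf n (btl_centered n w)
               \<le> C * sqrt (ln (real n) / (real n * p * real L))}"
    if n: "n \<ge> 2" and w: "0 < wmin" "\<forall>i<n. wmin \<le> w i \<and> w i \<le> wmax" and kappa: "wmax / wmin \<le> kappa0"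
      and p: "c0 * ln (real n) / real n \<le> p" "p \<le> 1" and L: "L \<ge> 1"
      and lam: "lam = c_lam * sqrt (real n * p * ln (real n) / real L)"
    for n L :: nat and p wmin wmax lam :: real and w :: "nat \<Rightarrow> real"
  proof -
    have "wmin \<le> w 0" "w 0 \<le> wmax" using w(2) n by auto
    then have "0 < wmax" using w(1) by linarith
    then have B: "ln (wmax / wmin) \<le> B"
      unfolding B_def using w(1) kappa assms(1) by (subst ln_le_cancel_iff) auto
    have np: "c0 * ln (real n) \<le> real n * p"
      using p(1) n by (simp add: divide_le_eq mult.commute)
    have sqrt0: "0 \<le> sqrt (ln (real n) / (real n * p * real L))"
    proof -
      have "0 < ln (real n)" using n by simp
      then have "0 \<le> c0 * ln (real n)" using c0(1) by (intro mult_nonneg_nonneg) auto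
      then have "0 \<le> real n * p" using np by linarith
      then show ?thesis using \<open>0 < ln (real n)\<close> by simp
    qed
    have "1 - 11 / real n ^ 5 \<le> measure_pmf.prob (pair_pmf (btl_edges_pmf n p) (btl_comp_pmf n L w))
          {(G, Y). \<forall>\<theta>. btl_is_reg_mle n L lam G Y \<theta> \<longrightarrow>
             vnorm_inf n (\<lambda>i. exp (\<theta> i) - btl_centered n w i) / vnorm_inf n (btl_centered n w)
               \<le> 2 * K * sqrt (ln (real n) / (real n * p * real L))}"
      unfolding K_def
      by (rule btl_sup_norm_whp[OF n w(1) _ B np p(2) L lam assms(4) c0(1,2) c0(3)[unfolded K_def]])
         (use w(2) in auto)
    also have "\<dots> \<le> measure_pmf.prob (pair_pmf (btl_edges_pmf n p) (btl_comp_pmf n L w))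
          {(G, Y). \<forall>\<theta>. btl_is_reg_mle n L lam G Y \<theta> \<longrightarrow>
             vnorm_inf n (\<lambda>i. exp (\<theta> i) - btl_centered n w i) / vnorm_inf n (btl_centered n w)
               \<le> C * sqrt (ln (real n) / (real n * p * real L))}"
    proof (intro measure_pmf.finite_measure_mono)
      have "2 * K * sqrt (ln (real n) / (real n * p * real L)) \<le> C * sqrt (ln (real n) / (real n * p * real L))"
        using sqrt0 by (intro mult_right_mono) (auto simp: C_def)
      then show "{(G, Y). \<forall>\<theta>. btl_is_reg_mle n L lam G Y \<theta> \<longrightarrow>
             vnorm_inf n (\<lambda>i. exp (\<theta> i) - btl_centered n w i) / vnorm_inf n (btl_centered n w)
               \<le> 2 * K * sqrt (ln (real n) / (real n * p * real L))}
          \<subseteq> {(G, Y). \<forall>\<theta>. btl_is_reg_mle n L lam G Y \<theta> \<longrightarrow>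
             vnorm_inf n (\<lambda>i. exp (\<theta> i) - btl_centered n w i) / vnorm_inf n (btl_centered n w)
               \<le> C * sqrt (ln (real n) / (real n * p * real L))}"
        by (auto intro: order_trans)
    qed simp
    finally show ?thesis .
  qed
  have pos: "0 < c0" "0 < C" "0 < (11::real)"
    using c0(1) by (auto simp: C_def)
  show ?thesis
    by (rule exI[of _ c0], rule conjI[OF pos(1)], rule exI[of _ C], rule conjI[OF pos(2)],
        rule exI[of _ 11], rule conjI[OF pos(3)], intro allI impI, elim conjE, rule whp) assumption+
qed

end
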